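(* Let $\mu\in\mathcal M_1(\mathcal S)$, $T\in(0,\infty)$ and assume $$H:=\sup_{v,w\in\mathcal M(\mathcal S\times\mathbb N)\colon\|v\|_1,\|w\|_1\le1}\langle v,Kw\rangle<\infty.$$ Fix any $\beta>0$ and some function $f\colon\mathbb N\to[0,\infty)$ with $f(r)/r\to\infty$ as $r\to\infty$. Let $(\nu_n)_{n\in\mathbb N}$ be a sequence in $\mathcal A_{f,\beta}$ that converges weakly towards some $\nu\in\mathcal M(\Gamma_T^{(1)})$ that has finite entropy $\mathcal H(\nu|M_{b\mu}^{(T)})<\infty$ for some $b>0$ with $|M_{b\mu}^{(T)}|<\infty$. Then $\rho(\nu_n)\to\rho(\nu)$ in $\mathbb D_T(\mathcal M(\mathcal S\times\mathbb N))$ as $n\to\infty$.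
   Context: Notation. $\mathcal S$ is a Polish space, $\mathbb N=\{1,2,\dots\}$, $\mathbb N_0=\{0,1,\dots\}$. $\mathcal M(\mathcal X)$ is the set of finite positive Borel measures on $\mathcal X$ with the weak topology; $\mathcal M_1(\mathcal X)$ the probability measures, $\mathcal M_{\mathbb N_0}(\mathcal X)$ the finite $\mathbb N_0$-valued (point) measures. $|\mathfrak m|$ is the total mass, $\langle\mathfrak m,g\rangle$ the integral of $g$; for a measure $v$ on $\mathcal S\times\mathbb N$, $\|v\|_1=\sum_{m\in\mathbb N}m\,v(\mathcal S\times\{m\})$. $\mathrm{Poi}_\lambda$ is the law of a Poisson point process with intensity measure $\lambda$. $\mathbb D_T(\mathcal X)$ is the space of càdlàg paths $[0,T]\to\mathcal X$ with the Skorohod $J_1$-topology. Process. The coagulation kernel $K\colon(\mathcal S\times\mathbb N)^2\to[0,\infty)$ is measurable and symmetric; the placement kernel $\Upsilon$ is a Markov kernel from $(\mathcal S\times\mathbb N)^2$ to $\mathcal S$, symmetric in its first two arguments. Write $K\phi(y)=\int K(y,y')\,\phi(\mathrm dy')$. The Marcus--Lushnikov process $\Xi=(\Xi_t)_{t\ge0}$ is the Markov jump process on $\mathcal M_{\mathbb N_0}(\mathcal S\times\mathbb N)$, $\Xi_t=\sum_i\delta_{(X_i(t),M_i(t))}$, in which each unordered pair of particles at $(x,m)$, $(x',m')$ is, independently, at rate $K((x,m),(x',m'))$ replaced by one particle of mass $m+m'$ at a random location sampled from $\Upsilon((x,m),(x',m'),\cdot)$. $\mathbb P_k$ is its law when started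 from $k\in\mathcal M_{\mathbb N_0}(\mathcal S)$, all initial particles having mass one ($k$ is identified with $k\otimes\delta_1$); under $\mathbb P_0$ the process is constantly zero. Trajectories. $\Gamma_T^{(1)}\subset\mathbb D_T(\mathcal M_{\mathbb N_0}(\mathcal S\times\mathbb N))$ is the set of paths $\xi=(\xi_t)_{t\in[0,T]}$ with $\xi_0$ concentrated on $\mathcal S\times\{1\}$ that are piecewise constant with all jumps of the form $\phi\mapsto\phi-\delta_{(x,m)}-\delta_{(x',m')}+\delta_{(z,m+m')}$ and satisfy $\xi_T(\mathcal S\times\mathbb N)=1$. $|\xi_0|$ is the number of atoms of $\xi_0$. $\mathcal A_{f,\beta}=\{\nu\in\mathcal M(\Gamma_T^{(1)})\colon\int\nu(\mathrm d\xi)\,f(|\xi_0|)\le\beta\}$. For $\nu\in\mathcal M(\Gamma_T^{(1)})$ with $\int\nu(\mathrm d\xi)|\xi_0|<\infty$, $\rho(\nu)=(\rho_t(\nu))_{t\in[0,T]}=\big(\int\nu(\mathrm d\xi)\,\xi_t\big)_{t\in[0,T]}$. Reference measure. $\varphi_k(\xi)=\frac12\int_0^T[\langle\xi_t,K\xi_t\rangle-\langle\xi_t,K^{\mathrm{diag}}\rangle]\,\mathrm dt$, $K^{\mathrm{diag}}(y)=K(y,y)$; $\mathbb Q_k^{(T)}(\mathrm d\xi)=\mathrm e^{\varphi_k(\xi)}\,\mathbb P_k((\Xi_t)_{t\in[0,T]}\in\mathrm d\xi)$ restricted to $\Gamma_T^{(1)}$; $M_{b\mu}^{(T)}(\mathrm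 d\xi)=\mathrm e\int\mathrm{Poi}_{b\mu}(\mathrm dk)\,\mathbb Q_k^{(T)}(\mathrm d\xi)$. Relative entropy of finite measures: $\mathcal H(m|p)=\int\log\frac{\mathrm dm}{\mathrm dp}\,\mathrm dm+|p|-|m|$ if $m\ll p$, $=\infty$ otherwise. *)

theory Defs
  imports "HOL-Probability.Probability"
begin

section \<open>Finite measures on a topological space and the weak topology\<close>

definition borel_of :: "'a topology \<Rightarrow> 'a measure" where
  "borel_of X = sigma (topspace X) {U. openin X U}"

definition finite_measures :: "'a topology \<Rightarrow> 'a measure set" where
  "finite_measures X = {\<mu>. finite_measure \<mu> \<and> sets \<mu> = sets (borel_of X)}"

definition probability_measures :: "'a topology \<Rightarrow> 'a measure set" where
  "probability_measures X = {\<mu> \<in> finite_measures X. prob_space \<mu>}"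

definition point_measures :: "'a topology \<Rightarrow> 'a measure set" where
  "point_measures X = {\<phi> \<in> finite_measures X. \<forall>A\<in>sets \<phi>. \<exists>n::nat. emeasure \<phi> A = of_nat n}"

definition weak_topology :: "'a topology \<Rightarrow> 'a measure topology" where
  "weak_topology X = topology_generated_by
     {{\<mu> \<in> finite_measures X. (\<integral>x. g x \<partial>\<mu>) \<in> U} | g U.
        continuous_map X euclideanreal g \<and> bounded (g ` topspace X) \<and> open U}"

definition point_measure_topology :: "'a topology \<Rightarrow> 'a measure topology" where
  "point_measure_topology X = subtopology (weak_topology X) (point_measures X)"

definition total_mass :: "'a measure \<Rightarrow> real" where
  "total_mass \<mu> = measure \<mu> (space \<mu>)"

definition num_atoms :: "'a measure \<Rightarrow> nat" where
  "num_atoms \<phi> = nat \<lfloor>total_mass \<phi>\<rfloor>"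

lemma topspace_weak_topology: "topspace (weak_topology X) = finite_measures X"
proof -
  have "finite_measures X \<in> {{\<mu> \<in> finite_measures X. (\<integral>x. g x \<partial>\<mu>) \<in> U} | g U.
        continuous_map X euclideanreal g \<and> bounded (g ` topspace X) \<and> open U}"
  proof -
    have "finite_measures X = {\<mu> \<in> finite_measures X. (\<integral>x. (0::real) \<partial>\<mu>) \<in> UNIV}" by simp
    moreover have "bounded ((\<lambda>x. 0::real) ` topspace X)"
      by (rule bounded_subset[of "{0}"]) auto
    ultimately show ?thesis
      by (intro CollectI exI[of _ "\<lambda>x. 0::real"] exI[of _ UNIV]) simp
  qed
  then show ?thesis
    unfolding weak_topology_def topology_generated_by_topspace by blast
qed


section \<open>Cadlag paths and the Skorohod \<open>J\<^sub>1\<close>-topology\<close>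

text \<open>A path on \<open>[0,T]\<close> is represented by a function that is \<open>undefined\<close> outside \<open>[0,T]\<close>.\<close>

definition cadlag :: "real \<Rightarrow> 'a topology \<Rightarrow> (real \<Rightarrow> 'a) set" where
  "cadlag T X = {\<xi> \<in> {0..T} \<rightarrow>\<^sub>E topspace X.
     (\<forall>t\<in>{0..<T}. limitin X \<xi> (\<xi> t) (at_right t)) \<and>
     (\<forall>t\<in>{0<..T}. \<exists>l. limitin X \<xi> l (at_left t))}"

definition time_changes :: "real \<Rightarrow> (real \<Rightarrow> real) set" where
  "time_changes T = {\<tau>. strict_mono_on {0..T} \<tau> \<and> \<tau> ` {0..T} = {0..T}}"

definition skorohod_dist ::
  "real \<Rightarrow> ('a \<Rightarrow> 'a \<Rightarrow> real) \<Rightarrow> (real \<Rightarrow> 'a) \<Rightarrow> (real \<Rightarrow> 'a) \<Rightarrow> ennreal" where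
  "skorohod_dist T d \<xi> \<eta> = (INF \<tau>\<in>time_changes T. SUP t\<in>{0..T}.
     max (ennreal \<bar>\<tau> t - t\<bar>) (ennreal (d (\<xi> t) (\<eta> (\<tau> t)))))"

definition continuous_pseudometric :: "'a topology \<Rightarrow> ('a \<Rightarrow> 'a \<Rightarrow> real) \<Rightarrow> bool" where
  "continuous_pseudometric X d \<longleftrightarrow>
     (\<forall>x\<in>topspace X. d x x = 0) \<and>
     (\<forall>x\<in>topspace X. \<forall>y\<in>topspace X. d x y = d y x) \<and>
     (\<forall>x\<in>topspace X. \<forall>y\<in>topspace X. \<forall>z\<in>topspace X. d x z \<le> d x y + d y z) \<and>
     continuous_map (prod_topology X X) euclideanreal (\<lambda>(x, y). d x y)"

text \<open>
  The usual definition of the \<open>J\<^sub>1\<close>-topology starts from a metric that induces the topology of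
  \<open>X\<close>, and the result does not depend on that metric.  To have a definition that involves only the
  topology, all continuous pseudometrics are used here; lemma \<open>openin_skorohod_metric\<close> shows that
  for every metric inducing the topology of \<open>X\<close> this is the topology of the Skorohod metric.
\<close>

definition skorohod_topology :: "real \<Rightarrow> 'a topology \<Rightarrow> (real \<Rightarrow> 'a) topology" where
  "skorohod_topology T X = topology (\<lambda>U. U \<subseteq> cadlag T X \<and>
     (\<forall>\<xi>\<in>U. \<exists>d \<epsilon>. continuous_pseudometric X d \<and> \<epsilon> > 0 \<and>
        {\<eta> \<in> cadlag T X. skorohod_dist T d \<xi> \<eta> < \<epsilon>} \<subseteq> U))"

lemma skorohod_dist_mono:
  assumes "\<xi> \<in> {0..T} \<rightarrow>\<^sub>E M" "\<eta> \<in> {0..T} \<rightarrow>\<^sub>E M" "\<And>x y. x \<in> M \<Longrightarrow> y \<in> M \<Longrightarrow> d x y \<le> e x y"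
  shows "skorohod_dist T d \<xi> \<eta> \<le> skorohod_dist T e \<xi> \<eta>"
  unfolding skorohod_dist_def
proof (intro INF_mono)
  fix \<tau> assume \<tau>: "\<tau> \<in> time_changes T"
  have "d (\<xi> t) (\<eta> (\<tau> t)) \<le> e (\<xi> t) (\<eta> (\<tau> t))" if "t \<in> {0..T}" for t
  proof -
    have "\<tau> t \<in> {0..T}" using \<tau> that by (auto simp: time_changes_def)
    then show ?thesis using assms that by (auto simp: PiE_iff)
  qed
  then have "(SUP t\<in>{0..T}. max (ennreal \<bar>\<tau> t - t\<bar>) (ennreal (d (\<xi> t) (\<eta> (\<tau> t)))))
    \<le> (SUP t\<in>{0..T}. max (ennreal \<bar>\<tau> t - t\<bar>) (ennreal (e (\<xi> t) (\<eta> (\<tau> t)))))"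
    by (intro SUP_mono) (meson ennreal_leI max.mono order_refl)
  then show "\<exists>\<tau>'\<in>time_changes T. (SUP t\<in>{0..T}. max (ennreal \<bar>\<tau>' t - t\<bar>) (ennreal (d (\<xi> t) (\<eta> (\<tau>' t)))))
    \<le> (SUP t\<in>{0..T}. max (ennreal \<bar>\<tau> t - t\<bar>) (ennreal (e (\<xi> t) (\<eta> (\<tau> t)))))"
    using \<tau> by blast
qed

lemma continuous_pseudometric_nonneg:
  assumes "continuous_pseudometric X d" "x \<in> topspace X" "y \<in> topspace X"
  shows "0 \<le> d x y"
proof -
  have "d x x \<le> d x y + d y x" "d x x = 0" "d x y = d y x"
    using assms unfolding continuous_pseudometric_def by blast+
  then show ?thesis by linarith
qed

lemma continuous_pseudometric_add:
  assumes d: "continuous_pseudometric X d" and e: "continuous_pseudometric X e"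
  shows "continuous_pseudometric X (\<lambda>x y. d x y + e x y)"
proof -
  have tr: "d x z + e x z \<le> (d x y + e x y) + (d y z + e y z)"
    if "x \<in> topspace X" "y \<in> topspace X" "z \<in> topspace X" for x y z
  proof -
    have "d x z \<le> d x y + d y z" "e x z \<le> e x y + e y z"
      using d e that unfolding continuous_pseudometric_def by blast+
    then show ?thesis by linarith
  qed
  have "continuous_map (prod_topology X X) euclideanreal
          (\<lambda>p. (case p of (x, y) \<Rightarrow> d x y) + (case p of (x, y) \<Rightarrow> e x y))"
    using d e unfolding continuous_pseudometric_def by (intro continuous_map_add) blast+
  then have "continuous_map (prod_topology X X) euclideanreal (\<lambda>(x, y). d x y + e x y)"
    by (simp add: case_prod_unfold)
  then show ?thesis
    using d e tr unfolding continuous_pseudometric_def by (simp add: add.commute)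
qed

lemma continuous_pseudometric_zero: "continuous_pseudometric X (\<lambda>x y. 0)"
  unfolding continuous_pseudometric_def by (simp add: case_prod_unfold)

lemma cadlag_PiE: "\<xi> \<in> cadlag T X \<Longrightarrow> \<xi> \<in> {0..T} \<rightarrow>\<^sub>E topspace X"
  by (simp add: cadlag_def)

lemma openin_skorohod:
  "openin (skorohod_topology T X) U \<longleftrightarrow> U \<subseteq> cadlag T X \<and>
     (\<forall>\<xi>\<in>U. \<exists>d \<epsilon>. continuous_pseudometric X d \<and> \<epsilon> > 0 \<and>
        {\<eta> \<in> cadlag T X. skorohod_dist T d \<xi> \<eta> < \<epsilon>} \<subseteq> U)"
proof -
  let ?P = "\<lambda>U. U \<subseteq> cadlag T X \<and>
     (\<forall>\<xi>\<in>U. \<exists>d \<epsilon>. continuous_pseudometric X d \<and> \<epsilon> > 0 \<and>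
        {\<eta> \<in> cadlag T X. skorohod_dist T d \<xi> \<eta> < \<epsilon>} \<subseteq> U)"
  have "istopology ?P"
    unfolding istopology_def
  proof (intro conjI allI impI)
    fix U V assume U: "?P U" and V: "?P V"
    show "U \<inter> V \<subseteq> cadlag T X" using conjunct1[OF U] by blast
    show "\<forall>\<xi>\<in>U \<inter> V. \<exists>d \<epsilon>. continuous_pseudometric X d \<and> \<epsilon> > 0 \<and>
        {\<eta> \<in> cadlag T X. skorohod_dist T d \<xi> \<eta> < \<epsilon>} \<subseteq> U \<inter> V"
    proof
      fix \<xi> assume \<xi>: "\<xi> \<in> U \<inter> V"
      from U \<xi> obtain d \<delta> where d: "continuous_pseudometric X d" "\<delta> > 0"
        "{\<eta> \<in> cadlag T X. skorohod_dist T d \<xi> \<eta> < \<delta>} \<subseteq> U" by blast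
      from V \<xi> obtain e \<epsilon> where e: "continuous_pseudometric X e" "\<epsilon> > 0"
        "{\<eta> \<in> cadlag T X. skorohod_dist T e \<xi> \<eta> < \<epsilon>} \<subseteq> V" by blast
      let ?s = "\<lambda>x y. d x y + e x y"
      have \<xi>D: "\<xi> \<in> {0..T} \<rightarrow>\<^sub>E topspace X" by (rule cadlag_PiE, rule subsetD[OF conjunct1[OF U]]) (use \<xi> in simp)
      have "skorohod_dist T d \<xi> \<eta> \<le> skorohod_dist T ?s \<xi> \<eta>"
           "skorohod_dist T e \<xi> \<eta> \<le> skorohod_dist T ?s \<xi> \<eta>" if "\<eta> \<in> cadlag T X" for \<eta>
        by (rule skorohod_dist_mono[OF \<xi>D cadlag_PiE[OF that]],
            simp add: continuous_pseudometric_nonneg[OF e(1)] continuous_pseudometric_nonneg[OF d(1)])+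
      then have "{\<eta> \<in> cadlag T X. skorohod_dist T ?s \<xi> \<eta> < min \<delta> \<epsilon>} \<subseteq> U \<inter> V"
        using d(3) e(3) by (fastforce dest: le_less_trans)
      moreover have "min \<delta> \<epsilon> > 0" using d e by simp
      ultimately show "\<exists>d \<epsilon>. continuous_pseudometric X d \<and> \<epsilon> > 0 \<and>
          {\<eta> \<in> cadlag T X. skorohod_dist T d \<xi> \<eta> < \<epsilon>} \<subseteq> U \<inter> V"
        using continuous_pseudometric_add[OF d(1) e(1)] by blast
    qed
  next
    fix \<U> assume U: "\<forall>U\<in>\<U>. ?P U"
    show "\<Union>\<U> \<subseteq> cadlag T X" using U by blast
    show "\<forall>\<xi>\<in>\<Union>\<U>. \<exists>d \<epsilon>. continuous_pseudometric X d \<and> \<epsilon> > 0 \<and>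
        {\<eta> \<in> cadlag T X. skorohod_dist T d \<xi> \<eta> < \<epsilon>} \<subseteq> \<Union>\<U>"
    proof
      fix \<xi> assume "\<xi> \<in> \<Union>\<U>"
      then obtain V where V: "V \<in> \<U>" "\<xi> \<in> V" by blast
      with U obtain d \<epsilon> where "continuous_pseudometric X d" "\<epsilon> > 0"
        "{\<eta> \<in> cadlag T X. skorohod_dist T d \<xi> \<eta> < \<epsilon>} \<subseteq> V" by blast
      with V show "\<exists>d \<epsilon>. continuous_pseudometric X d \<and> \<epsilon> > 0 \<and>
        {\<eta> \<in> cadlag T X. skorohod_dist T d \<xi> \<eta> < \<epsilon>} \<subseteq> \<Union>\<U>" by blast
    qed
  qed
  then show ?thesis
    unfolding skorohod_topology_def by (simp add: topology_inverse')
qed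

lemma topspace_skorohod_topology: "topspace (skorohod_topology T X) = cadlag T X"
proof -
  have "openin (skorohod_topology T X) (cadlag T X)"
    unfolding openin_skorohod using continuous_pseudometric_zero[of X]
    by (auto intro!: exI[of _ "\<lambda>x y. 0"] exI[of _ "1::ennreal"])
  then show ?thesis
    by (metis openin_skorohod openin_subset openin_topspace subset_antisym)
qed

lemma (in Metric_space) continuous_pseudometric_metric: "continuous_pseudometric mtopology d"
proof -
  have "continuous_map (prod_topology mtopology mtopology) euclideanreal (\<lambda>(x, y). d x y)"
    using continuous_map_metric[of "metric (M, d)"] by (simp add: Metric_space_axioms mtopology_of_def)
  then show ?thesis
    unfolding continuous_pseudometric_def using triangle commute by auto
qed

lemma (in Metric_space) openin_skorohod_metric:
  assumes "T > 0"
  shows "openin (skorohod_topology T mtopology) U \<longleftrightarrow> U \<subseteq> cadlag T mtopology \<and>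
     (\<forall>\<xi>\<in>U. \<exists>\<epsilon>>0. {\<eta> \<in> cadlag T mtopology. skorohod_dist T d \<xi> \<eta> < \<epsilon>} \<subseteq> U)"
  (is "?L \<longleftrightarrow> ?R")
proof
  assume ?R
  then show ?L
    unfolding openin_skorohod using continuous_pseudometric_metric by blast
next
  assume L: ?L
  show ?R
  proof (intro conjI ballI)
    show "U \<subseteq> cadlag T mtopology" using L by (simp add: openin_skorohod)
    fix \<xi> assume "\<xi> \<in> U"
    with L obtain e \<epsilon> where e: "continuous_pseudometric mtopology e" and \<epsilon>: "\<epsilon> > 0"
      and sub: "{\<eta> \<in> cadlag T mtopology. skorohod_dist T e \<xi> \<eta> < \<epsilon>} \<subseteq> U"
      and \<xi>: "\<xi> \<in> cadlag T mtopology"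
      unfolding openin_skorohod by blast
    obtain c where c: "0 < c" "ennreal c < \<epsilon>"
    proof (cases "\<epsilon> = \<infinity>")
      case True then show ?thesis using that[of 1] by simp
    next
      case False
      then obtain r where r: "\<epsilon> = ennreal r" "0 < r"
        by (metis \<epsilon> ennreal_cases ennreal_less_zero_iff infinity_ennreal_def)
      then show ?thesis using that[of "r/2"] by (simp add: ennreal_lessI)
    qed
    have \<xi>M: "\<xi> s \<in> M" if "s \<in> {0..T}" for s
      using \<xi> that by (auto simp: cadlag_def PiE_iff)
    have sym: "e x y = e y x" and tri: "e x z \<le> e x y + e y z"
      if "x \<in> M" "y \<in> M" "z \<in> M" for x y z
      using e that unfolding continuous_pseudometric_def topspace_mtopology by blast+
    have near: "\<exists>r>0. \<forall>u v. u \<in> M \<longrightarrow> v \<in> M \<longrightarrow> d l u < r \<longrightarrow> d u v < r \<longrightarrow> e u v < c"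
      if l: "l \<in> M" for l
    proof -
      have pm: "continuous_map mtopology (prod_topology mtopology mtopology) (\<lambda>y. (l, y))"
        using l by (auto intro!: continuous_map_pairedI)
      have "continuous_map mtopology euclideanreal ((\<lambda>(x, y). e x y) \<circ> (\<lambda>y. (l, y)))"
        using e pm unfolding continuous_pseudometric_def by (blast intro: continuous_map_compose)
      then have "continuous_map mtopology euclideanreal (\<lambda>y. e l y)"
        by (simp add: comp_def)
      then have "openin mtopology {y \<in> topspace mtopology. e l y \<in> {..<c/2}}"
        by (rule openin_continuous_map_preimage) auto
      moreover have "l \<in> {y \<in> topspace mtopology. e l y \<in> {..<c/2}}"
        using l c e by (simp add: continuous_pseudometric_def)
      ultimately obtain r where r: "r > 0" "mball l r \<subseteq> {y \<in> topspace mtopology. e l y \<in> {..<c/2}}"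
        by (meson openin_mtopology)
      show ?thesis
      proof (intro exI[of _ "r/2"] conjI allI impI)
        fix u v assume uv: "u \<in> M" "v \<in> M" "d l u < r/2" "d u v < r/2"
        have "d l v \<le> d l u + d u v" using triangle l uv by blast
        then have "u \<in> mball l r" "v \<in> mball l r" using uv l r(1) by auto
        with r(2) have "e l u < c/2" "e l v < c/2" by auto
        then show "e u v < c" using tri[of u l v] sym[of u l] l uv by fastforce
      qed (use r in simp)
    qed
    have "\<exists>\<delta>>0. \<forall>s\<in>{0..T}. \<forall>v\<in>M. d (\<xi> s) v < \<delta> \<longrightarrow> e (\<xi> s) v < c"
    proof -
      define P where "P a b \<longleftrightarrow>
        (\<exists>\<delta>>0. \<forall>s\<in>{a..b} \<inter> {0..T}. \<forall>v\<in>M. d (\<xi> s) v < \<delta> \<longrightarrow> e (\<xi> s) v < c)" for a b :: real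
      have "P 0 T"
      proof (rule Bolzano)
        show "0 \<le> T" using assms by simp
      next
        fix a b b' assume "P a b" "P b b'" "a \<le> b" "b \<le> b'"
        then obtain \<delta> \<delta>' where
          "\<delta> > 0" "\<forall>s\<in>{a..b} \<inter> {0..T}. \<forall>v\<in>M. d (\<xi> s) v < \<delta> \<longrightarrow> e (\<xi> s) v < c"
          "\<delta>' > 0" "\<forall>s\<in>{b..b'} \<inter> {0..T}. \<forall>v\<in>M. d (\<xi> s) v < \<delta>' \<longrightarrow> e (\<xi> s) v < c"
          unfolding P_def by blast
        moreover have "{a..b'} = {a..b} \<union> {b..b'}" using \<open>a \<le> b\<close> \<open>b \<le> b'\<close> by auto
        ultimately show "P a b'"
          unfolding P_def by (intro exI[of _ "min \<delta> \<delta>'"]) auto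
      next
        fix x assume x: "0 \<le> x" "x \<le> T"
        obtain r0 where r0: "r0 > 0" and
          r0': "\<And>u v. u \<in> M \<Longrightarrow> v \<in> M \<Longrightarrow> d (\<xi> x) u < r0 \<Longrightarrow> d u v < r0 \<Longrightarrow> e u v < c"
          using near[OF \<xi>M[of x]] x by auto
        have right: "\<exists>b>x. \<forall>s\<in>{x..<b}\<inter>{0..T}. d (\<xi> x) (\<xi> s) < r0"
        proof (cases "x < T")
          case True
          then have "limitin mtopology \<xi> (\<xi> x) (at_right x)"
            using \<xi> x by (simp add: cadlag_def)
          then have "\<forall>\<^sub>F s in at_right x. \<xi> s \<in> M \<and> d (\<xi> s) (\<xi> x) < r0"
            using r0 by (simp add: limitin_metric)
          then obtain b where "b > x" "\<forall>s>x. s < b \<longrightarrow> \<xi> s \<in> M \<and> d (\<xi> s) (\<xi> x) < r0"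
            unfolding eventually_at_right_field by blast
          then show ?thesis using \<xi>M[of x] x r0 by (intro exI[of _ b]) (auto simp: commute less_le)
        next
          case False
          then show ?thesis using x r0 \<xi>M[of x] by (intro exI[of _ "x+1"]) auto
        qed
        have left: "\<exists>a<x. \<exists>r>0. \<forall>s\<in>{a<..<x}\<inter>{0..T}. \<forall>v\<in>M. d (\<xi> s) v < r \<longrightarrow> e (\<xi> s) v < c"
        proof (cases "0 < x")
          case True
          then have "x \<in> {0<..T}" using x by simp
          then obtain l where l: "limitin mtopology \<xi> l (at_left x)"
            using \<xi> unfolding cadlag_def by blast
          then have lM: "l \<in> M" by (simp add: limitin_metric)
          obtain r where r: "r > 0" and
            r': "\<And>u v. u \<in> M \<Longrightarrow> v \<in> M \<Longrightarrow> d l u < r \<Longrightarrow> d u v < r \<Longrightarrow> e u v < c"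
            using near[OF lM] by auto
          have "\<forall>\<^sub>F s in at_left x. \<xi> s \<in> M \<and> d (\<xi> s) l < r"
            using l r by (simp add: limitin_metric)
          then obtain a where "a < x" "\<forall>s>a. s < x \<longrightarrow> \<xi> s \<in> M \<and> d (\<xi> s) l < r"
            unfolding eventually_at_left_field by blast
          then show ?thesis using r r' by (intro exI[of _ a] conjI exI[of _ r]) (auto simp: commute)
        next
          case False
          then show ?thesis using x by (intro exI[of _ "x-1"] conjI exI[of _ "1::real"]) auto
        qed
        obtain b where b: "b > x" "\<forall>s\<in>{x..<b}\<inter>{0..T}. d (\<xi> x) (\<xi> s) < r0" using right by blast
        obtain a r where a: "a < x" "r > 0"
          "\<forall>s\<in>{a<..<x}\<inter>{0..T}. \<forall>v\<in>M. d (\<xi> s) v < r \<longrightarrow> e (\<xi> s) v < c" using left by blast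
        show "\<exists>k>0. \<forall>p q. p \<le> x \<and> x \<le> q \<and> q - p < k \<longrightarrow> P p q"
        proof (intro exI[of _ "min (x - a) (b - x)"] conjI allI impI)
          show "0 < min (x - a) (b - x)" using a b by simp
          fix p q assume pq: "p \<le> x \<and> x \<le> q \<and> q - p < min (x - a) (b - x)"
          show "P p q" unfolding P_def
          proof (intro exI[of _ "min r r0"] conjI ballI impI)
            show "0 < min r r0" using a r0 by simp
            fix s v assume s: "s \<in> {p..q} \<inter> {0..T}" and v: "v \<in> M" "d (\<xi> s) v < min r r0"
            show "e (\<xi> s) v < c"
            proof (cases "s < x")
              case True
              then have "s \<in> {a<..<x} \<inter> {0..T}" using s pq by auto
              then show ?thesis using a(3) v by auto
            next
              case False
              then have "s \<in> {x..<b} \<inter> {0..T}" using s pq by auto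
              then show ?thesis using b(2) v r0' \<xi>M s by auto
            qed
          qed
        qed
      qed
      then obtain \<delta> where "\<delta> > 0"
        "\<forall>s\<in>{0..T} \<inter> {0..T}. \<forall>v\<in>M. d (\<xi> s) v < \<delta> \<longrightarrow> e (\<xi> s) v < c" unfolding P_def by blast
      then show ?thesis by auto
    qed
    then obtain \<delta> where \<delta>: "\<delta> > 0" "\<And>s v. s \<in> {0..T} \<Longrightarrow> v \<in> M \<Longrightarrow> d (\<xi> s) v < \<delta> \<Longrightarrow> e (\<xi> s) v < c"
      by blast
    have "skorohod_dist T e \<xi> \<eta> < \<epsilon>"
      if \<eta>: "\<eta> \<in> cadlag T mtopology" and less: "skorohod_dist T d \<xi> \<eta> < ennreal (min c \<delta>)" for \<eta>
    proof -
      obtain \<tau> where \<tau>: "\<tau> \<in> time_changes T" and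
        *: "(SUP t\<in>{0..T}. max (ennreal \<bar>\<tau> t - t\<bar>) (ennreal (d (\<xi> t) (\<eta> (\<tau> t))))) < ennreal (min c \<delta>)"
        using less unfolding skorohod_dist_def INF_less_iff by blast
      have "max (ennreal \<bar>\<tau> t - t\<bar>) (ennreal (e (\<xi> t) (\<eta> (\<tau> t)))) \<le> ennreal c" if t: "t \<in> {0..T}" for t
      proof -
        have "max (ennreal \<bar>\<tau> t - t\<bar>) (ennreal (d (\<xi> t) (\<eta> (\<tau> t)))) < ennreal (min c \<delta>)"
          using * t by (meson SUP_upper le_less_trans)
        then have "\<bar>\<tau> t - t\<bar> < c" "d (\<xi> t) (\<eta> (\<tau> t)) < \<delta>" by (auto simp: ennreal_less_iff)
        moreover have "\<eta> (\<tau> t) \<in> M" using \<tau> t \<eta> by (auto simp: time_changes_def cadlag_def PiE_iff)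
        ultimately show ?thesis using \<delta>(2) t by (simp add: ennreal_leI less_imp_le)
      qed
      then have "skorohod_dist T e \<xi> \<eta> \<le> ennreal c"
        unfolding skorohod_dist_def by (intro INF_lower2[OF \<tau>] SUP_least)
      then show ?thesis using c(2) by (rule le_less_trans)
    qed
    then show "\<exists>\<epsilon>>0. {\<eta> \<in> cadlag T mtopology. skorohod_dist T d \<xi> \<eta> < \<epsilon>} \<subseteq> U"
      using sub c \<delta> by (intro exI[of _ "ennreal (min c \<delta>)"]) auto
  qed
qed

section \<open>Poisson point processes\<close>

definition is_poisson_law :: "'a topology \<Rightarrow> 'a measure \<Rightarrow> 'a measure measure \<Rightarrow> bool" where
  "is_poisson_law X \<kappa> P \<longleftrightarrow>
     prob_space P \<and> sets P = sets (borel_of (point_measure_topology X)) \<and>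
     (\<forall>A\<in>sets (borel_of X). \<forall>n::nat. measure P {k \<in> space P. emeasure k A = of_nat n} =
        exp (- measure \<kappa> A) * measure \<kappa> A ^ n / fact n) \<and>
     (\<forall>(A :: nat \<Rightarrow> 'a set) I. range A \<subseteq> sets (borel_of X) \<longrightarrow> finite I \<longrightarrow> disjoint_family_on A I \<longrightarrow>
        prob_space.indep_vars P (\<lambda>_. borel) (\<lambda>i k. emeasure k (A i)) I)"

text \<open>For a finite intensity measure on a Polish space this law exists and is unique.\<close>

definition poisson_law :: "'a topology \<Rightarrow> 'a measure \<Rightarrow> 'a measure measure" where
  "poisson_law X \<kappa> = (THE P. is_poisson_law X \<kappa> P)"


section \<open>Particle configurations and coagulation\<close>

text \<open>A particle is a pair of a location and a mass; masses are positive.\<close>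

definition particles :: "('a::polish_space \<times> nat) topology" where
  "particles = top_of_set (UNIV \<times> {1..})"

abbreviation configurations :: "('a::polish_space \<times> nat) measure topology" where
  "configurations \<equiv> point_measure_topology particles"

definition coagulation_kernel ::
  "('a::polish_space \<times> nat \<Rightarrow> 'a \<times> nat \<Rightarrow> real) \<Rightarrow> bool" where
  "coagulation_kernel K \<longleftrightarrow>
     case_prod K \<in> borel_measurable (borel_of particles \<Otimes>\<^sub>M borel_of particles) \<and>
     (\<forall>y\<in>topspace particles. \<forall>y'\<in>topspace particles. 0 \<le> K y y' \<and> K y y' = K y' y)"

definition placement_kernel ::
  "('a::polish_space \<times> nat \<Rightarrow> 'a \<times> nat \<Rightarrow> 'a measure) \<Rightarrow> bool" where
  "placement_kernel \<Upsilon> \<longleftrightarrow>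
     case_prod \<Upsilon> \<in> borel_of particles \<Otimes>\<^sub>M borel_of particles \<rightarrow>\<^sub>M prob_algebra borel \<and>
     (\<forall>y\<in>topspace particles. \<forall>y'\<in>topspace particles. \<Upsilon> y y' = \<Upsilon> y' y)"

text \<open>The configuration \<open>\<phi> - \<delta>\<^sub>y - \<delta>\<^sub>y\<^sub>' + \<delta>\<^bsub>(z,m+m')\<^esub>\<close>, where \<open>m\<close> and \<open>m'\<close> are the masses of \<open>y\<close> and \<open>y'\<close>.
  It is only used when \<open>\<delta>\<^sub>y + \<delta>\<^sub>y\<^sub>' \<le> \<phi>\<close>.\<close>

definition coagulate ::
  "('a \<times> nat) measure \<Rightarrow> 'a \<times> nat \<Rightarrow> 'a \<times> nat \<Rightarrow> 'a \<Rightarrow> ('a \<times> nat) measure" where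
  "coagulate \<phi> y y' z = measure_of (space \<phi>) (sets \<phi>)
     (\<lambda>A. emeasure \<phi> A - indicator A y - indicator A y' + indicator A (z, snd y + snd y'))"

definition coagulation_jump ::
  "('a::polish_space \<times> nat) measure \<Rightarrow> ('a \<times> nat) measure \<Rightarrow> bool" where
  "coagulation_jump \<phi> \<psi> \<longleftrightarrow> (\<exists>y\<in>topspace particles. \<exists>y'\<in>topspace particles. \<exists>z.
     (\<forall>A\<in>sets \<phi>. indicator A y + indicator A y' \<le> emeasure \<phi> A) \<and> \<psi> = coagulate \<phi> y y' z)"


section \<open>The Marcus--Lushnikov process\<close>

text \<open>
  \<open>ml_jump K \<Upsilon> \<phi> F\<close> is the integral of \<open>F\<close> against the jump rate measure of the process in state \<open>\<phi>\<close>: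
  integrating \<open>y\<close> against \<open>\<phi>\<close> and then \<open>y'\<close> against \<open>\<phi> - \<delta>\<^sub>y\<close> enumerates the ordered pairs of
  distinct particles, so that division by two leaves the sum over unordered pairs.
\<close>

definition ml_jump ::
  "('a::polish_space \<times> nat \<Rightarrow> 'a \<times> nat \<Rightarrow> real) \<Rightarrow> ('a \<times> nat \<Rightarrow> 'a \<times> nat \<Rightarrow> 'a measure) \<Rightarrow>
   ('a \<times> nat) measure \<Rightarrow> (('a \<times> nat) measure \<Rightarrow> ennreal) \<Rightarrow> ennreal" where
  "ml_jump K \<Upsilon> \<phi> F =
     (\<integral>\<^sup>+y. (\<integral>\<^sup>+y'. ennreal (K y y') * (\<integral>\<^sup>+z. F (coagulate \<phi> y y' z) \<partial>\<Upsilon> y y')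
        \<partial>diff_measure \<phi> (return \<phi> y)) \<partial>\<phi>) / 2"

definition ml_total_rate ::
  "('a::polish_space \<times> nat \<Rightarrow> 'a \<times> nat \<Rightarrow> real) \<Rightarrow> ('a \<times> nat \<Rightarrow> 'a \<times> nat \<Rightarrow> 'a measure) \<Rightarrow>
   ('a \<times> nat) measure \<Rightarrow> real" where
  "ml_total_rate K \<Upsilon> \<phi> = enn2real (ml_jump K \<Upsilon> \<phi> (\<lambda>_. 1))"

text \<open>
  The law of the Markov jump process is described by its holding times and jumps.  In
  state \<open>\<phi>\<close> the process waits for an exponential time with parameter \<open>q(\<phi>)\<close> and then jumps according
  to \<open>J(\<phi>, \<cdot>) / q(\<phi>)\<close>, where \<open>J(\<phi>, \<cdot>)\<close> is the jump rate measure and \<open>q(\<phi>)\<close> its total mass; the joint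
  law of holding time and new state therefore is \<open>exp (- q(\<phi>) u) J(\<phi>, d\<psi>) du\<close>, also if \<open>q(\<phi>) = 0\<close>.
  \<open>ml_prob K \<Upsilon> T n s \<xi> A\<close> is the probability, given the path \<open>\<xi>\<close> up to time \<open>s\<close>, that there are
  exactly \<open>n\<close> jumps in the remaining time until \<open>T\<close> and that the resulting path lies in \<open>A\<close>; the path \<open>\<xi>\<close> is
  assumed to be constant from \<open>s\<close> on, and it is modified at the next jump.  Since the number of
  particles decreases at each jump, there is no explosion and summing over \<open>n\<close> gives a probability measure.
\<close>

primrec ml_prob ::
  "('a::polish_space \<times> nat \<Rightarrow> 'a \<times> nat \<Rightarrow> real) \<Rightarrow> ('a \<times> nat \<Rightarrow> 'a \<times> nat \<Rightarrow> 'a measure) \<Rightarrow> real \<Rightarrow>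
   nat \<Rightarrow> real \<Rightarrow> (real \<Rightarrow> ('a \<times> nat) measure) \<Rightarrow> (real \<Rightarrow> ('a \<times> nat) measure) set \<Rightarrow> ennreal" where
  "ml_prob K \<Upsilon> T 0 s \<xi> A =
     ennreal (exp (- ml_total_rate K \<Upsilon> (\<xi> s) * (T - s))) * indicator A \<xi>"
| "ml_prob K \<Upsilon> T (Suc n) s \<xi> A =
     (\<integral>\<^sup>+r\<in>{s..T}. ennreal (exp (- ml_total_rate K \<Upsilon> (\<xi> s) * (r - s))) *
        ml_jump K \<Upsilon> (\<xi> s) (\<lambda>\<psi>. ml_prob K \<Upsilon> T n r (\<lambda>t\<in>{0..T}. if t < r then \<xi> t else \<psi>) A) \<partial>lborel)"

definition monodisperse :: "'a::polish_space measure \<Rightarrow> ('a \<times> nat) measure" where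
  "monodisperse k = distr k (borel_of particles) (\<lambda>x. (x, 1))"

text \<open>The law \<open>P\<^sub>k\<close> of the process on the time interval \<open>[0,T]\<close>, started from \<open>k \<otimes> \<delta>\<^sub>1\<close>.\<close>

definition ml_law ::
  "('a::polish_space \<times> nat \<Rightarrow> 'a \<times> nat \<Rightarrow> real) \<Rightarrow> ('a \<times> nat \<Rightarrow> 'a \<times> nat \<Rightarrow> 'a measure) \<Rightarrow> real \<Rightarrow>
   'a measure \<Rightarrow> (real \<Rightarrow> ('a \<times> nat) measure) measure" where
  "ml_law K \<Upsilon> T k =
     (let D = borel_of (skorohod_topology T configurations) in
      measure_of (space D) (sets D)
        (\<lambda>A. \<Sum>n. ml_prob K \<Upsilon> T n 0 (\<lambda>t\<in>{0..T}. monodisperse k) A))"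


section \<open>Trajectories ending with a single particle, and the reference measure\<close>

definition piecewise_constant_with_jumps ::
  "('s \<Rightarrow> 's \<Rightarrow> bool) \<Rightarrow> real \<Rightarrow> (real \<Rightarrow> 's) \<Rightarrow> bool" where
  "piecewise_constant_with_jumps R T \<xi> \<longleftrightarrow> (\<exists>(n::nat) (t :: nat \<Rightarrow> real).
     t 0 = 0 \<and> t n \<le> T \<and> (\<forall>i<n. t i < t (Suc i)) \<and>
     (\<forall>i<n. \<forall>s\<in>{t i..<t (Suc i)}. \<xi> s = \<xi> (t i)) \<and>
     (\<forall>s\<in>{t n..T}. \<xi> s = \<xi> (t n)) \<and>
     (\<forall>i<n. R (\<xi> (t i)) (\<xi> (t (Suc i)))))"

definition coag_paths :: "real \<Rightarrow> (real \<Rightarrow> ('a::polish_space \<times> nat) measure) set" where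
  "coag_paths T = {\<xi> \<in> cadlag T configurations.
     emeasure (\<xi> 0) (topspace particles - UNIV \<times> {1}) = 0 \<and>
     piecewise_constant_with_jumps coagulation_jump T \<xi> \<and>
     emeasure (\<xi> T) (topspace particles) = 1}"

definition coag_path_topology ::
  "real \<Rightarrow> (real \<Rightarrow> ('a::polish_space \<times> nat) measure) topology" where
  "coag_path_topology T = subtopology (skorohod_topology T configurations) (coag_paths T)"

definition moment_bounded ::
  "real \<Rightarrow> (nat \<Rightarrow> real) \<Rightarrow> real \<Rightarrow> (real \<Rightarrow> ('a::polish_space \<times> nat) measure) measure set" where
  "moment_bounded T f \<beta> = {\<nu> \<in> finite_measures (coag_path_topology T).
     (\<integral>\<^sup>+\<xi>. ennreal (f (num_atoms (\<xi> 0))) \<partial>\<nu>) \<le> ennreal \<beta>}"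

definition rho ::
  "real \<Rightarrow> (real \<Rightarrow> ('a::polish_space \<times> nat) measure) measure \<Rightarrow> real \<Rightarrow> ('a \<times> nat) measure" where
  "rho T \<nu> = (\<lambda>t\<in>{0..T}. measure_of (topspace particles) (sets (borel_of particles))
     (\<lambda>B. \<integral>\<^sup>+\<xi>. emeasure (\<xi> t) B \<partial>\<nu>))"

definition path_exponent ::
  "('a::polish_space \<times> nat \<Rightarrow> 'a \<times> nat \<Rightarrow> real) \<Rightarrow> real \<Rightarrow> (real \<Rightarrow> ('a \<times> nat) measure) \<Rightarrow> real" where
  "path_exponent K T \<xi> = 1/2 * (LINT t:{0..T}|lborel.
     (\<integral>y. (\<integral>y'. K y y' \<partial>\<xi> t) \<partial>\<xi> t) - (\<integral>y. K y y \<partial>\<xi> t))"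

definition tilted_law ::
  "('a::polish_space \<times> nat \<Rightarrow> 'a \<times> nat \<Rightarrow> real) \<Rightarrow> ('a \<times> nat \<Rightarrow> 'a \<times> nat \<Rightarrow> 'a measure) \<Rightarrow> real \<Rightarrow>
   'a measure \<Rightarrow> (real \<Rightarrow> ('a \<times> nat) measure) measure" where
  "tilted_law K \<Upsilon> T k =
     density (restrict_space (ml_law K \<Upsilon> T k) (coag_paths T)) (\<lambda>\<xi>. ennreal (exp (path_exponent K T \<xi>)))"

text \<open>The reference measure with Poisson initial configuration of intensity \<open>\<kappa>\<close>.\<close>

definition reference_measure ::
  "('a::polish_space \<times> nat \<Rightarrow> 'a \<times> nat \<Rightarrow> real) \<Rightarrow> ('a \<times> nat \<Rightarrow> 'a \<times> nat \<Rightarrow> 'a measure) \<Rightarrow> real \<Rightarrow>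
   'a measure \<Rightarrow> (real \<Rightarrow> ('a \<times> nat) measure) measure" where
  "reference_measure K \<Upsilon> T \<kappa> =
     (let G = borel_of (coag_path_topology T) in
      measure_of (space G) (sets G)
        (\<lambda>A. ennreal (exp 1) * (\<integral>\<^sup>+k. emeasure (tilted_law K \<Upsilon> T k) A \<partial>poisson_law euclidean \<kappa>)))"

text \<open>Relative entropy of finite measures.  The integral of the logarithm is taken in the extended
  sense; its negative part is finite because \<open>p\<close> is.\<close>

definition rel_entropy :: "'a measure \<Rightarrow> 'a measure \<Rightarrow> ereal" where
  "rel_entropy m p = (if absolutely_continuous p m
     then enn2ereal (\<integral>\<^sup>+x. ennreal (entropy_density (exp 1) p m x) \<partial>m)
          - enn2ereal (\<integral>\<^sup>+x. ennreal (- entropy_density (exp 1) p m x) \<partial>m)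
          + ereal (total_mass p) - ereal (total_mass m)
     else \<infinity>)"


section \<open>The standing bound on the coagulation kernel\<close>

definition mass_norm :: "('a::polish_space \<times> nat) measure \<Rightarrow> ennreal" where
  "mass_norm v = (\<Sum>m. of_nat m * emeasure v (UNIV \<times> {m}))"

definition kernel_bound :: "('a::polish_space \<times> nat \<Rightarrow> 'a \<times> nat \<Rightarrow> real) \<Rightarrow> ennreal" where
  "kernel_bound K = (SUP (v, w) \<in> {(v, w). v \<in> finite_measures particles \<and> w \<in> finite_measures particles \<and>
       mass_norm v \<le> 1 \<and> mass_norm w \<le> 1}.
     \<integral>\<^sup>+y. (\<integral>\<^sup>+y'. ennreal (K y y') \<partial>w) \<partial>v)"

end

theory Submission
  imports Defs
begin

text \<open>
  For a bounded continuous \<open>g\<close>, the envelope \<open>sup\<^sub>s (\<langle>\<xi>\<^sub>s, g\<rangle> - L |s - t|)\<close> is a Lipschitz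
  functional of \<open>\<xi>\<close> for the Skorohod distance.  It dominates \<open>\<langle>\<xi>\<^sub>r, g\<rangle> - L |r - t|\<close>, and as
  \<open>L \<rightarrow> \<infinity>\<close> it tends to \<open>\<langle>\<xi>\<^sub>t, g\<rangle>\<close> for every path that is continuous at \<open>t\<close>.  The entropy
  bound makes \<open>\<nu>\<close> absolutely continuous with respect to the reference measure, under which the time
  of the next jump has a density, so that \<open>\<nu>\<close>-almost every path is continuous at a given \<open>t\<close>.
  The moment bound yields uniform integrability of \<open>|\<xi>\<^sub>0|\<close>, which bounds \<open>|\<xi>\<^sub>s|\<close> because
  coagulation does not increase the number of particles.  Applying the envelope to \<open>g\<close> and \<open>-g\<close>
  therefore gives \<open>\<rho>\<^sub>s(\<nu>\<^sub>n) \<rightarrow> \<rho>\<^sub>t(\<nu>)\<close> as \<open>n \<rightarrow> \<infinity>\<close> and \<open>s \<rightarrow> t\<close> jointly.  By compactness of \<open>[0,T]\<close> the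
  convergence is uniform in time, and the identity is a suitable time change.
\<close>


section \<open>Weak convergence\<close>

text \<open>Evaluation at an interior time is not continuous on Skorohod space, so neither its
  measurability nor the passage to the limit is immediate; envelopes serve for both. Centred
  slightly to the right of t, they are continuous and converge to the integral at t for every path,
  by right-continuity; this yields the measurability that makes \<open>rho\<close> an honest finite
  measure. Centred at t itself, they converge only along paths without a jump at t, and this is
  where the entropy is needed. The order of limits is essential: the slope is fixed first, using
  only the limit \<nu>, and n tends to infinity afterwards, so that the penalty at the moving time
  vanishes. Single trajectories jump, but their average under \<nu> is continuous in time because no
  fixed time carries jumps with positive mass. A continuous limit is what allows uniform convergence
  in place of a search for time changes. Since neighbourhoods in \<open>skorohod_topology\<close>
  are given by continuous pseudometrics, uniformity is shown for each of these separately and no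
  metric for the weak topology has to be constructed.\<close>

definition bounded_continuous :: "'a topology \<Rightarrow> ('a \<Rightarrow> real) \<Rightarrow> bool" where
  "bounded_continuous X g \<longleftrightarrow> continuous_map X euclideanreal g \<and> bounded (g ` topspace X)"

lemma bounded_continuousI:
  assumes "continuous_map X euclideanreal g" "\<And>x. x \<in> topspace X \<Longrightarrow> \<bar>g x\<bar> \<le> C"
  shows "bounded_continuous X g"
  using assms unfolding bounded_continuous_def bounded_iff by auto

lemma bounded_continuous_const: "bounded_continuous X (\<lambda>_. c)"
  by (rule bounded_continuousI[of _ _ "\<bar>c\<bar>"]) auto

lemma bounded_continuous_uminus: "bounded_continuous X g \<Longrightarrow> bounded_continuous X (\<lambda>x. - g x)"
  unfolding bounded_continuous_def by (auto intro: continuous_map_minus simp: bounded_iff)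

lemma bounded_continuousE:
  assumes "bounded_continuous X g"
  obtains C where "0 \<le> C" "\<And>x. x \<in> topspace X \<Longrightarrow> \<bar>g x\<bar> \<le> C"
proof -
  obtain C where C: "\<forall>x\<in>topspace X. \<bar>g x\<bar> \<le> C"
    using assms unfolding bounded_continuous_def bounded_iff by auto
  show ?thesis by (rule that[of "max C 0"]) (use C in force)+
qed

lemma sets_borel_of: "sets (borel_of X) = sigma_sets (topspace X) {U. openin X U}"
  unfolding borel_of_def by (auto intro!: sets_measure_of dest: openin_subset)

lemma space_borel_of [simp]: "space (borel_of X) = topspace X"
  unfolding borel_of_def by (auto intro!: space_measure_of dest: openin_subset)

lemma borel_of_openin: "openin X U \<Longrightarrow> U \<in> sets (borel_of X)"
  unfolding sets_borel_of by auto

lemma finite_measuresD: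
  assumes "m \<in> finite_measures X"
  shows "finite_measure m" "sets m = sets (borel_of X)" "space m = topspace X"
  using assms sets_eq_imp_space_eq[of m "borel_of X"] unfolding finite_measures_def by auto

lemma continuous_map_borel_measurable:
  assumes "continuous_map X euclideanreal g" "sets m = sets (borel_of X)"
  shows "g \<in> borel_measurable m"
proof (rule borel_measurableI)
  fix U :: "real set" assume "open U"
  then have "openin X {x \<in> topspace X. g x \<in> U}"
    by (intro openin_continuous_map_preimage[OF assms(1)]) auto
  moreover have "g -` U \<inter> space m = {x \<in> topspace X. g x \<in> U}"
    using sets_eq_imp_space_eq[OF assms(2)] by auto
  ultimately show "g -` U \<inter> space m \<in> sets m"
    using borel_of_openin assms(2) by metis
qed

lemma (in finite_measure) bounded_integral:
  fixes g :: "'a \<Rightarrow> real"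
  assumes "g \<in> borel_measurable M" "\<And>x. x \<in> space M \<Longrightarrow> \<bar>g x\<bar> \<le> C"
  shows "integrable M g" "\<bar>\<integral>x. g x \<partial>M\<bar> \<le> C * total_mass M"
proof -
  show i: "integrable M g"
    by (rule integrable_const_bound[of _ C]) (use assms in auto)
  have "\<bar>\<integral>x. g x \<partial>M\<bar> \<le> (\<integral>x. \<bar>g x\<bar> \<partial>M)" by (rule integral_abs_bound)
  also have "\<dots> \<le> (\<integral>x. C \<partial>M)" using assms i by (intro integral_mono) auto
  finally show "\<bar>\<integral>x. g x \<partial>M\<bar> \<le> C * total_mass M" by (simp add: total_mass_def mult.commute)
qed

lemma finite_measures_integral:
  assumes "m \<in> finite_measures X" "continuous_map X euclideanreal g"
    and "\<And>x. x \<in> topspace X \<Longrightarrow> \<bar>g x\<bar> \<le> C"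
  shows "integrable m g" "\<bar>\<integral>x. g x \<partial>m\<bar> \<le> C * total_mass m"
  using finite_measure.bounded_integral[of m g C] finite_measuresD[OF assms(1)]
    continuous_map_borel_measurable[OF assms(2)] assms(3) by auto

lemma continuous_map_integral:
  assumes "bounded_continuous X g"
  shows "continuous_map (weak_topology X) euclideanreal (\<lambda>m. \<integral>x. g x \<partial>m)"
  unfolding continuous_map_def topspace_weak_topology
proof (intro conjI allI impI)
  fix U :: "real set" assume "openin euclideanreal U"
  then show "openin (weak_topology X) {m \<in> finite_measures X. (\<integral>x. g x \<partial>m) \<in> U}"
    unfolding weak_topology_def
    by (intro topology_generated_by_Basis) (use assms in \<open>auto simp: bounded_continuous_def\<close>)
qed auto

text \<open>The sets that define \<open>weak_topology\<close> form only a subbase; induction over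
  \<open>generate_topology_on\<close> carries the test-function condition through finite
  intersections and unions. Eventual membership is a separate clause because integrals alone do not
  detect it.\<close>

lemma limitin_weak_topology:
  "limitin (weak_topology X) m l F \<longleftrightarrow> l \<in> finite_measures X \<and>
     (\<forall>\<^sub>F i in F. m i \<in> finite_measures X) \<and>
     (\<forall>g. bounded_continuous X g \<longrightarrow> ((\<lambda>i. \<integral>x. g x \<partial>m i) \<longlongrightarrow> (\<integral>x. g x \<partial>l)) F)" (is "?L \<longleftrightarrow> ?R")
proof
  assume L: ?L
  have l: "l \<in> finite_measures X" using L by (simp add: limitin_def topspace_weak_topology)
  have "\<forall>\<^sub>F i in F. m i \<in> finite_measures X"
    using L l unfolding limitin_def topspace_weak_topology
    by (metis openin_topspace topspace_weak_topology)
  moreover have "((\<lambda>i. \<integral>x. g x \<partial>m i) \<longlongrightarrow> (\<integral>x. g x \<partial>l)) F" if "bounded_continuous X g" for g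
    using continuous_map_limit[OF continuous_map_integral[OF that] L] by (simp add: comp_def)
  ultimately show ?R using l by blast
next
  assume R: ?R
  have "\<forall>\<^sub>F i in F. m i \<in> U" if "generate_topology_on {{m \<in> finite_measures X. (\<integral>x. g x \<partial>m) \<in> U} | g U.
        continuous_map X euclideanreal g \<and> bounded (g ` topspace X) \<and> open U} U" "l \<in> U" for U
    using that
  proof (induction rule: generate_topology_on.induct)
    case Empty then show ?case by simp
  next
    case (Int a b) then show ?case by (auto intro: eventually_conj simp: eventually_conj_iff)
  next
    case (UN K)
    then obtain k where k: "k \<in> K" "l \<in> k" by blast
    then show ?case using UN.IH[OF k] by (auto elim: eventually_mono)
  next
    case (Basis s)
    then obtain g V where s: "s = {m \<in> finite_measures X. (\<integral>x. g x \<partial>m) \<in> V}" "bounded_continuous X g" "open V"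
      unfolding bounded_continuous_def by blast
    with Basis.prems R have "\<forall>\<^sub>F i in F. (\<integral>x. g x \<partial>m i) \<in> V"
      by (auto dest!: spec[of _ g] simp: tendsto_def)
    then show ?case using R unfolding s(1) by (auto intro: eventually_elim2)
  qed
  then show ?L
    using R unfolding limitin_def topspace_weak_topology
    by (auto simp: weak_topology_def openin_topology_generated_by_iff)
qed

lemma limitin_subtopology_weak:
  assumes "limitin (subtopology (weak_topology X) S) m l F" "bounded_continuous X g"
  shows "((\<lambda>i. \<integral>x. g x \<partial>m i) \<longlongrightarrow> (\<integral>x. g x \<partial>l)) F"
  using assms by (simp add: limitin_subtopology limitin_weak_topology)


section \<open>Mixtures of finite measures\<close>

text \<open>The intensity measure of the random measure \<kappa> under \<nu>. The definition
  guarantees nothing by itself, as \<open>measure_of\<close> accepts any set function; countable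
  additivity is proved in \<open>finite_kernel\<close>. General kernels are allowed because left
  limits of paths are averaged in the same way as their values.\<close>

definition mixture :: "'b topology \<Rightarrow> 'a measure \<Rightarrow> ('a \<Rightarrow> 'b measure) \<Rightarrow> 'b measure" where
  "mixture X \<nu> \<kappa> = measure_of (topspace X) (sets (borel_of X)) (\<lambda>B. \<integral>\<^sup>+\<xi>. emeasure (\<kappa> \<xi>) B \<partial>\<nu>)"

text \<open>\<open>measure_of\<close> yields either the prescribed value or 0, so an upper bound
  survives even where the set function has not been shown to be a measure.\<close>

lemma emeasure_measure_of_le: "emeasure (measure_of \<Omega> A m) B \<le> m B"
  by (simp add: emeasure_measure_of_conv)

text \<open>The closed sets form an intersection-stable generator, and the indicator of a closed set is a
  decreasing limit of continuous functions.\<close>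

lemma measurable_emeasure_kernel:
  fixes X :: "'b topology"
  assumes zero_set: "\<And>C. closedin X C \<Longrightarrow> \<exists>h. continuous_map X euclideanreal h \<and>
      (\<forall>x\<in>topspace X. 0 \<le> h x \<and> (h x = 0 \<longleftrightarrow> x \<in> C))"
    and fin: "\<And>\<xi>. \<xi> \<in> space \<nu> \<Longrightarrow> \<kappa> \<xi> \<in> finite_measures X"
    and meas: "\<And>g. bounded_continuous X g \<Longrightarrow> (\<lambda>\<xi>. \<integral>x. g x \<partial>\<kappa> \<xi>) \<in> borel_measurable \<nu>"
    and B: "B \<in> sets (borel_of X)"
  shows "(\<lambda>\<xi>. emeasure (\<kappa> \<xi>) B) \<in> borel_measurable \<nu>"
proof -
  let ?S = "topspace X"
  let ?G = "{C. closedin X C}"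
  have fm: "finite_measure (\<kappa> \<xi>)" "sets (\<kappa> \<xi>) = sets (borel_of X)" "space (\<kappa> \<xi>) = ?S" if "\<xi> \<in> space \<nu>" for \<xi>
    using finite_measuresD[OF fin[OF that]] by auto
  have gen: "sets (borel_of X) = sigma_sets ?S ?G"
  proof (rule antisym)
    have "U \<in> sigma_sets ?S ?G" if U: "openin X U" for U
    proof -
      have "closedin X (?S - U)" using openin_closedin_eq[of X U] U by simp
      then have "?S - (?S - U) \<in> sigma_sets ?S ?G" by (intro sigma_sets.Compl sigma_sets.Basic) simp
      then show ?thesis using openin_subset[OF U] by (simp add: double_diff)
    qed
    then show "sets (borel_of X) \<subseteq> sigma_sets ?S ?G"
      unfolding sets_borel_of by (auto intro!: sigma_sets_mono)
    have "C \<in> sets (borel_of X)" if C: "closedin X C" for C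
    proof -
      have "openin X (?S - C)" using C by (simp add: closedin_def)
      then show ?thesis
        using sets.compl_sets[OF borel_of_openin[of X "?S - C"]] closedin_subset[OF C] by (simp add: double_diff)
    qed
    then show "sigma_sets ?S ?G \<subseteq> sets (borel_of X)"
      using sets.sigma_sets_subset[of ?G "borel_of X"] by auto
  qed
  have closed: "(\<lambda>\<xi>. measure (\<kappa> \<xi>) C) \<in> borel_measurable \<nu>" if C: "closedin X C" for C
  proof -
    obtain h where hc: "continuous_map X euclideanreal h"
      and h: "\<And>x. x \<in> ?S \<Longrightarrow> 0 \<le> h x" "\<And>x. x \<in> ?S \<Longrightarrow> h x = 0 \<longleftrightarrow> x \<in> C"
      using zero_set[OF C] by blast
    \<comment> \<open>A tent around C: it equals 1 on C, where h vanishes, and at any other point it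
      is 0 as soon as k exceeds 1 / h x.\<close>
    define g where "g k x = max 0 (1 - real k * h x)" for k x
    have g01: "\<bar>g k x\<bar> \<le> 1" if "x \<in> ?S" for k x using h(1)[OF that] by (auto simp: g_def)
    have gc: "bounded_continuous X (g k)" for k
      unfolding g_def
      by (rule bounded_continuousI[OF _ g01[unfolded g_def]])
        (intro continuous_map_real_max continuous_map_diff continuous_map_real_mult_left hc | simp)+
    have lim: "(\<lambda>k. g k x) \<longlonglongrightarrow> indicator C x" if "x \<in> ?S" for x
    proof (cases "x \<in> C")
      case True
      then have "h x = 0" using h(2)[OF that] by simp
      then show ?thesis using True by (simp add: g_def)
    next
      case F: False
      have pos: "h x > 0" using F h[OF that] by linarith
      obtain k0 where k0: "1 < real k0 * h x" using reals_Archimedean3[OF pos] by blast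
      have "g k x = 0" if "k \<ge> k0" for k
      proof -
        have "real k0 * h x \<le> real k * h x" using that pos by (intro mult_right_mono) auto
        then have "1 - real k * h x \<le> 0" using k0 by linarith
        then show ?thesis by (simp add: g_def)
      qed
      then have "\<forall>\<^sub>F k in sequentially. g k x = 0" unfolding eventually_sequentially by blast
      then show ?thesis using F by (auto intro: tendsto_eventually)
    qed
    have "(\<lambda>k. \<integral>x. g k x \<partial>\<kappa> \<xi>) \<longlonglongrightarrow> measure (\<kappa> \<xi>) C" if \<xi>: "\<xi> \<in> space \<nu>" for \<xi>
    proof -
      interpret finite_measure "\<kappa> \<xi>" using fm[OF \<xi>] by simp
      have Cs: "C \<in> sets (\<kappa> \<xi>)" using C gen fm[OF \<xi>] by auto
      have "(\<lambda>k. \<integral>x. g k x \<partial>\<kappa> \<xi>) \<longlonglongrightarrow> (\<integral>x. indicator C x \<partial>\<kappa> \<xi>)"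
      proof (rule integral_dominated_convergence[where w="\<lambda>_. 1"])
        show "g k \<in> borel_measurable (\<kappa> \<xi>)" for k
          using gc[of k] fm(2)[OF \<xi>] unfolding bounded_continuous_def by (blast intro: continuous_map_borel_measurable)
      qed (use lim Cs g01 fm(3)[OF \<xi>] in auto)
      then show ?thesis using Cs by simp
    qed
    then show ?thesis by (rule borel_measurable_LIMSEQ_real) (auto intro!: meas gc)
  qed
  \<comment> \<open>The induction runs over the real-valued \<open>measure\<close>, since
    complements are handled by subtracting from the finite total mass.\<close>
  have "(\<lambda>\<xi>. measure (\<kappa> \<xi>) B) \<in> borel_measurable \<nu>"
  proof (rule sigma_sets_induct_disjoint[of ?G ?S B])
    show "Int_stable ?G" by (auto simp: Int_stable_def)
    show "?G \<subseteq> Pow ?S" using closedin_subset[of X] by auto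
    show "B \<in> sigma_sets ?S ?G" using B gen by simp
    show "(\<lambda>\<xi>. measure (\<kappa> \<xi>) A) \<in> borel_measurable \<nu>" if "A \<in> ?G" for A using that closed by simp
    show "(\<lambda>\<xi>. measure (\<kappa> \<xi>) {}) \<in> borel_measurable \<nu>" by simp
  next
    fix A assume A: "A \<in> sigma_sets ?S ?G" "(\<lambda>\<xi>. measure (\<kappa> \<xi>) A) \<in> borel_measurable \<nu>"
    have "measure (\<kappa> \<xi>) (?S - A) = measure (\<kappa> \<xi>) ?S - measure (\<kappa> \<xi>) A" if "\<xi> \<in> space \<nu>" for \<xi>
      using finite_measure.finite_measure_compl[OF fm(1)[OF that], of A] fm(2,3)[OF that] A gen by simp
    then show "(\<lambda>\<xi>. measure (\<kappa> \<xi>) (?S - A)) \<in> borel_measurable \<nu>"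
      using A(2) closed[of ?S] by (simp cong: measurable_cong)
  next
    fix A :: "nat \<Rightarrow> 'b set"
    assume A: "disjoint_family A" "range A \<subseteq> sigma_sets ?S ?G"
      and m: "\<And>i. (\<lambda>\<xi>. measure (\<kappa> \<xi>) (A i)) \<in> borel_measurable \<nu>"
    have "measure (\<kappa> \<xi>) (\<Union>i. A i) = (\<Sum>i. measure (\<kappa> \<xi>) (A i))" if "\<xi> \<in> space \<nu>" for \<xi>
      using finite_measure.finite_measure_UNION[OF fm(1)[OF that], of A] fm(2)[OF that] A gen
      by (simp add: sums_iff)
    then show "(\<lambda>\<xi>. measure (\<kappa> \<xi>) (\<Union>i. A i)) \<in> borel_measurable \<nu>"
      using m by (simp cong: measurable_cong)
  qed
  then have "(\<lambda>\<xi>. ennreal (measure (\<kappa> \<xi>) B)) \<in> borel_measurable \<nu>" by measurable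
  then show ?thesis
    using fm(1) by (simp add: finite_measure.emeasure_eq_measure cong: measurable_cong)
qed

text \<open>The particle number is not bounded uniformly over trajectories. An integrable majorant N
  of the masses is enough to make the mixture finite and to integrate bounded functions against
  it.\<close>

locale finite_kernel = finite_measure \<nu> for \<nu> :: "'a measure" +
  fixes X :: "'b topology" and \<kappa> :: "'a \<Rightarrow> 'b measure" and N :: "'a \<Rightarrow> real"
  assumes fin: "\<And>\<xi>. \<xi> \<in> space \<nu> \<Longrightarrow> \<kappa> \<xi> \<in> finite_measures X"
    and meas: "\<And>B. B \<in> sets (borel_of X) \<Longrightarrow> (\<lambda>\<xi>. emeasure (\<kappa> \<xi>) B) \<in> borel_measurable \<nu>"
    and mass: "\<And>\<xi>. \<xi> \<in> space \<nu> \<Longrightarrow> total_mass (\<kappa> \<xi>) \<le> N \<xi>"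
    and N: "integrable \<nu> N"
begin

lemma sets_mixture: "sets (mixture X \<nu> \<kappa>) = sets (borel_of X)"
  unfolding mixture_def
  by (metis sets.sigma_sets_eq sets.space_closed sets_measure_of space_borel_of)

lemma space_mixture: "space (mixture X \<nu> \<kappa>) = topspace X"
  using sets_eq_imp_space_eq[OF sets_mixture] by simp

lemma emeasure_mixture:
  assumes "B \<in> sets (borel_of X)"
  shows "emeasure (mixture X \<nu> \<kappa>) B = (\<integral>\<^sup>+\<xi>. emeasure (\<kappa> \<xi>) B \<partial>\<nu>)"
proof (rule emeasure_measure_of[OF mixture_def])
  show "countably_additive (sets (mixture X \<nu> \<kappa>)) (\<lambda>B. \<integral>\<^sup>+\<xi>. emeasure (\<kappa> \<xi>) B \<partial>\<nu>)"
    unfolding countably_additive_def sets_mixture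
  proof (intro allI impI)
    fix A :: "nat \<Rightarrow> 'b set" assume A: "range A \<subseteq> sets (borel_of X)" "disjoint_family A"
    have "(\<Sum>i. \<integral>\<^sup>+\<xi>. emeasure (\<kappa> \<xi>) (A i) \<partial>\<nu>) = (\<integral>\<^sup>+\<xi>. (\<Sum>i. emeasure (\<kappa> \<xi>) (A i)) \<partial>\<nu>)"
      using A meas by (intro nn_integral_suminf[symmetric]) auto
    also have "\<dots> = (\<integral>\<^sup>+\<xi>. emeasure (\<kappa> \<xi>) (\<Union>i. A i) \<partial>\<nu>)"
      using A finite_measuresD(2)[OF fin] by (intro nn_integral_cong suminf_emeasure) auto
    finally show "(\<Sum>i. \<integral>\<^sup>+\<xi>. emeasure (\<kappa> \<xi>) (A i) \<partial>\<nu>) = (\<integral>\<^sup>+\<xi>. emeasure (\<kappa> \<xi>) (\<Union>i. A i) \<partial>\<nu>)" .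
  qed
qed (use assms sets_mixture sets.sets_into_space[of _ "borel_of X"] in \<open>auto simp: positive_def\<close>)

lemma emeasure_kernel_space: "\<xi> \<in> space \<nu> \<Longrightarrow> emeasure (\<kappa> \<xi>) (topspace X) \<le> ennreal (N \<xi>)"
  using mass[of \<xi>] finite_measuresD[OF fin[of \<xi>]]
  by (simp add: finite_measure.emeasure_eq_measure total_mass_def ennreal_leI)

lemma mixture_finite_measures: "mixture X \<nu> \<kappa> \<in> finite_measures X"
proof -
  have "(\<integral>\<^sup>+\<xi>. emeasure (\<kappa> \<xi>) (topspace X) \<partial>\<nu>) \<le> (\<integral>\<^sup>+\<xi>. ennreal (N \<xi>) \<partial>\<nu>)"
    by (intro nn_integral_mono emeasure_kernel_space)
  also have "\<dots> < \<infinity>" using N by (simp add: real_integrable_def less_top)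
  finally have "finite_measure (mixture X \<nu> \<kappa>)"
    using emeasure_mixture[of "topspace X"] borel_of_openin[of X "topspace X"]
    by (intro finite_measureI) (auto simp: space_mixture)
  then show ?thesis using sets_mixture by (simp add: finite_measures_def)
qed

text \<open>Measurability of the inner integral is part of the claim because the sum and supremum
  cases of the induction need it to exchange operations with the outer integral.\<close>

lemma nn_integral_mixture:
  fixes g :: "'b \<Rightarrow> ennreal"
  assumes "g \<in> borel_measurable (borel_of X)"
  shows "(\<integral>\<^sup>+x. g x \<partial>mixture X \<nu> \<kappa>) = (\<integral>\<^sup>+\<xi>. \<integral>\<^sup>+x. g x \<partial>\<kappa> \<xi> \<partial>\<nu>) \<and>
    (\<lambda>\<xi>. \<integral>\<^sup>+x. g x \<partial>\<kappa> \<xi>) \<in> borel_measurable \<nu>"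
  using assms
proof (induction rule: borel_measurable_induct)
  case (cong f g)
  have 1: "(\<integral>\<^sup>+x. f x \<partial>\<kappa> \<xi>) = (\<integral>\<^sup>+x. g x \<partial>\<kappa> \<xi>)" if "\<xi> \<in> space \<nu>" for \<xi>
    using cong(3) finite_measuresD(3)[OF fin[OF that]] by (intro nn_integral_cong) simp
  have 2: "(\<integral>\<^sup>+x. f x \<partial>mixture X \<nu> \<kappa>) = (\<integral>\<^sup>+x. g x \<partial>mixture X \<nu> \<kappa>)"
    using cong(3) space_mixture by (intro nn_integral_cong) simp
  show ?case using cong(4) unfolding 2[symmetric]
    by (simp add: 1[symmetric] cong: nn_integral_cong measurable_cong)
next
  case (set A)
  have "(\<integral>\<^sup>+x. indicator A x \<partial>\<kappa> \<xi>) = emeasure (\<kappa> \<xi>) A" if "\<xi> \<in> space \<nu>" for \<xi>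
    using set finite_measuresD(2)[OF fin[OF that]] by simp
  moreover have "(\<integral>\<^sup>+x. indicator A x \<partial>mixture X \<nu> \<kappa>) = (\<integral>\<^sup>+\<xi>. emeasure (\<kappa> \<xi>) A \<partial>\<nu>)"
    using set sets_mixture emeasure_mixture by simp
  ultimately show ?case using meas[OF set] by (simp cong: nn_integral_cong measurable_cong)
next
  case (mult u c)
  have "u \<in> borel_measurable (mixture X \<nu> \<kappa>)"
    using mult by (simp add: measurable_cong_sets[OF sets_mixture refl])
  moreover have "(\<integral>\<^sup>+x. c * u x \<partial>\<kappa> \<xi>) = c * (\<integral>\<^sup>+x. u x \<partial>\<kappa> \<xi>)" if "\<xi> \<in> space \<nu>" for \<xi>
    using mult by (intro nn_integral_cmult)
      (simp add: measurable_cong_sets[OF finite_measuresD(2)[OF fin[OF that]] refl])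
  ultimately show ?case
    using mult by (auto simp: nn_integral_cmult cong: nn_integral_cong measurable_cong intro!: borel_measurable_times)
next
  case (add u v)
  have "u \<in> borel_measurable (mixture X \<nu> \<kappa>)" "v \<in> borel_measurable (mixture X \<nu> \<kappa>)"
    using add by (simp_all add: measurable_cong_sets[OF sets_mixture refl])
  moreover have "(\<integral>\<^sup>+x. v x + u x \<partial>\<kappa> \<xi>) = (\<integral>\<^sup>+x. v x \<partial>\<kappa> \<xi>) + (\<integral>\<^sup>+x. u x \<partial>\<kappa> \<xi>)" if "\<xi> \<in> space \<nu>" for \<xi>
    using add by (intro nn_integral_add)
      (simp_all add: measurable_cong_sets[OF finite_measuresD(2)[OF fin[OF that]] refl])
  moreover have "(\<lambda>\<xi>. (\<integral>\<^sup>+x. v x \<partial>\<kappa> \<xi>) + (\<integral>\<^sup>+x. u x \<partial>\<kappa> \<xi>)) \<in> borel_measurable \<nu>"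
    using add by (intro borel_measurable_add) auto
  ultimately show ?case using add by (simp add: nn_integral_add cong: nn_integral_cong measurable_cong)
next
  case (seq U)
  have m: "U i \<in> borel_measurable (mixture X \<nu> \<kappa>)" for i
    using seq by (simp add: measurable_cong_sets[OF sets_mixture refl])
  have k: "(\<integral>\<^sup>+x. (SUP i. U i x) \<partial>\<kappa> \<xi>) = (SUP i. \<integral>\<^sup>+x. U i x \<partial>\<kappa> \<xi>)" if "\<xi> \<in> space \<nu>" for \<xi>
    using seq by (intro nn_integral_monotone_convergence_SUP)
      (simp_all add: measurable_cong_sets[OF finite_measuresD(2)[OF fin[OF that]] refl])
  have inc: "incseq (\<lambda>i \<xi>. \<integral>\<^sup>+x. U i x \<partial>\<kappa> \<xi>)"
    using seq(3) by (auto simp: incseq_def le_fun_def intro!: nn_integral_mono)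
  have "(\<integral>\<^sup>+x. (SUP i. U i x) \<partial>mixture X \<nu> \<kappa>) = (SUP i. \<integral>\<^sup>+x. U i x \<partial>mixture X \<nu> \<kappa>)"
    using seq m by (intro nn_integral_monotone_convergence_SUP)
  also have "\<dots> = (\<integral>\<^sup>+\<xi>. (SUP i. \<integral>\<^sup>+x. U i x \<partial>\<kappa> \<xi>) \<partial>\<nu>)"
    using seq inc by (simp add: nn_integral_monotone_convergence_SUP)
  finally have "(\<integral>\<^sup>+x. (SUP i. U i x) \<partial>mixture X \<nu> \<kappa>) = (\<integral>\<^sup>+\<xi>. (SUP i. \<integral>\<^sup>+x. U i x \<partial>\<kappa> \<xi>) \<partial>\<nu>)" .
  moreover have "(\<lambda>\<xi>. SUP i. \<integral>\<^sup>+x. U i x \<partial>\<kappa> \<xi>) \<in> borel_measurable \<nu>"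
    using seq by (intro borel_measurable_SUP) auto
  ultimately show ?case using seq(4) k by (simp add: SUP_apply image_comp cong: nn_integral_cong measurable_cong)
qed

lemma integral_mixture:
  fixes g :: "'b \<Rightarrow> real"
  assumes g: "g \<in> borel_measurable (borel_of X)" and C: "\<And>x. x \<in> topspace X \<Longrightarrow> \<bar>g x\<bar> \<le> C"
  shows "integrable \<nu> (\<lambda>\<xi>. \<integral>x. g x \<partial>\<kappa> \<xi>)" "(\<integral>x. g x \<partial>mixture X \<nu> \<kappa>) = (\<integral>\<xi>. \<integral>x. g x \<partial>\<kappa> \<xi> \<partial>\<nu>)"
proof -
  have main: "integrable \<nu> (\<lambda>\<xi>. \<integral>x. h x \<partial>\<kappa> \<xi>) \<and> (\<integral>x. h x \<partial>mixture X \<nu> \<kappa>) = (\<integral>\<xi>. \<integral>x. h x \<partial>\<kappa> \<xi> \<partial>\<nu>)"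
    if h: "h \<in> borel_measurable (borel_of X)" and h0: "\<And>x. x \<in> topspace X \<Longrightarrow> 0 \<le> h x"
      and hC: "\<And>x. x \<in> topspace X \<Longrightarrow> h x \<le> D" for h :: "'b \<Rightarrow> real" and D
  proof -
    have hm: "h \<in> borel_measurable (mixture X \<nu> \<kappa>)"
      using h by (simp add: measurable_cong_sets[OF sets_mixture refl])
    have hk: "h \<in> borel_measurable (\<kappa> \<xi>)" if "\<xi> \<in> space \<nu>" for \<xi>
      using h by (simp add: measurable_cong_sets[OF finite_measuresD(2)[OF fin[OF that]] refl])
    have eq: "(\<integral>\<^sup>+x. ennreal (h x) \<partial>\<kappa> \<xi>) = ennreal (\<integral>x. h x \<partial>\<kappa> \<xi>)"
      and nonneg: "0 \<le> (\<integral>x. h x \<partial>\<kappa> \<xi>)" and le: "(\<integral>x. h x \<partial>\<kappa> \<xi>) \<le> \<bar>D\<bar> * N \<xi>" if "\<xi> \<in> space \<nu>" for \<xi>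
    proof -
      have sp: "space (\<kappa> \<xi>) = topspace X" using finite_measuresD(3)[OF fin[OF that]] .
      have *: "integrable (\<kappa> \<xi>) h" "\<bar>\<integral>x. h x \<partial>\<kappa> \<xi>\<bar> \<le> \<bar>D\<bar> * total_mass (\<kappa> \<xi>)"
        using finite_measure.bounded_integral[OF finite_measuresD(1)[OF fin[OF that]] hk[OF that], of "\<bar>D\<bar>"] h0 hC
        by (force simp: sp)+
      show "(\<integral>\<^sup>+x. ennreal (h x) \<partial>\<kappa> \<xi>) = ennreal (\<integral>x. h x \<partial>\<kappa> \<xi>)"
        using *(1) h0 by (intro nn_integral_eq_integral) (auto simp: sp)
      show "0 \<le> (\<integral>x. h x \<partial>\<kappa> \<xi>)" using h0 by (intro Bochner_Integration.integral_nonneg) (auto simp: sp)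
      show "(\<integral>x. h x \<partial>\<kappa> \<xi>) \<le> \<bar>D\<bar> * N \<xi>"
        using *(2) mult_left_mono[OF mass[OF that], of "\<bar>D\<bar>"] by simp
    qed
    have "(\<lambda>x. ennreal (h x)) \<in> borel_measurable (borel_of X)" using h by measurable
    note nn = nn_integral_mixture[OF this]
    have "(\<lambda>\<xi>. enn2real (\<integral>\<^sup>+x. ennreal (h x) \<partial>\<kappa> \<xi>)) \<in> borel_measurable \<nu>"
      by (rule borel_measurable_enn2real[OF conjunct2[OF nn]])
    then have m: "(\<lambda>\<xi>. \<integral>x. h x \<partial>\<kappa> \<xi>) \<in> borel_measurable \<nu>"
      using eq nonneg by (simp cong: measurable_cong)
    have int: "integrable \<nu> (\<lambda>\<xi>. \<integral>x. h x \<partial>\<kappa> \<xi>)"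
    proof (rule Bochner_Integration.integrable_bound)
      show "integrable \<nu> (\<lambda>\<xi>. \<bar>D\<bar> * N \<xi>)" using N by simp
    qed (use m nonneg le in \<open>auto intro!: AE_I2 order_trans[OF le]\<close>)
    have "(\<integral>x. h x \<partial>mixture X \<nu> \<kappa>) = enn2real (\<integral>\<^sup>+x. ennreal (h x) \<partial>mixture X \<nu> \<kappa>)"
      using h0 hm by (intro integral_eq_nn_integral) (auto simp: space_mixture)
    also have "(\<integral>\<^sup>+x. ennreal (h x) \<partial>mixture X \<nu> \<kappa>) = (\<integral>\<^sup>+\<xi>. ennreal (\<integral>x. h x \<partial>\<kappa> \<xi>) \<partial>\<nu>)"
      using nn eq by (simp cong: nn_integral_cong)
    also have "enn2real \<dots> = (\<integral>\<xi>. \<integral>x. h x \<partial>\<kappa> \<xi> \<partial>\<nu>)"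
      using m nonneg by (intro integral_eq_nn_integral[symmetric]) auto
    finally show ?thesis using int by simp
  qed
  \<comment> \<open>C may be negative if the space is empty; D is a nonnegative bound in every
    case.\<close>
  obtain D where D: "0 \<le> D" "\<And>x. x \<in> topspace X \<Longrightarrow> \<bar>g x\<bar> \<le> D"
    using C by (meson abs_ge_self abs_ge_zero order_trans)
  \<comment> \<open>Adding D makes the integrand nonnegative, with values at most 2 * D, so
    \<open>main\<close> applies to it and to the constant D; g is recovered as the
    difference.\<close>
  have a: "integrable \<nu> (\<lambda>\<xi>. \<integral>x. g x + D \<partial>\<kappa> \<xi>) \<and> (\<integral>x. g x + D \<partial>mixture X \<nu> \<kappa>) = (\<integral>\<xi>. \<integral>x. g x + D \<partial>\<kappa> \<xi> \<partial>\<nu>)"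
    by (rule main[where D="2 * D"]) (use g D in force)+
  have b: "integrable \<nu> (\<lambda>\<xi>. \<integral>x. D \<partial>\<kappa> \<xi>) \<and> (\<integral>x. D \<partial>mixture X \<nu> \<kappa>) = (\<integral>\<xi>. \<integral>x. D \<partial>\<kappa> \<xi> \<partial>\<nu>)"
    by (rule main[where D=D]) (use D(1) in auto)
  have split: "(\<integral>x. g x \<partial>m) = (\<integral>x. g x + D \<partial>m) - (\<integral>x. D \<partial>m)" if m: "m \<in> finite_measures X" for m
  proof -
    have "g \<in> borel_measurable m" using g by (simp add: measurable_cong_sets[OF finite_measuresD(2)[OF m] refl])
    then have "integrable m g"
      by (rule finite_measure.bounded_integral(1)[OF finite_measuresD(1)[OF m]])
        (use D finite_measuresD(3)[OF m] in blast)
    moreover have "integrable m (\<lambda>_. D)"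
      by (rule finite_measure.integrable_const[OF finite_measuresD(1)[OF m]])
    ultimately have "(\<integral>x. g x + D \<partial>m) = (\<integral>x. g x \<partial>m) + (\<integral>x. D \<partial>m)"
      by (rule Bochner_Integration.integral_add)
    then show ?thesis by simp
  qed
  have s: "(\<integral>x. g x \<partial>\<kappa> \<xi>) = (\<integral>x. g x + D \<partial>\<kappa> \<xi>) - (\<integral>x. D \<partial>\<kappa> \<xi>)" if "\<xi> \<in> space \<nu>" for \<xi>
    by (rule split[OF fin[OF that]])
  show "integrable \<nu> (\<lambda>\<xi>. \<integral>x. g x \<partial>\<kappa> \<xi>)"
  proof (subst Bochner_Integration.integrable_cong[OF refl s])
    show "integrable \<nu> (\<lambda>\<xi>. (\<integral>x. g x + D \<partial>\<kappa> \<xi>) - (\<integral>x. D \<partial>\<kappa> \<xi>))"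
      using a b by (intro Bochner_Integration.integrable_diff integrable_mult_right) auto
  qed
  have "(\<integral>\<xi>. \<integral>x. g x \<partial>\<kappa> \<xi> \<partial>\<nu>) = (\<integral>\<xi>. (\<integral>x. g x + D \<partial>\<kappa> \<xi>) - (\<integral>x. D \<partial>\<kappa> \<xi>) \<partial>\<nu>)"
    by (intro Bochner_Integration.integral_cong refl s)
  also have "\<dots> = (\<integral>\<xi>. \<integral>x. g x + D \<partial>\<kappa> \<xi> \<partial>\<nu>) - (\<integral>\<xi>. \<integral>x. D \<partial>\<kappa> \<xi> \<partial>\<nu>)"
    using a b by (subst Bochner_Integration.integral_diff) auto
  also have "\<dots> = (\<integral>x. g x \<partial>mixture X \<nu> \<kappa>)"
    by (simp only: a[THEN conjunct2] b[THEN conjunct2] split[OF mixture_finite_measures])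
  finally show "(\<integral>x. g x \<partial>mixture X \<nu> \<kappa>) = (\<integral>\<xi>. \<integral>x. g x \<partial>\<kappa> \<xi> \<partial>\<nu>)" by simp
qed

end


section \<open>Continuous functionals on the Skorohod space\<close>

text \<open>An increasing surjection of the interval cannot move its endpoints. For this reason
  evaluation at 0 and at T, in contrast to interior times, is continuous for the Skorohod
  topology.\<close>

lemma time_changes_fixed:
  assumes "\<tau> \<in> time_changes T" "t \<in> {0, T}" "0 \<le> T"
  shows "\<tau> t = t"
proof -
  have m: "strict_mono_on {0..T} \<tau>" and im: "\<tau> ` {0..T} = {0..T}"
    using assms by (auto simp: time_changes_def)
  have "t \<in> \<tau> ` {0..T}" unfolding im using assms by auto
  then obtain s where s: "s \<in> {0..T}" "t = \<tau> s" by blast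
  have t: "t \<in> {0..T}" "\<tau> t \<in> {0..T}" using assms im by auto
  show ?thesis
  proof (cases "t = 0")
    case True
    then have "\<tau> t \<le> \<tau> s" using strict_mono_onD[OF m, of t s] s t by (cases "s = t") force+
    then show ?thesis using s(2) t True by simp
  next
    case False
    then have "t = T" using assms by simp
    then have "\<tau> s \<le> \<tau> t" using strict_mono_onD[OF m, of s t] s t by (cases "s = t") force+
    then show ?thesis using s(2) t \<open>t = T\<close> by simp
  qed
qed

lemma time_changes_comp:
  assumes "\<sigma> \<in> time_changes T" "\<tau> \<in> time_changes T"
  shows "\<tau> \<circ> \<sigma> \<in> time_changes T"
proof -
  have s: "strict_mono_on {0..T} \<sigma>" "\<sigma> ` {0..T} = {0..T}"
    and t: "strict_mono_on {0..T} \<tau>" "\<tau> ` {0..T} = {0..T}"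
    using assms by (auto simp: time_changes_def)
  have "strict_mono_on {0..T} (\<tau> \<circ> \<sigma>)"
  proof (rule strict_mono_onI)
    fix r u assume *: "r \<in> {0..T}" "u \<in> {0..T}" "r < u"
    then have "\<sigma> r \<in> {0..T}" "\<sigma> u \<in> {0..T}" using s(2) by blast+
    with * show "(\<tau> \<circ> \<sigma>) r < (\<tau> \<circ> \<sigma>) u"
      using strict_mono_onD[OF t(1)] strict_mono_onD[OF s(1)] by simp
  qed
  moreover have "(\<tau> \<circ> \<sigma>) ` {0..T} = {0..T}" by (simp only: image_comp[symmetric] s(2) t(2))
  ultimately show ?thesis by (simp add: time_changes_def)
qed

lemma time_changes_id: "id \<in> time_changes T"
  by (simp add: time_changes_def strict_mono_on_def)

lemma skorohod_dist_lessE: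
  assumes "skorohod_dist T d \<xi> \<eta> < ennreal e"
  obtains \<tau> where "\<tau> \<in> time_changes T"
    "\<And>t. t \<in> {0..T} \<Longrightarrow> \<bar>\<tau> t - t\<bar> < e" "\<And>t. t \<in> {0..T} \<Longrightarrow> d (\<xi> t) (\<eta> (\<tau> t)) < e"
proof -
  obtain \<tau> where \<tau>: "\<tau> \<in> time_changes T"
    and *: "(SUP t\<in>{0..T}. max (ennreal \<bar>\<tau> t - t\<bar>) (ennreal (d (\<xi> t) (\<eta> (\<tau> t))))) < ennreal e"
    using assms unfolding skorohod_dist_def INF_less_iff by blast
  have e: "0 < e" using assms by (metis ennreal_eq_0_iff linorder_not_less not_less_zero)
  have bound: "max (ennreal \<bar>\<tau> t - t\<bar>) (ennreal (d (\<xi> t) (\<eta> (\<tau> t)))) < ennreal e" if "t \<in> {0..T}" for t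
    using * that by (meson SUP_upper le_less_trans)
  then have "\<bar>\<tau> t - t\<bar> < e" "d (\<xi> t) (\<eta> (\<tau> t)) < e" if "t \<in> {0..T}" for t
  proof -
    have *: "x < e" if "ennreal x < ennreal e" for x
      using that e by (cases "0 \<le> x") (auto simp: ennreal_less_iff)
    show "\<bar>\<tau> t - t\<bar> < e" "d (\<xi> t) (\<eta> (\<tau> t)) < e"
      using bound[OF that] by (auto intro!: *)
  qed
  then show ?thesis using that \<tau> by blast
qed

lemma skorohod_dist_leI:
  assumes "\<tau> \<in> time_changes T"
    and "\<And>t. t \<in> {0..T} \<Longrightarrow> \<bar>\<tau> t - t\<bar> \<le> e" "\<And>t. t \<in> {0..T} \<Longrightarrow> d (\<xi> t) (\<eta> (\<tau> t)) \<le> e"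
  shows "skorohod_dist T d \<xi> \<eta> \<le> ennreal e"
  unfolding skorohod_dist_def
  by (intro INF_lower2[OF assms(1)] SUP_least max.boundedI ennreal_leI assms)

text \<open>Composing time changes adds both the displacements in time and the distances in space.
  The infima need not be attained, hence the slack \<open>e/2\<close> for each of the two
  factors.\<close>

lemma skorohod_dist_triangle:
  assumes d: "continuous_pseudometric X d"
    and paths: "\<xi> \<in> cadlag T X" "\<eta> \<in> cadlag T X" "\<zeta> \<in> cadlag T X"
  shows "skorohod_dist T d \<xi> \<zeta> \<le> skorohod_dist T d \<xi> \<eta> + skorohod_dist T d \<eta> \<zeta>"
proof (cases "skorohod_dist T d \<xi> \<eta> < \<infinity> \<and> skorohod_dist T d \<eta> \<zeta> < \<infinity>")
  case True
  obtain a where a: "skorohod_dist T d \<xi> \<eta> = ennreal a" "0 \<le> a"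
    using True by (cases "skorohod_dist T d \<xi> \<eta>") auto
  obtain b where b: "skorohod_dist T d \<eta> \<zeta> = ennreal b" "0 \<le> b"
    using True by (cases "skorohod_dist T d \<eta> \<zeta>") auto
  have "skorohod_dist T d \<xi> \<zeta> \<le> ennreal (a + b) + ennreal e" if e: "0 < e" for e
  proof -
    have "skorohod_dist T d \<xi> \<eta> < ennreal (a + e/2)" "skorohod_dist T d \<eta> \<zeta> < ennreal (b + e/2)"
      using a b e by (auto simp: ennreal_less_iff)
    then obtain \<sigma> \<tau> where
      \<sigma>: "\<sigma> \<in> time_changes T" "\<And>t. t \<in> {0..T} \<Longrightarrow> \<bar>\<sigma> t - t\<bar> < a + e/2"
        "\<And>t. t \<in> {0..T} \<Longrightarrow> d (\<xi> t) (\<eta> (\<sigma> t)) < a + e/2" and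
      \<tau>: "\<tau> \<in> time_changes T" "\<And>t. t \<in> {0..T} \<Longrightarrow> \<bar>\<tau> t - t\<bar> < b + e/2"
        "\<And>t. t \<in> {0..T} \<Longrightarrow> d (\<eta> t) (\<zeta> (\<tau> t)) < b + e/2"
      by (metis skorohod_dist_lessE)
    have "skorohod_dist T d \<xi> \<zeta> \<le> ennreal (a + b + e)"
    proof (rule skorohod_dist_leI[OF time_changes_comp[OF \<sigma>(1) \<tau>(1)]])
      fix t assume t: "t \<in> {0..T}"
      have st: "\<sigma> t \<in> {0..T}" using \<sigma>(1) t by (auto simp: time_changes_def)
      then have tst: "\<tau> (\<sigma> t) \<in> {0..T}" using \<tau>(1) by (auto simp: time_changes_def)
      show "\<bar>(\<tau> \<circ> \<sigma>) t - t\<bar> \<le> a + b + e"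
        using \<sigma>(2)[OF t] \<tau>(2)[OF st] by simp
      have "\<xi> t \<in> topspace X" "\<eta> (\<sigma> t) \<in> topspace X" "\<zeta> (\<tau> (\<sigma> t)) \<in> topspace X"
        using paths t st tst by (auto simp: cadlag_def PiE_iff)
      then have "d (\<xi> t) (\<zeta> (\<tau> (\<sigma> t))) \<le> d (\<xi> t) (\<eta> (\<sigma> t)) + d (\<eta> (\<sigma> t)) (\<zeta> (\<tau> (\<sigma> t)))"
        using d unfolding continuous_pseudometric_def by blast
      then show "d (\<xi> t) (\<zeta> ((\<tau> \<circ> \<sigma>) t)) \<le> a + b + e"
        using \<sigma>(3)[OF t] \<tau>(3)[OF st] by simp
    qed
    then show ?thesis using a b e by simp
  qed
  then have "skorohod_dist T d \<xi> \<zeta> \<le> ennreal (a + b)"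
    by (rule ennreal_le_epsilon) blast
  then show ?thesis using a b by simp
next
  case False
  then have "skorohod_dist T d \<xi> \<eta> + skorohod_dist T d \<eta> \<zeta> = \<top>" by (auto simp: not_less top_unique)
  then show ?thesis by (simp only: top_greatest)
qed

text \<open>The definition of the topology only demands that open sets contain balls around their
  points; that balls are themselves open comes from the triangle inequality.\<close>

lemma openin_skorohod_ball:
  assumes d: "continuous_pseudometric X d" and \<xi>: "\<xi> \<in> cadlag T X"
  shows "openin (skorohod_topology T X) {\<eta> \<in> cadlag T X. skorohod_dist T d \<xi> \<eta> < \<epsilon>}"
  unfolding openin_skorohod
proof (intro conjI ballI)
  fix \<eta> assume "\<eta> \<in> {\<eta> \<in> cadlag T X. skorohod_dist T d \<xi> \<eta> < \<epsilon>}"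
  then have \<eta>: "\<eta> \<in> cadlag T X" and less: "skorohod_dist T d \<xi> \<eta> < \<epsilon>" by auto
  let ?e = "\<epsilon> - skorohod_dist T d \<xi> \<eta>"
  have "skorohod_dist T d \<xi> \<zeta> < \<epsilon>" if \<zeta>: "\<zeta> \<in> cadlag T X" "skorohod_dist T d \<eta> \<zeta> < ?e" for \<zeta>
  proof -
    have "skorohod_dist T d \<xi> \<eta> + skorohod_dist T d \<eta> \<zeta> < skorohod_dist T d \<xi> \<eta> + ?e"
      using less \<zeta>(2) by (simp add: ennreal_add_left_cancel_less less_top order.strict_trans2)
    also have "\<dots> = \<epsilon>" using less by (simp add: ennreal_add_diff_cancel add_diff_inverse_ennreal)
    finally show ?thesis
      using skorohod_dist_triangle[OF d \<xi> \<eta> \<zeta>(1)] by (rule le_less_trans[rotated])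
  qed
  moreover have "?e > 0" using less by (simp add: diff_gr0_ennreal)
  ultimately show "\<exists>d' \<epsilon>'. continuous_pseudometric X d' \<and> \<epsilon>' > 0 \<and>
      {\<zeta> \<in> cadlag T X. skorohod_dist T d' \<eta> \<zeta> < \<epsilon>'} \<subseteq> {\<eta> \<in> cadlag T X. skorohod_dist T d \<xi> \<eta> < \<epsilon>}"
    using d by blast
qed auto

lemma continuous_pseudometric_integral:
  assumes "bounded_continuous X g"
  shows "continuous_pseudometric (subtopology (weak_topology X) S) (\<lambda>m m'. \<bar>(\<integral>x. g x \<partial>m) - (\<integral>x. g x \<partial>m')\<bar>)"
proof -
  let ?W = "subtopology (weak_topology X) S"
  have I: "continuous_map ?W euclideanreal (\<lambda>m. \<integral>x. g x \<partial>m)"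
    by (rule continuous_map_from_subtopology[OF continuous_map_integral[OF assms]])
  have "continuous_map (prod_topology ?W ?W) euclideanreal (\<lambda>p. \<bar>(\<integral>x. g x \<partial>fst p) - (\<integral>x. g x \<partial>snd p)\<bar>)"
    using continuous_map_compose[OF continuous_map_fst I] continuous_map_compose[OF continuous_map_snd I]
    by (intro continuous_map_real_abs continuous_map_diff) (auto simp: comp_def)
  then show ?thesis
    unfolding continuous_pseudometric_def by (auto simp: case_prod_unfold)
qed

text \<open>The single pseudometric that compares integrals of g already controls \<Phi>: a small
  Skorohod distance supplies a time change that meets the premises of \<open>lip\<close>.\<close>

lemma continuous_map_skorohod_functional:
  assumes g: "bounded_continuous X g"
    and lip: "\<And>\<xi> \<eta> \<tau> e. \<xi> \<in> P \<Longrightarrow> \<eta> \<in> P \<Longrightarrow> \<tau> \<in> time_changes T \<Longrightarrow>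
      (\<And>t. t \<in> {0..T} \<Longrightarrow> \<bar>\<tau> t - t\<bar> \<le> e) \<Longrightarrow>
      (\<And>t. t \<in> {0..T} \<Longrightarrow> \<bar>(\<integral>x. g x \<partial>\<xi> t) - (\<integral>x. g x \<partial>\<eta> (\<tau> t))\<bar> \<le> e) \<Longrightarrow> \<bar>\<Phi> \<xi> - \<Phi> \<eta>\<bar> \<le> C * e"
  shows "continuous_map (subtopology (skorohod_topology T (subtopology (weak_topology X) S)) P) euclideanreal \<Phi>"
    (is "continuous_map (subtopology ?Y P) _ _")
  unfolding continuous_map_def
proof (intro conjI allI impI)
  let ?d = "\<lambda>m m'. \<bar>(\<integral>x. g x \<partial>m) - (\<integral>x. g x \<partial>m')\<bar>"
  let ?W = "subtopology (weak_topology X) S"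
  fix V :: "real set" assume "openin euclideanreal V"
  then have V: "open V" by simp
  show "openin (subtopology ?Y P) {\<xi> \<in> topspace (subtopology ?Y P). \<Phi> \<xi> \<in> V}"
  proof (subst openin_subopen, intro ballI)
    fix \<xi> assume "\<xi> \<in> {\<xi> \<in> topspace (subtopology ?Y P). \<Phi> \<xi> \<in> V}"
    then have \<xi>: "\<xi> \<in> cadlag T ?W" "\<xi> \<in> P" "\<Phi> \<xi> \<in> V" by (auto simp: topspace_skorohod_topology)
    then obtain r where r: "0 < r" "ball (\<Phi> \<xi>) r \<subseteq> V" using V open_contains_ball by blast
    \<comment> \<open>Nothing is assumed about the sign of C; the denominator is positive and e is
      chosen so that C * e < r.\<close>
    define e where "e = r / (\<bar>C\<bar> + 1)"
    have e: "0 < e" "C * e < r"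
    proof -
      show "0 < e" using r by (simp add: e_def add_nonneg_pos)
      then have "C * e < (\<bar>C\<bar> + 1) * e" by (intro mult_strict_right_mono) auto
      also have "\<dots> = r" by (simp add: e_def add_nonneg_eq_0_iff)
      finally show "C * e < r" .
    qed
    let ?B = "{\<eta> \<in> cadlag T ?W. skorohod_dist T ?d \<xi> \<eta> < ennreal e}"
    have "openin ?Y ?B"
      by (rule openin_skorohod_ball[OF continuous_pseudometric_integral[OF g] \<xi>(1)])
    then have "openin (subtopology ?Y P) (?B \<inter> P)" by (auto simp: openin_subtopology)
    moreover have "\<xi> \<in> ?B \<inter> P"
    proof -
      have "skorohod_dist T ?d \<xi> \<xi> \<le> ennreal 0" by (rule skorohod_dist_leI[OF time_changes_id]) auto
      then show ?thesis using \<xi> e(1) by (simp add: le_less_trans)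
    qed
    moreover have "\<Phi> \<eta> \<in> V" if \<eta>: "\<eta> \<in> ?B \<inter> P" for \<eta>
    proof -
      obtain \<tau> where "\<tau> \<in> time_changes T" "\<And>t. t \<in> {0..T} \<Longrightarrow> \<bar>\<tau> t - t\<bar> < e"
        "\<And>t. t \<in> {0..T} \<Longrightarrow> ?d (\<xi> t) (\<eta> (\<tau> t)) < e"
        using skorohod_dist_lessE[of T ?d \<xi> \<eta> e] \<eta> by blast
      then have "\<bar>\<Phi> \<xi> - \<Phi> \<eta>\<bar> \<le> C * e" using \<eta> \<xi> by (intro lip[of _ _ \<tau>]) (auto intro: less_imp_le)
      then show ?thesis using r e by (auto simp: dist_real_def)
    qed
    ultimately show "\<exists>U. openin (subtopology ?Y P) U \<and> \<xi> \<in> U \<and> U \<subseteq> {\<xi> \<in> topspace (subtopology ?Y P). \<Phi> \<xi> \<in> V}"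
      by (intro exI[of _ "?B \<inter> P"]) (auto simp: topspace_skorohod_topology)
  qed
qed auto

lemma continuous_map_eval_endpoint:
  assumes "bounded_continuous X g" "t \<in> {0, T}" "0 \<le> T"
  shows "continuous_map (subtopology (skorohod_topology T (subtopology (weak_topology X) S)) P)
    euclideanreal (\<lambda>\<xi>. \<integral>x. g x \<partial>\<xi> t)"
proof (rule continuous_map_skorohod_functional[OF assms(1), where C=1])
  fix \<xi> \<eta> \<tau> e
  assume \<tau>: "\<tau> \<in> time_changes T"
    and "\<And>t. t \<in> {0..T} \<Longrightarrow> \<bar>(\<integral>x. g x \<partial>\<xi> t) - (\<integral>x. g x \<partial>\<eta> (\<tau> t))\<bar> \<le> e"
  from this(2)[of t] show "\<bar>(\<integral>x. g x \<partial>\<xi> t) - (\<integral>x. g x \<partial>\<eta> t)\<bar> \<le> 1 * e"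
    using time_changes_fixed[OF \<tau> assms(2,3)] assms(2,3) by auto
qed

text \<open>Evaluation at a fixed time is not continuous for the Skorohod topology.  Its upper envelopes
  with a penalty that is Lipschitz in time are, because a time change moves both the argument and the
  penalty only slightly.\<close>

definition envelope :: "real \<Rightarrow> real \<Rightarrow> real \<Rightarrow> (real \<Rightarrow> real) \<Rightarrow> real" where
  "envelope T L t h = (SUP s\<in>{0..T}. h s - L * \<bar>s - t\<bar>)"

lemma bdd_above_envelope:
  assumes "\<And>s. s \<in> {0..T} \<Longrightarrow> h s \<le> B" "0 \<le> L"
  shows "bdd_above ((\<lambda>s. h s - L * \<bar>s - t\<bar>) ` {0..T::real})"
  using assms by (intro bdd_aboveI2[of _ _ B]) (smt (verit) abs_ge_zero mult_nonneg_nonneg)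

lemma envelope_upper:
  assumes "\<And>s. s \<in> {0..T} \<Longrightarrow> h s \<le> B" "0 \<le> L" "s \<in> {0..T}"
  shows "h s - L * \<bar>s - t\<bar> \<le> envelope T L t h"
  unfolding envelope_def by (rule cSUP_upper[OF assms(3) bdd_above_envelope[OF assms(1,2)]])

lemma envelope_bound:
  assumes "\<And>s. s \<in> {0..T} \<Longrightarrow> \<bar>h s\<bar> \<le> B" "0 \<le> L" "t \<in> {0..T}"
  shows "\<bar>envelope T L t h\<bar> \<le> B"
proof -
  have "h s \<le> B" if "s \<in> {0..T}" for s using assms(1)[OF that] by simp
  from envelope_upper[where h=h and t=t, OF this assms(2,3)] have "- B \<le> envelope T L t h"
    using assms(1)[OF assms(3)] by simp
  moreover have "envelope T L t h \<le> B" unfolding envelope_def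
  proof (rule cSUP_least)
    fix s assume s: "s \<in> {0..T}"
    have "0 \<le> L * \<bar>s - t\<bar>" using assms(2) by simp
    then show "h s - L * \<bar>s - t\<bar> \<le> B" using assms(1)[OF s] by linarith
  qed (use assms in auto)
  ultimately show ?thesis by simp
qed

text \<open>In the factor 1 + L, the 1 accounts for the change of the values and L for the change of
  the penalty. Surjectivity of \<tau> lets every competitor in the supremum for h' be written as
  \<tau> s, which gives the reverse inequality.\<close>

lemma envelope_time_change:
  assumes "\<And>s. s \<in> {0..T} \<Longrightarrow> h s \<le> B" "\<And>s. s \<in> {0..T} \<Longrightarrow> h' s \<le> B'" "0 \<le> L" "0 \<le> T"
    and \<tau>: "\<tau> \<in> time_changes T" "\<And>s. s \<in> {0..T} \<Longrightarrow> \<bar>\<tau> s - s\<bar> \<le> e"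
    and e: "\<And>s. s \<in> {0..T} \<Longrightarrow> \<bar>h s - h' (\<tau> s)\<bar> \<le> e"
  shows "\<bar>envelope T L t h - envelope T L t h'\<bar> \<le> (1 + L) * e"
proof -
  have *: "\<bar>(h s - L * \<bar>s - t\<bar>) - (h' (\<tau> s) - L * \<bar>\<tau> s - t\<bar>)\<bar> \<le> (1 + L) * e" if s: "s \<in> {0..T}" for s
  proof -
    have "\<bar>\<bar>s - t\<bar> - \<bar>\<tau> s - t\<bar>\<bar> \<le> e" using \<tau>(2)[OF s] by linarith
    then have "\<bar>L * \<bar>s - t\<bar> - L * \<bar>\<tau> s - t\<bar>\<bar> \<le> L * e"
      using \<open>0 \<le> L\<close> by (metis abs_mult abs_of_nonneg mult_left_mono right_diff_distrib)
    then show ?thesis using e[OF s] by (simp add: algebra_simps)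
  qed
  have im: "\<tau> ` {0..T} = {0..T}" using \<tau>(1) by (simp add: time_changes_def)
  have "envelope T L t h \<le> envelope T L t h' + (1 + L) * e"
    unfolding envelope_def[of _ _ _ h]
  proof (rule cSUP_least)
    fix s assume s: "s \<in> {0..T}"
    then have "\<tau> s \<in> {0..T}" using im by blast
    from envelope_upper[where h=h' and t=t, OF assms(2,3) this] *[OF s]
    show "h s - L * \<bar>s - t\<bar> \<le> envelope T L t h' + (1 + L) * e" by simp
  qed (use assms in auto)
  moreover have "envelope T L t h' \<le> envelope T L t h + (1 + L) * e"
    unfolding envelope_def[of _ _ _ h']
  proof (rule cSUP_least)
    fix u assume "u \<in> {0..T}"
    then obtain s where s: "s \<in> {0..T}" "u = \<tau> s" using im by blast
    from envelope_upper[where h=h and t=t, OF assms(1,3) s(1)] *[OF s(1)]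
    show "h' u - L * \<bar>u - t\<bar> \<le> envelope T L t h + (1 + L) * e" by (simp add: s(2))
  qed (use assms in auto)
  ultimately show ?thesis by linarith
qed

text \<open>The bound may depend on the path, since it only ensures that the suprema are over sets
  bounded above; the Lipschitz constant 1 + L does not involve it.\<close>

lemma continuous_map_envelope:
  assumes "bounded_continuous X g" "0 \<le> T" "0 \<le> L"
    and bound: "\<And>\<xi> s. \<xi> \<in> P \<Longrightarrow> s \<in> {0..T} \<Longrightarrow> (\<integral>x. g x \<partial>\<xi> s) \<le> B \<xi>"
  shows "continuous_map (subtopology (skorohod_topology T (subtopology (weak_topology X) S)) P)
    euclideanreal (\<lambda>\<xi>. envelope T L t (\<lambda>s. \<integral>x. g x \<partial>\<xi> s))"
  by (rule continuous_map_skorohod_functional[OF assms(1), where C="1 + L"])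
    (rule envelope_time_change[OF bound bound assms(3,2)])

text \<open>Within distance 1 / (k + 1) of the centre, h is close to x. Farther away the slope (k +
  1)^2 makes the penalty at least k + 1, which eventually outweighs the bound B. The centre may move
  with k so that it can approach a time from the right, where nothing is known about continuity from
  the left.\<close>

lemma envelope_tendsto:
  assumes bound: "\<And>s. s \<in> {0..T} \<Longrightarrow> \<bar>h s\<bar> \<le> B"
    and p: "\<forall>\<^sub>F k in sequentially. p k \<in> {0..T}"
    and conv: "\<And>\<epsilon>. 0 < \<epsilon> \<Longrightarrow>
      \<forall>\<^sub>F k in sequentially. \<forall>s\<in>{0..T}. \<bar>s - p k\<bar> < 1 / (real k + 1) \<longrightarrow> \<bar>h s - x\<bar> \<le> \<epsilon>"
  shows "(\<lambda>k. envelope T ((real k + 1)\<^sup>2) (p k) h) \<longlonglongrightarrow> x"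
proof (rule LIMSEQ_I)
  fix \<epsilon> :: real assume \<epsilon>: "0 < \<epsilon>"
  have "\<forall>\<^sub>F k in sequentially. B - x \<le> real k"
    using filterlim_real_sequentially by (simp add: filterlim_at_top)
  with p conv[of "\<epsilon>/2"] \<epsilon>
  have "\<forall>\<^sub>F k in sequentially. p k \<in> {0..T} \<and> B - x \<le> real k \<and>
      (\<forall>s\<in>{0..T}. \<bar>s - p k\<bar> < 1 / (real k + 1) \<longrightarrow> \<bar>h s - x\<bar> \<le> \<epsilon>/2)"
    by (auto simp: eventually_conj_iff)
  then have "\<forall>\<^sub>F k in sequentially. norm (envelope T ((real k + 1)\<^sup>2) (p k) h - x) < \<epsilon>"
  proof (eventually_elim)
    case (elim k)
    let ?L = "(real k + 1)\<^sup>2"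
    have "h s \<le> B" if "s \<in> {0..T}" for s using bound[OF that] by simp
    from envelope_upper[where h=h and L="?L" and s="p k" and t="p k", OF this] have "h (p k) \<le> envelope T ?L (p k) h"
      using elim by simp
    moreover have "\<bar>h (p k) - x\<bar> \<le> \<epsilon>/2" using elim by simp
    moreover have "envelope T ?L (p k) h \<le> x + \<epsilon>/2"
      unfolding envelope_def
    proof (rule cSUP_least)
      fix s assume s: "s \<in> {0..T}"
      show "h s - ?L * \<bar>s - p k\<bar> \<le> x + \<epsilon>/2"
      proof (cases "\<bar>s - p k\<bar> < 1 / (real k + 1)")
        case True
        then have "\<bar>h s - x\<bar> \<le> \<epsilon>/2" using elim s by blast
        moreover have "0 \<le> ?L * \<bar>s - p k\<bar>" by simp
        ultimately show ?thesis by linarith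
      next
        case False
        then have "?L * (1 / (real k + 1)) \<le> ?L * \<bar>s - p k\<bar>" by (intro mult_left_mono) auto
        then have "real k + 1 \<le> ?L * \<bar>s - p k\<bar>" by (simp add: power2_eq_square)
        then show ?thesis using bound[OF s] elim \<epsilon> by linarith
      qed
    qed (use elim in auto)
    ultimately show ?case using \<epsilon> unfolding real_norm_def by linarith
  qed
  then show "\<exists>no. \<forall>n\<ge>no. norm (envelope T ((real n + 1)\<^sup>2) (p n) h - x) < \<epsilon>"
    by (simp add: eventually_sequentially)
qed


section \<open>Coagulation trajectories\<close>

lemma coag_pathsD:
  assumes "\<xi> \<in> coag_paths T" "s \<in> {0..T}"
  shows "\<xi> s \<in> point_measures particles" "\<xi> s \<in> finite_measures particles"
proof -
  have "\<xi> s \<in> topspace configurations"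
    using assms by (auto simp: coag_paths_def cadlag_def PiE_iff)
  then show "\<xi> s \<in> point_measures particles" "\<xi> s \<in> finite_measures particles"
    by (auto simp: point_measure_topology_def topspace_weak_topology)
qed

lemma coagulation_jump_mass:
  assumes "coagulation_jump \<phi> \<psi>" "\<phi> \<in> finite_measures particles"
  shows "emeasure \<psi> (topspace particles) \<le> emeasure \<phi> (topspace particles)"
proof -
  let ?A = "topspace (particles :: ('a::polish_space \<times> nat) topology)"
  obtain y y' z where y: "y \<in> ?A" "y' \<in> ?A" "\<psi> = coagulate \<phi> y y' z"
    and le: "\<And>A. A \<in> sets \<phi> \<Longrightarrow> indicator A y + indicator A y' \<le> emeasure \<phi> A"
    using assms(1) unfolding coagulation_jump_def by blast
  have "?A \<in> sets \<phi>" using finite_measuresD(3)[OF assms(2)] sets.top[of \<phi>] by simp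
  \<comment> \<open>Two removable particles force mass at least 2, so the truncated subtraction in
    \<open>coagulate\<close> is exact on the whole space; starting from mass 0 it would produce mass
    1.\<close>
  with le[of ?A] y have two: "2 \<le> emeasure \<phi> ?A" by simp
  obtain r where r: "emeasure \<phi> ?A = ennreal r" "0 \<le> r"
    using finite_measure.emeasure_finite[OF finite_measuresD(1)[OF assms(2)]]
    by (metis ennreal_cases)
  have r2: "2 \<le> r" using two r by (metis ennreal_le_iff ennreal_numeral)
  have "emeasure \<psi> ?A \<le> emeasure \<phi> ?A - indicator ?A y - indicator ?A y' + indicator ?A (z, snd y + snd y')"
    unfolding y(3) coagulate_def by (rule emeasure_measure_of_le)
  also have "\<dots> \<le> ennreal r - 1 - 1 + 1"
    using y r by (intro add_mono) (auto simp: indicator_def)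
  also have "\<dots> = ennreal (r - 1 - 1 + 1)"
    using r2 by (simp only: ennreal_1[symmetric] ennreal_minus ennreal_plus[symmetric])
  also have "\<dots> \<le> emeasure \<phi> ?A" unfolding r(1) by (intro ennreal_leI) simp
  finally show ?thesis .
qed

text \<open>Induction along the jump times; an arbitrary time then lies in one of the intervals of
  constancy. Monotonicity of a jump is required only for states at times in [0,T], where the path
  takes values in the state space.\<close>

lemma piecewise_constant_antimono:
  fixes m :: "'s \<Rightarrow> 'b::preorder"
  assumes pc: "piecewise_constant_with_jumps R T \<xi>"
    and anti: "\<And>s s'. s \<in> {0..T} \<Longrightarrow> R (\<xi> s) (\<xi> s') \<Longrightarrow> m (\<xi> s') \<le> m (\<xi> s)"
    and s: "s \<in> {0..T}"
  shows "m (\<xi> s) \<le> m (\<xi> 0)"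
proof -
  obtain n t where t: "t 0 = (0::real)" "t n \<le> T" "\<And>i. i < n \<Longrightarrow> t i < t (Suc i)"
    and const: "\<And>i s. i < n \<Longrightarrow> s \<in> {t i..<t (Suc i)} \<Longrightarrow> \<xi> s = \<xi> (t i)"
    and last: "\<And>s. s \<in> {t n..T} \<Longrightarrow> \<xi> s = \<xi> (t n)"
    and jump: "\<And>i. i < n \<Longrightarrow> R (\<xi> (t i)) (\<xi> (t (Suc i)))"
    using pc unfolding piecewise_constant_with_jumps_def by blast
  have pos: "0 \<le> t i" if "i \<le> n" for i
    using that
  proof (induction i)
    case (Suc i) then show ?case using t(3)[of i] by simp
  qed (use t in simp)
  have upper: "t i \<le> T" if "i \<le> n" for i
    using that
  proof (induction rule: inc_induct)
    case (step k) then show ?case using t(3)[of k] by simp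
  qed (use t in simp)
  have mono: "m (\<xi> (t i)) \<le> m (\<xi> 0)" if "i \<le> n" for i
    using that
  proof (induction i)
    case (Suc i)
    then have "m (\<xi> (t (Suc i))) \<le> m (\<xi> (t i))"
      using jump[of i] pos[of i] upper[of i] by (intro anti) auto
    then show ?case using Suc by (auto intro: order_trans)
  qed (use t in simp)
  have "s < t i \<Longrightarrow> i \<le> n \<Longrightarrow> \<exists>j<i. s \<in> {t j..<t (Suc j)}" for i
  proof (induction i)
    case (Suc i) then show ?case by (cases "s < t i") (auto simp: less_Suc_eq)
  qed (use s t in simp)
  note before = this[of n]
  show ?thesis
  proof (cases "s < t n")
    case True
    then obtain j where j: "j < n" "s \<in> {t j..<t (Suc j)}" using before by blast
    show ?thesis unfolding const[OF j] using mono[of j] j(1) by simp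
  next
    case False
    then have "\<xi> s = \<xi> (t n)" using s by (intro last) simp
    then show ?thesis using mono[of n] by simp
  qed
qed

text \<open>This turns the initial mass into one majorant for all times of a trajectory, and hence
  into the dominating function of every limit below.\<close>

lemma coag_paths_mass:
  assumes "\<xi> \<in> coag_paths T" "s \<in> {0..T}"
  shows "total_mass (\<xi> s) \<le> total_mass (\<xi> 0)"
proof -
  have "piecewise_constant_with_jumps coagulation_jump T \<xi>" using assms(1) by (simp add: coag_paths_def)
  then have "emeasure (\<xi> s) (topspace particles) \<le> emeasure (\<xi> 0) (topspace particles)"
    by (rule piecewise_constant_antimono[where m="\<lambda>\<phi>. emeasure \<phi> (topspace particles)", OF _ _ assms(2)])
      (use coagulation_jump_mass coag_pathsD(2)[OF assms(1)] in blast)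
  moreover have "0 \<in> {0..T}" using assms(2) by simp
  note 0 = coag_pathsD(2)[OF assms(1) this]
  ultimately show ?thesis
    unfolding total_mass_def measure_def finite_measuresD(3)[OF coag_pathsD(2)[OF assms]] finite_measuresD(3)[OF 0]
    using finite_measure.emeasure_finite[OF finite_measuresD(1)[OF 0]]
    by (intro enn2real_mono) (auto simp: less_top)
qed

lemma coag_paths_integral_bound:
  assumes g: "bounded_continuous particles g" "\<And>x. x \<in> topspace particles \<Longrightarrow> \<bar>g x\<bar> \<le> C" "0 \<le> C"
    and "\<xi> \<in> coag_paths T" "s \<in> {0..T}"
  shows "\<bar>\<integral>x. g x \<partial>\<xi> s\<bar> \<le> C * total_mass (\<xi> 0)"
proof -
  have "\<bar>\<integral>x. g x \<partial>\<xi> s\<bar> \<le> C * total_mass (\<xi> s)"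
    using coag_pathsD(2)[OF assms(4,5)] conjunct1[OF g(1)[unfolded bounded_continuous_def]] g(2)
    by (rule finite_measures_integral(2))
  also have "\<dots> \<le> C * total_mass (\<xi> 0)"
    by (rule mult_left_mono[OF coag_paths_mass[OF assms(4,5)] assms(3)])
  finally show ?thesis .
qed

lemma coag_paths_limit:
  assumes "\<xi> \<in> coag_paths T" "bounded_continuous particles g" "t \<in> {0..<T}"
  shows "((\<lambda>s. \<integral>x. g x \<partial>\<xi> s) \<longlongrightarrow> (\<integral>x. g x \<partial>\<xi> t)) (at_right t)"
  using assms
  by (intro limitin_subtopology_weak[of particles "point_measures particles"])
    (auto simp: coag_paths_def cadlag_def point_measure_topology_def)

text \<open>The limit is chosen without showing uniqueness. Measurability and convergence are
  derived from integrals of test functions, which as limits of real numbers do not depend on the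
  choice.\<close>

definition left_limit :: "(real \<Rightarrow> ('a::polish_space \<times> nat) measure) \<Rightarrow> real \<Rightarrow> ('a \<times> nat) measure" where
  "left_limit \<xi> t = (SOME l. limitin configurations \<xi> l (at_left t))"

lemma left_limit:
  assumes "\<xi> \<in> coag_paths T" "t \<in> {0<..T}"
  shows "left_limit \<xi> t \<in> finite_measures particles"
    and "bounded_continuous particles g \<Longrightarrow>
      ((\<lambda>s. \<integral>x. g x \<partial>\<xi> s) \<longlongrightarrow> (\<integral>x. g x \<partial>left_limit \<xi> t)) (at_left t)"
proof -
  have "\<exists>l. limitin configurations \<xi> l (at_left t)"
    using assms by (auto simp: coag_paths_def cadlag_def)
  then have l: "limitin configurations \<xi> (left_limit \<xi> t) (at_left t)"
    unfolding left_limit_def by (rule someI_ex)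
  then show "left_limit \<xi> t \<in> finite_measures particles"
    by (auto simp: point_measure_topology_def limitin_subtopology limitin_weak_topology)
  show "((\<lambda>s. \<integral>x. g x \<partial>\<xi> s) \<longlongrightarrow> (\<integral>x. g x \<partial>left_limit \<xi> t)) (at_left t)" if "bounded_continuous particles g"
    using l that unfolding point_measure_topology_def by (rule limitin_subtopology_weak)
qed

section \<open>Continuity and measurability of functionals on the space of trajectories\<close>

lemma coag_path_topology_eq:
  "coag_path_topology T =
    subtopology (skorohod_topology T (subtopology (weak_topology particles) (point_measures particles))) (coag_paths T)"
  by (simp add: coag_path_topology_def point_measure_topology_def)

lemma topspace_coag_path_topology: "topspace (coag_path_topology T) = coag_paths T"
  by (auto simp: coag_path_topology_def topspace_skorohod_topology coag_paths_def)

lemma integral_one: "(\<integral>x. 1 \<partial>m) = total_mass m"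
  by (simp add: total_mass_def)

lemma continuous_map_initial_mass:
  assumes "0 \<le> T"
  shows "continuous_map (coag_path_topology T) euclideanreal (\<lambda>\<xi>. total_mass (\<xi> 0))"
  unfolding coag_path_topology_eq integral_one[symmetric]
  using assms by (intro continuous_map_eval_endpoint bounded_continuous_const) auto

lemma continuous_map_coag_envelope:
  assumes "bounded_continuous particles g" "0 \<le> T" "0 \<le> L"
  shows "continuous_map (coag_path_topology T) euclideanreal (\<lambda>\<xi>. envelope T L t (\<lambda>s. \<integral>x. g x \<partial>\<xi> s))"
proof -
  obtain C where C: "0 \<le> C" "\<And>x. x \<in> topspace particles \<Longrightarrow> \<bar>g x\<bar> \<le> C"
    using bounded_continuousE[OF assms(1)] by blast
  show ?thesis
    unfolding coag_path_topology_eq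
  proof (rule continuous_map_envelope[OF assms])
    fix \<xi> :: "real \<Rightarrow> ('a \<times> nat) measure" and s assume "\<xi> \<in> coag_paths T" "s \<in> {0..T}"
    from coag_paths_integral_bound[where g=g, OF assms(1) C(2,1) this]
    show "(\<integral>x. g x \<partial>\<xi> s) \<le> C * total_mass (\<xi> 0)" by simp
  qed
qed

text \<open>Before T the evaluation is a pointwise limit of continuous envelopes centred to the
  right of t, where right-continuity of every path can be used. At T there is no room to the right,
  but there the evaluation is continuous.\<close>

lemma measurable_coag_eval:
  assumes g: "bounded_continuous particles g" and t: "t \<in> {0..T}"
    and \<nu>: "sets \<nu> = sets (borel_of (coag_path_topology T))"
  shows "(\<lambda>\<xi>. \<integral>x. g x \<partial>\<xi> t) \<in> borel_measurable \<nu>"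
proof (cases "t = T")
  case True
  have "continuous_map (coag_path_topology T) euclideanreal (\<lambda>\<xi>. \<integral>x. g x \<partial>\<xi> t)"
    unfolding coag_path_topology_eq using t True by (intro continuous_map_eval_endpoint g) auto
  then show ?thesis by (rule continuous_map_borel_measurable) (rule \<nu>)
next
  case False
  then have t: "t \<in> {0..<T}" using t by simp
  obtain C where C: "0 \<le> C" "\<And>x. x \<in> topspace particles \<Longrightarrow> \<bar>g x\<bar> \<le> C"
    using bounded_continuousE[OF g] by blast
  \<comment> \<open>The offset equals the radius 1 / (k + 1) used in
    \<open>envelope_tendsto\<close>, so the window around the centre is the open interval from t to
    t + 2 / (k + 1) and never reaches back to t or beyond.\<close>
  let ?p = "\<lambda>k. t + 1 / (real k + 1)"
  show ?thesis
  proof (rule borel_measurable_LIMSEQ_real)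
    show "(\<lambda>\<xi>. envelope T ((real k + 1)\<^sup>2) (?p k) (\<lambda>s. \<integral>x. g x \<partial>\<xi> s)) \<in> borel_measurable \<nu>" for k
      by (rule continuous_map_borel_measurable[OF continuous_map_coag_envelope[OF g] \<nu>]) (use t in auto)
    fix \<xi> assume "\<xi> \<in> space \<nu>"
    then have \<xi>: "\<xi> \<in> coag_paths T"
      using sets_eq_imp_space_eq[OF \<nu>] by (simp add: topspace_coag_path_topology)
    have plim: "?p \<longlonglongrightarrow> t" and plim2: "(\<lambda>k. t + 2 / (real k + 1)) \<longlonglongrightarrow> t" by real_asymp+
    show "(\<lambda>k. envelope T ((real k + 1)\<^sup>2) (?p k) (\<lambda>s. \<integral>x. g x \<partial>\<xi> s)) \<longlonglongrightarrow> (\<integral>x. g x \<partial>\<xi> t)"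
    proof (rule envelope_tendsto)
      show "\<bar>\<integral>x. g x \<partial>\<xi> s\<bar> \<le> C * total_mass (\<xi> 0)" if "s \<in> {0..T}" for s
        using g C(2,1) \<xi> that by (rule coag_paths_integral_bound)
      have "\<forall>\<^sub>F k in sequentially. ?p k < T" using order_tendstoD(2)[OF plim, of T] t by simp
      then show "\<forall>\<^sub>F k in sequentially. ?p k \<in> {0..T}" by eventually_elim (use t in auto)
      fix \<epsilon> :: real assume \<epsilon>: "0 < \<epsilon>"
      have "\<forall>\<^sub>F s in at_right t. dist (\<integral>x. g x \<partial>\<xi> s) (\<integral>x. g x \<partial>\<xi> t) < \<epsilon>"
        using tendstoD[OF coag_paths_limit[OF \<xi> g t] \<epsilon>] .
      then obtain b where b: "t < b"
        "\<And>s. t < s \<Longrightarrow> s < b \<Longrightarrow> dist (\<integral>x. g x \<partial>\<xi> s) (\<integral>x. g x \<partial>\<xi> t) < \<epsilon>"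
        unfolding eventually_at_right_field by blast
      have "\<forall>\<^sub>F k in sequentially. t + 2 / (real k + 1) < b" using order_tendstoD(2)[OF plim2] b(1) by simp
      then show "\<forall>\<^sub>F k in sequentially. \<forall>s\<in>{0..T}. \<bar>s - ?p k\<bar> < 1 / (real k + 1) \<longrightarrow>
          \<bar>(\<integral>x. g x \<partial>\<xi> s) - (\<integral>x. g x \<partial>\<xi> t)\<bar> \<le> \<epsilon>"
      proof (eventually_elim, intro ballI impI)
        fix k s assume k: "t + 2 / (real k + 1) < b" and "\<bar>s - ?p k\<bar> < 1 / (real k + 1)"
        then have "t < s" "s < t + 1 / (real k + 1) + 1 / (real k + 1)" by linarith+
        moreover have "1 / (real k + 1) + 1 / (real k + 1) = 2 / (real k + 1)" by simp
        ultimately have "dist (\<integral>x. g x \<partial>\<xi> s) (\<integral>x. g x \<partial>\<xi> t) < \<epsilon>" using k by (intro b(2)) linarith+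
        then show "\<bar>(\<integral>x. g x \<partial>\<xi> s) - (\<integral>x. g x \<partial>\<xi> t)\<bar> \<le> \<epsilon>" by (simp add: dist_real_def)
      qed
    qed
  qed
qed

text \<open>The type of natural numbers is not an instance of the class of metric spaces, so the
  masses are embedded into the real line to measure distances of particles.\<close>

lemma particles_zero_set:
  fixes C :: "('a::polish_space \<times> nat) set"
  assumes "closedin particles C"
  shows "\<exists>h. continuous_map particles euclideanreal h \<and>
    (\<forall>x\<in>topspace particles. 0 \<le> h x \<and> (h x = 0 \<longleftrightarrow> x \<in> C))"
proof -
  let ?S = "UNIV \<times> {1..} :: ('a \<times> nat) set"
  obtain D where D: "closed D" "C = ?S \<inter> D"
    using assms unfolding particles_def closedin_closed by blast
  define j :: "'a \<times> nat \<Rightarrow> 'a \<times> real" where "j p = (fst p, real (snd p))" for p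
  have j: "inj j" by (auto simp: inj_def j_def prod_eq_iff)
  have jc: "continuous_on A j" for A unfolding j_def by (intro continuous_intros)
  show ?thesis
  proof (cases "D = {}")
    \<comment> \<open>By convention \<open>infdist\<close> to the empty set is 0, so the empty set
      needs its own witness.\<close>
    case True
    then show ?thesis using D by (intro exI[of _ "\<lambda>_. 1"]) auto
  next
    case False
    have "closed (j ` D)"
      unfolding closed_sequential_limits
    proof (intro allI impI, elim conjE)
      fix z l assume z: "\<forall>n. z n \<in> j ` D" and l: "z \<longlonglongrightarrow> l"
      then have "\<forall>n. \<exists>p. p \<in> D \<and> z n = j p" by blast
      then obtain p where p: "\<And>n. p n \<in> D" "\<And>n. z n = j (p n)" by metis
      have s: "(\<lambda>n. real (snd (p n))) \<longlonglongrightarrow> snd l" and f: "(\<lambda>n. fst (p n)) \<longlonglongrightarrow> fst l"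
        using tendsto_snd[OF l] tendsto_fst[OF l] by (simp_all add: p(2) j_def)
      have "snd l \<in> range real"
        by (rule closed_sequentially[OF closed_of_nat_image[of UNIV, where 'a=real] _ s]) simp
      then obtain m where m: "snd l = real m" by blast
      have "\<forall>\<^sub>F n in sequentially. dist (real (snd (p n))) (real m) < 1"
        using tendstoD[OF s, of 1] m by simp
      \<comment> \<open>Natural numbers at distance less than 1 coincide, so the masses are
        eventually constant and converge in the discrete topology as well.\<close>
      then have "(\<lambda>n. snd (p n)) \<longlonglongrightarrow> m"
        unfolding tendsto_discrete by eventually_elim (simp add: dist_of_nat)
      from tendsto_Pair[OF f this] have "p \<longlonglongrightarrow> (fst l, m)" by (simp only: prod.collapse)
      with p(1) have "(fst l, m) \<in> D"
        by (intro Lim_in_closed_set[OF D(1) _ sequentially_bot, of p]) simp_all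
      moreover have "l = j (fst l, m)" using m by (simp add: j_def prod_eq_iff)
      ultimately show "l \<in> j ` D" by blast
    qed
    then have "infdist (j p) (j ` D) = 0 \<longleftrightarrow> j p \<in> j ` D" for p
      by (rule in_closed_iff_infdist_zero[symmetric]) (use False in simp)
    then have zero: "infdist (j p) (j ` D) = 0 \<longleftrightarrow> p \<in> D" for p
      by (simp only: inj_image_mem_iff[OF j])
    have "continuous_map particles euclideanreal (\<lambda>p. infdist (j p) (j ` D))"
      unfolding particles_def continuous_map_iff_continuous by (rule continuous_on_infdist[OF jc])
    moreover have "p \<in> C \<longleftrightarrow> p \<in> D" if "p \<in> topspace particles" for p
      using that unfolding D(2) particles_def by simp
    ultimately show ?thesis
      using zero by (intro exI[of _ "\<lambda>p. infdist (j p) (j ` D)"] conjI ballI) (simp_all only: infdist_nonneg)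
  qed
qed

lemma particles_emeasure_measurable:
  fixes \<kappa> :: "'b \<Rightarrow> ('a::polish_space \<times> nat) measure"
  assumes "\<And>\<xi>. \<xi> \<in> space \<nu> \<Longrightarrow> \<kappa> \<xi> \<in> finite_measures particles"
    and "\<And>g. bounded_continuous particles g \<Longrightarrow> (\<lambda>\<xi>. \<integral>x. g x \<partial>\<kappa> \<xi>) \<in> borel_measurable \<nu>"
    and "B \<in> sets (borel_of particles)"
  shows "(\<lambda>\<xi>. emeasure (\<kappa> \<xi>) B) \<in> borel_measurable \<nu>"
proof (rule measurable_emeasure_kernel[where X=particles])
  show "\<exists>h. continuous_map particles euclideanreal h \<and>
      (\<forall>x\<in>topspace particles. 0 \<le> h x \<and> (h x = 0 \<longleftrightarrow> x \<in> C))" if "closedin particles C"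
    for C :: "('a \<times> nat) set"
    using that by (rule particles_zero_set)
qed (fact assms)+

section \<open>The averaged path and its regularity in time\<close>

lemma rho_eq_mixture: "t \<in> {0..T} \<Longrightarrow> rho T \<nu> t = mixture particles \<nu> (\<lambda>\<xi>. \<xi> t)"
  by (simp add: rho_def mixture_def)

locale path_measure =
  fixes T :: real and \<nu> :: "(real \<Rightarrow> ('a::polish_space \<times> nat) measure) measure"
  assumes T: "0 < T" and fin_meas: "\<nu> \<in> finite_measures (coag_path_topology T)"
    and integrable_mass: "integrable \<nu> (\<lambda>\<xi>. total_mass (\<xi> 0))"
begin

lemma sets_nu: "sets \<nu> = sets (borel_of (coag_path_topology T))"
  and space_nu: "space \<nu> = coag_paths T"
  and finite_nu: "finite_measure \<nu>"
  using finite_measuresD[OF fin_meas] by (auto simp: topspace_coag_path_topology)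

lemma finite_kernel_eval:
  assumes "t \<in> {0..T}"
  shows "finite_kernel \<nu> particles (\<lambda>\<xi>. \<xi> t) (\<lambda>\<xi>. total_mass (\<xi> 0))"
proof -
  interpret finite_measure \<nu> by (rule finite_nu)
  show ?thesis
  proof
    fix B :: "('a \<times> nat) set" assume "B \<in> sets (borel_of particles)"
    then show "(\<lambda>\<xi>. emeasure (\<xi> t) B) \<in> borel_measurable \<nu>"
      by (rule particles_emeasure_measurable[rotated 2])
        (use assms in \<open>auto simp: space_nu intro: coag_pathsD measurable_coag_eval[OF _ assms sets_nu]\<close>)
  qed (use assms integrable_mass in \<open>auto simp: space_nu intro: coag_pathsD coag_paths_mass\<close>)
qed

text \<open>One deterministic sequence of times increasing to t serves all trajectories;
  measurability and the mass bound pass from the evaluations along it to their limit.\<close>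

lemma finite_kernel_left_limit:
  assumes t: "t \<in> {0<..T}"
  shows "finite_kernel \<nu> particles (\<lambda>\<xi>. left_limit \<xi> t) (\<lambda>\<xi>. total_mass (\<xi> 0))"
proof -
  interpret finite_measure \<nu> by (rule finite_nu)
  let ?p = "\<lambda>k::nat. t - t / (real k + 2)"
  have p: "?p k \<in> {0..T}" "?p k < t" for k
  proof -
    have "t / (real k + 2) \<le> t / 1" using t by (intro divide_left_mono) auto
    moreover have "0 < t / (real k + 2)" using t by simp
    ultimately show "?p k \<in> {0..T}" using t unfolding atLeastAtMost_iff by auto
    show "?p k < t" using t by simp
  qed
  have "?p \<longlonglongrightarrow> t" by real_asymp
  then have p_left: "filterlim ?p (at_left t) sequentially"
    using p(2) by (simp add: filterlim_at less_imp_neq)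
  have lim: "(\<lambda>k. \<integral>x. g x \<partial>\<xi> (?p k)) \<longlonglongrightarrow> (\<integral>x. g x \<partial>left_limit \<xi> t)"
    if "\<xi> \<in> coag_paths T" "bounded_continuous particles g" for \<xi> and g :: "'a \<times> nat \<Rightarrow> real"
    using left_limit(2)[OF that(1) t that(2)] p_left by (rule filterlim_compose)
  show ?thesis
  proof
    fix B :: "('a \<times> nat) set" assume "B \<in> sets (borel_of particles)"
    then show "(\<lambda>\<xi>. emeasure (left_limit \<xi> t) B) \<in> borel_measurable \<nu>"
    proof (rule particles_emeasure_measurable[rotated 2])
      fix g :: "'a \<times> nat \<Rightarrow> real" assume g: "bounded_continuous particles g"
      show "(\<lambda>\<xi>. \<integral>x. g x \<partial>left_limit \<xi> t) \<in> borel_measurable \<nu>"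
        by (rule borel_measurable_LIMSEQ_real[OF lim[OF _ g]])
          (use space_nu measurable_coag_eval[OF g p(1) sets_nu] in auto)
    qed (use t space_nu left_limit(1) in auto)
  next
    fix \<xi> assume "\<xi> \<in> space \<nu>"
    then have \<xi>: "\<xi> \<in> coag_paths T" by (simp add: space_nu)
    show "total_mass (left_limit \<xi> t) \<le> total_mass (\<xi> 0)"
      using lim[OF \<xi> bounded_continuous_const[of _ 1]] unfolding integral_one
      by (rule LIMSEQ_le_const2) (use coag_paths_mass[OF \<xi> p(1)] in auto)
  qed (use t space_nu left_limit(1) integrable_mass in auto)
qed

lemma integral_rho:
  assumes "bounded_continuous particles g" "t \<in> {0..T}"
  shows "integrable \<nu> (\<lambda>\<xi>. \<integral>x. g x \<partial>\<xi> t)" "(\<integral>x. g x \<partial>rho T \<nu> t) = (\<integral>\<xi>. \<integral>x. g x \<partial>\<xi> t \<partial>\<nu>)"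
proof -
  obtain C where C: "\<And>x. x \<in> topspace particles \<Longrightarrow> \<bar>g x\<bar> \<le> C"
    using bounded_continuousE[OF assms(1)] by blast
  interpret finite_kernel \<nu> particles "\<lambda>\<xi>. \<xi> t" "\<lambda>\<xi>. total_mass (\<xi> 0)"
    by (rule finite_kernel_eval[OF assms(2)])
  have "g \<in> borel_measurable (borel_of particles)"
    using assms(1) by (intro continuous_map_borel_measurable[OF _ refl]) (simp add: bounded_continuous_def)
  from integral_mixture[OF this C]
  show "integrable \<nu> (\<lambda>\<xi>. \<integral>x. g x \<partial>\<xi> t)" "(\<integral>x. g x \<partial>rho T \<nu> t) = (\<integral>\<xi>. \<integral>x. g x \<partial>\<xi> t \<partial>\<nu>)"
    by (auto simp: rho_eq_mixture[OF assms(2)])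
qed

lemma rho_finite_measures: "t \<in> {0..T} \<Longrightarrow> rho T \<nu> t \<in> finite_measures particles"
  using finite_kernel.mixture_finite_measures[OF finite_kernel_eval] rho_eq_mixture by metis

text \<open>Dominated convergence with majorant \<open>C * total_mass (\<xi> 0)\<close>. F stands
  for the value at a time when right limits are treated, and for the left limit otherwise.\<close>

lemma integral_rho_tendsto:
  assumes S: "\<And>n. S n \<in> {0..T}" and g: "bounded_continuous particles g"
    and F: "F \<in> borel_measurable \<nu>" and lim: "\<And>\<xi>. \<xi> \<in> coag_paths T \<Longrightarrow> (\<lambda>n. \<integral>x. g x \<partial>\<xi> (S n)) \<longlonglongrightarrow> F \<xi>"
  shows "(\<lambda>n. \<integral>x. g x \<partial>rho T \<nu> (S n)) \<longlonglongrightarrow> (\<integral>\<xi>. F \<xi> \<partial>\<nu>)"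
proof -
  obtain C where C: "0 \<le> C" "\<And>x. x \<in> topspace particles \<Longrightarrow> \<bar>g x\<bar> \<le> C"
    using bounded_continuousE[OF g] by blast
  have "(\<lambda>n. \<integral>\<xi>. \<integral>x. g x \<partial>\<xi> (S n) \<partial>\<nu>) \<longlonglongrightarrow> (\<integral>\<xi>. F \<xi> \<partial>\<nu>)"
  proof (rule integral_dominated_convergence[where w="\<lambda>\<xi>. C * total_mass (\<xi> 0)"])
    show "AE \<xi> in \<nu>. norm (\<integral>x. g x \<partial>\<xi> (S n)) \<le> C * total_mass (\<xi> 0)" for n
      using coag_paths_integral_bound[where g=g, OF g C(2,1) _ S] space_nu by (intro AE_I2) simp
  qed (use F lim integrable_mass measurable_coag_eval[OF g S sets_nu] space_nu in auto)
  then show ?thesis using integral_rho(2)[OF g S] by simp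
qed

lemma rho_cadlag: "rho T \<nu> \<in> cadlag T (weak_topology particles)"
  unfolding cadlag_def mem_Collect_eq
proof (intro conjI ballI)
  show "rho T \<nu> \<in> {0..T} \<rightarrow>\<^sub>E topspace (weak_topology particles)"
    using rho_finite_measures by (auto simp: topspace_weak_topology PiE_iff rho_def extensional_def)
next
  fix t assume t: "t \<in> {0..<T}"
  have "\<forall>\<^sub>F s in at_right t. s < T" using t by (auto intro: eventually_at_right_less order_tendstoD(2) simp: eventually_at_right_field)
  then have "\<forall>\<^sub>F s in at_right t. s \<in> {0..T}"
    using eventually_at_right_less[of t] by eventually_elim (use t in auto)
  then have ev: "\<forall>\<^sub>F s in at_right t. rho T \<nu> s \<in> finite_measures particles"
    by eventually_elim (rule rho_finite_measures)
  have "((\<lambda>s. \<integral>x. g x \<partial>rho T \<nu> s) \<longlongrightarrow> (\<integral>x. g x \<partial>rho T \<nu> t)) (at_right t)" if g: "bounded_continuous particles g" for g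
  \<comment> \<open>Dominated convergence is available along sequences, so one-sided limits are
    tested on sequences of times.\<close>
  proof (rule tendsto_at_right_sequentially[of t T])
    fix S assume S: "\<And>n. t < S n" "\<And>n. S n < T" "S \<longlonglongrightarrow> t"
    then have r: "filterlim S (at_right t) sequentially" by (simp add: filterlim_at less_imp_neq[symmetric])
    have t': "t \<in> {0..T}" using t by simp
    have "S n \<in> {0..T}" for n using S(1,2)[of n] t by simp
    then have "(\<lambda>n. \<integral>x. g x \<partial>rho T \<nu> (S n)) \<longlonglongrightarrow> (\<integral>\<xi>. \<integral>x. g x \<partial>\<xi> t \<partial>\<nu>)"
      using measurable_coag_eval[OF g t' sets_nu] filterlim_compose[OF coag_paths_limit[OF _ g t] r]
      by (intro integral_rho_tendsto g)
    then show "(\<lambda>n. \<integral>x. g x \<partial>rho T \<nu> (S n)) \<longlonglongrightarrow> (\<integral>x. g x \<partial>rho T \<nu> t)"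
      by (simp add: integral_rho(2)[OF g t'])
  qed (use t in auto)
  then show "limitin (weak_topology particles) (rho T \<nu>) (rho T \<nu> t) (at_right t)"
    using ev t rho_finite_measures[of t] by (auto simp: limitin_weak_topology)
next
  fix t assume t: "t \<in> {0<..T}"
  have "\<forall>\<^sub>F s in at_left t. 0 < s" using t by (auto simp: eventually_at_left_field)
  then have "\<forall>\<^sub>F s in at_left t. s \<in> {0..T}"
    using eventually_at_left_field[of "\<lambda>s. s < t" t] t by (auto simp: eventually_at_left_field)
  then have ev: "\<forall>\<^sub>F s in at_left t. rho T \<nu> s \<in> finite_measures particles"
    by eventually_elim (rule rho_finite_measures)
  interpret finite_kernel \<nu> particles "\<lambda>\<xi>. left_limit \<xi> t" "\<lambda>\<xi>. total_mass (\<xi> 0)"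
    by (rule finite_kernel_left_limit[OF t])
  \<comment> \<open>The left limit of the averaged path is the average of the left limits.\<close>
  let ?l = "mixture particles \<nu> (\<lambda>\<xi>. left_limit \<xi> t)"
  have "((\<lambda>s. \<integral>x. g x \<partial>rho T \<nu> s) \<longlongrightarrow> (\<integral>x. g x \<partial>?l)) (at_left t)" if g: "bounded_continuous particles g" for g
  proof (rule tendsto_at_left_sequentially[of 0 t])
    obtain C where C: "\<And>x. x \<in> topspace particles \<Longrightarrow> \<bar>g x\<bar> \<le> C"
      using bounded_continuousE[OF g] by blast
    have gm: "g \<in> borel_measurable (borel_of particles)"
      using g by (intro continuous_map_borel_measurable[OF _ refl]) (simp add: bounded_continuous_def)
    fix S assume S: "\<And>n. S n < t" "\<And>n. 0 < S n" "S \<longlonglongrightarrow> t"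
    then have l: "filterlim S (at_left t) sequentially" by (simp add: filterlim_at less_imp_neq)
    have "S n \<in> {0..T}" for n using S(1,2)[of n] t by simp
    then have "(\<lambda>n. \<integral>x. g x \<partial>rho T \<nu> (S n)) \<longlonglongrightarrow> (\<integral>\<xi>. \<integral>x. g x \<partial>left_limit \<xi> t \<partial>\<nu>)"
      using integral_mixture(1)[OF gm C] filterlim_compose[OF left_limit(2)[OF _ t g] l]
      by (intro integral_rho_tendsto g) auto
    then show "(\<lambda>n. \<integral>x. g x \<partial>rho T \<nu> (S n)) \<longlonglongrightarrow> (\<integral>x. g x \<partial>?l)"
      by (simp add: integral_mixture(2)[OF gm C])
  qed (use t in auto)
  then show "\<exists>l. limitin (weak_topology particles) (rho T \<nu>) l (at_left t)"
    using ev mixture_finite_measures by (intro exI[of _ ?l]) (auto simp: limitin_weak_topology)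
qed

end


section \<open>The reference measure does not charge jumps at a fixed time\<close>

text \<open>The law of the process and the reference measure are defined by \<^const>\<open>measure_of\<close>, which
  returns the zero measure if the given set function is not a measure.  For a set on which the set
  function vanishes this distinction is irrelevant, so countable additivity need not be verified.\<close>

lemma ml_jump_zero: "ml_jump K \<Upsilon> \<phi> (\<lambda>_. 0) = 0"
  by (simp add: ml_jump_def)

text \<open>The set A contains no path that is constant on some interval (t - \<delta>, t]. Such
  constancy is the invariant of the induction over the number of jumps: it survives, possibly with
  another \<delta>, every further jump at a time r different from t, and after the last jump it
  excludes the path from A.\<close>

lemma ml_prob_null:
  assumes A: "\<And>\<eta> \<delta>. 0 < \<delta> \<Longrightarrow> (\<And>u. u \<in> {0..T} \<Longrightarrow> t - \<delta> < u \<Longrightarrow> u \<le> t \<Longrightarrow> \<eta> u = \<eta> t) \<Longrightarrow> \<eta> \<notin> A"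
    and t: "t \<in> {0..T}"
    and \<xi>: "0 < \<delta>" "\<And>u. u \<in> {0..T} \<Longrightarrow> t - \<delta> < u \<Longrightarrow> u \<le> t \<Longrightarrow> \<xi> u = \<xi> t"
  shows "ml_prob K \<Upsilon> T n s \<xi> A = 0"
  using \<xi>
proof (induction n arbitrary: s \<xi> \<delta>)
  case 0
  have "\<xi> \<notin> A" using 0 by (rule A[where \<eta>=\<xi>])
  then show ?case by simp
next
  case (Suc n)
  have null: "ml_prob K \<Upsilon> T n r (\<lambda>u\<in>{0..T}. if u < r then \<xi> u else \<psi>) A = 0" if r: "r \<noteq> t" for r \<psi>
  proof (cases "t < r")
    case True
    show ?thesis
    proof (rule Suc.IH[OF Suc.prems(1)])
      fix u assume u: "u \<in> {0..T}" "t - \<delta> < u" "u \<le> t"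
      from Suc.prems(2)[OF this] u t True
      show "(\<lambda>u\<in>{0..T}. if u < r then \<xi> u else \<psi>) u = (\<lambda>u\<in>{0..T}. if u < r then \<xi> u else \<psi>) t"
        by simp
    qed
  next
    case False
    \<comment> \<open>For r < t the new path equals \<psi> from r up to t, so t - r is an admissible
      length. For r > t, treated above, the path up to t is unchanged.\<close>
    then show ?thesis by (intro Suc.IH[of "t - r"]) (use r t in auto)
  qed
  have zero: "ml_jump K \<Upsilon> \<phi> (\<lambda>\<psi>. ml_prob K \<Upsilon> T n r (\<lambda>u\<in>{0..T}. if u < r then \<xi> u else \<psi>) A) = 0"
    if "r \<noteq> t" for r \<phi>
    unfolding null[OF that] by (rule ml_jump_zero)
  \<comment> \<open>The jump time is integrated against Lebesgue measure, so the one exceptional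
    instant has no weight.\<close>
  have "AE r in lborel. r \<noteq> t" by (rule AE_lborel_singleton)
  then have "ml_prob K \<Upsilon> T (Suc n) s \<xi> A = (\<integral>\<^sup>+r. 0 \<partial>(lborel :: real measure))"
    unfolding ml_prob.simps
    by (intro nn_integral_cong_AE, elim AE_mp) (intro AE_I2 impI, simp only: zero mult_zero_right mult_zero_left)
  then show ?case by simp
qed

lemma emeasure_measure_of_null: "m B = 0 \<Longrightarrow> emeasure (measure_of \<Omega> A m) B = 0"
  by (simp add: emeasure_measure_of_conv)

lemma nn_integral_null_set:
  assumes "A \<in> null_sets M"
  shows "(\<integral>\<^sup>+x. f x * indicator A x \<partial>M) = 0"
proof -
  have "(\<integral>\<^sup>+x. f x * indicator A x \<partial>M) = (\<integral>\<^sup>+x. 0 \<partial>M)"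
    using AE_not_in[OF assms] by (intro nn_integral_cong_AE) auto
  then show ?thesis by simp
qed

lemma emeasure_restrict_space_le: "A \<subseteq> \<Omega> \<Longrightarrow> emeasure (restrict_space M \<Omega>) A \<le> emeasure M A"
  unfolding restrict_space_def by (rule emeasure_measure_of_le)

text \<open>Stated for arbitrary f, so that it applies directly to the exponential density in
  \<open>tilted_law\<close>.\<close>

lemma emeasure_density_null:
  assumes "emeasure M A = 0"
  shows "emeasure (density M f) A = 0"
proof (cases "A \<in> sets M")
  case True
  then have "A \<in> null_sets M" using assms by auto
  then have "(\<integral>\<^sup>+x. f x * indicator A x \<partial>M) = 0" by (rule nn_integral_null_set)
  then show ?thesis
    unfolding density_def by (rule emeasure_measure_of_null)
qed (simp add: emeasure_notin_sets)

text \<open>The initial path is constant, so \<open>ml_prob_null\<close> starts with \<delta> = 1.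
  Nullity then holds for every initial configuration k and passes through the sum over jump numbers,
  the restriction, the density and the Poisson average.\<close>

lemma reference_measure_null:
  assumes A: "\<And>\<eta> \<delta>. 0 < \<delta> \<Longrightarrow> (\<And>u. u \<in> {0..T} \<Longrightarrow> t - \<delta> < u \<Longrightarrow> u \<le> t \<Longrightarrow> \<eta> u = \<eta> t) \<Longrightarrow> \<eta> \<notin> A"
    and t: "t \<in> {0..T}" and sub: "A \<subseteq> coag_paths T"
  shows "emeasure (reference_measure K \<Upsilon> T \<kappa>) A = 0"
proof -
  have "emeasure (ml_law K \<Upsilon> T k) A = 0" for k
  proof -
    have "ml_prob K \<Upsilon> T n 0 (\<lambda>t\<in>{0..T}. monodisperse k) A = 0" for n
    proof (rule ml_prob_null[where t=t])
      show "\<eta> \<notin> A" if "0 < \<delta>" "\<And>u. u \<in> {0..T} \<Longrightarrow> t - \<delta> < u \<Longrightarrow> u \<le> t \<Longrightarrow> \<eta> u = \<eta> t" for \<eta> \<delta>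
        using that by (rule A[where \<eta>=\<eta>])
      show "t \<in> {0..T}" "(0::real) < 1" using t by auto
    qed (use t in simp)
    then have "(\<Sum>n. ml_prob K \<Upsilon> T n 0 (\<lambda>t\<in>{0..T}. monodisperse k) A) = 0" by simp
    then show ?thesis
      unfolding ml_law_def Let_def by (rule emeasure_measure_of_null)
  qed
  then have "emeasure (restrict_space (ml_law K \<Upsilon> T k) (coag_paths T)) A = 0" for k
    using emeasure_restrict_space_le[OF sub, of "ml_law K \<Upsilon> T k"] by simp
  then have "emeasure (tilted_law K \<Upsilon> T k) A = 0" for k
    unfolding tilted_law_def by (rule emeasure_density_null)
  then have "ennreal (exp 1) * (\<integral>\<^sup>+k. emeasure (tilted_law K \<Upsilon> T k) A \<partial>poisson_law euclidean \<kappa>) = 0"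
    by simp
  then show ?thesis
    unfolding reference_measure_def Let_def by (rule emeasure_measure_of_null)
qed

lemma sets_reference_measure:
  "sets (reference_measure K \<Upsilon> T \<kappa>) = sets (borel_of (coag_path_topology T))"
  unfolding reference_measure_def Let_def
  by (metis sets.sigma_sets_eq sets.space_closed sets_measure_of)

text \<open>Finite entropy forces absolute continuity, because \<open>rel_entropy\<close> is
  infinite otherwise. The exceptional set may depend on g: convergence of \<open>rho\<close> is
  tested one function at a time, so no countable determining class is required.\<close>

lemma (in path_measure) AE_left_continuous:
  assumes t: "t \<in> {0<..T}" and g: "bounded_continuous particles g"
    and ent: "rel_entropy \<nu> (reference_measure K \<Upsilon> T \<kappa>) < \<infinity>"
  shows "AE \<xi> in \<nu>. (\<integral>x. g x \<partial>left_limit \<xi> t) = (\<integral>x. g x \<partial>\<xi> t)"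
proof -
  have t': "t \<in> {0..T}" using t by simp
  let ?A = "{\<xi> \<in> space \<nu>. (\<integral>x. g x \<partial>left_limit \<xi> t) \<noteq> (\<integral>x. g x \<partial>\<xi> t)}"
  interpret k: finite_kernel \<nu> particles "\<lambda>\<xi>. left_limit \<xi> t" "\<lambda>\<xi>. total_mass (\<xi> 0)"
    by (rule finite_kernel_left_limit[OF t])
  obtain C where C: "\<And>x. x \<in> topspace particles \<Longrightarrow> \<bar>g x\<bar> \<le> C"
    using bounded_continuousE[OF g] by blast
  have "g \<in> borel_measurable (borel_of particles)"
    using g by (intro continuous_map_borel_measurable[OF _ refl]) (simp add: bounded_continuous_def)
  then have "(\<lambda>\<xi>. \<integral>x. g x \<partial>left_limit \<xi> t) \<in> borel_measurable \<nu>"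
    using k.integral_mixture(1)[OF _ C] by (simp add: borel_measurable_integrable)
  then have A: "?A \<in> sets \<nu>"
    using measurable_coag_eval[OF g t' sets_nu] by (intro borel_measurable_neq)
  have "emeasure (reference_measure K \<Upsilon> T \<kappa>) ?A = 0"
  proof (rule reference_measure_null[OF _ t'])
    fix \<eta> :: "real \<Rightarrow> ('a \<times> nat) measure" and \<delta> :: real
    assume \<delta>: "0 < \<delta>" and const: "\<And>u. u \<in> {0..T} \<Longrightarrow> t - \<delta> < u \<Longrightarrow> u \<le> t \<Longrightarrow> \<eta> u = \<eta> t"
    show "\<eta> \<notin> ?A"
    proof
      assume "\<eta> \<in> ?A"
      then have \<eta>: "\<eta> \<in> coag_paths T" and ne: "(\<integral>x. g x \<partial>left_limit \<eta> t) \<noteq> (\<integral>x. g x \<partial>\<eta> t)"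
        by (auto simp: space_nu)
      have "\<forall>\<^sub>F u in at_left t. (\<integral>x. g x \<partial>\<eta> u) = (\<integral>x. g x \<partial>\<eta> t)"
        unfolding eventually_at_left_field
      proof (intro exI[of _ "max 0 (t - \<delta>)"] conjI allI impI)
        fix u assume "max 0 (t - \<delta>) < u" "u < t"
        then have "\<eta> u = \<eta> t" using t by (intro const) auto
        then show "(\<integral>x. g x \<partial>\<eta> u) = (\<integral>x. g x \<partial>\<eta> t)" by simp
      qed (use \<delta> t in auto)
      then have "((\<lambda>u. \<integral>x. g x \<partial>\<eta> u) \<longlongrightarrow> (\<integral>x. g x \<partial>\<eta> t)) (at_left t)"
        by (rule tendsto_eventually)
      from tendsto_unique[OF _ left_limit(2)[OF \<eta> t g] this] ne show False
        by (simp add: trivial_limit_at_left_real)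
    qed
  qed (auto simp: space_nu)
  then have "?A \<in> null_sets (reference_measure K \<Upsilon> T \<kappa>)"
    using A by (auto simp: sets_reference_measure sets_nu)
  moreover have "absolutely_continuous (reference_measure K \<Upsilon> T \<kappa>) \<nu>"
    using ent by (auto simp: rel_entropy_def split: if_splits)
  ultimately have "?A \<in> null_sets \<nu>" unfolding absolutely_continuous_def by blast
  from AE_not_in[OF this] show ?thesis by (rule AE_mp) (intro AE_I2, simp)
qed


section \<open>Uniform integrability and convergence\<close>

text \<open>A Fatou property for an unbounded continuous integrand. Its positive part is cut off at
  height k to obtain bounded test functions, and monotone convergence in k follows the limit in n.
  Negative values vanish under \<open>ennreal\<close>.\<close>

lemma weak_limit_nn_integral_le:
  assumes lim: "limitin (weak_topology Y) \<nu>s \<nu> sequentially"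
    and fin: "\<And>n. \<nu>s n \<in> finite_measures Y" "\<nu> \<in> finite_measures Y"
    and \<Phi>: "continuous_map Y euclideanreal \<Phi>"
    and bound: "\<And>n. (\<integral>\<^sup>+x. ennreal (\<Phi> x) \<partial>\<nu>s n) \<le> ennreal \<epsilon>" and \<epsilon>: "0 \<le> \<epsilon>"
  shows "(\<integral>\<^sup>+x. ennreal (\<Phi> x) \<partial>\<nu>) \<le> ennreal \<epsilon>"
proof -
  define \<Psi> where "\<Psi> k x = min (max 0 (\<Phi> x)) (real k)" for k x
  have \<Psi>01: "0 \<le> \<Psi> k x" "\<Psi> k x \<le> real k" "\<Psi> k x \<le> max 0 (\<Phi> x)" for k x by (auto simp: \<Psi>_def)
  have cont: "continuous_map Y euclideanreal (\<Psi> k)" for k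
    unfolding \<Psi>_def by (intro continuous_map_real_min continuous_map_real_max \<Phi>) simp_all
  have bc: "bounded_continuous Y (\<Psi> k)" for k
    using \<Psi>01 by (intro bounded_continuousI[OF cont, of _ "real k"]) simp
  have int: "integrable m (\<Psi> k)" if "m \<in> finite_measures Y" for m k
    using \<Psi>01 by (intro finite_measures_integral(1)[OF that cont, of _ "real k"]) simp
  have le: "(\<integral>x. \<Psi> k x \<partial>\<nu>s n) \<le> \<epsilon>" for k n
  proof -
    have "ennreal (\<integral>x. \<Psi> k x \<partial>\<nu>s n) = (\<integral>\<^sup>+x. ennreal (\<Psi> k x) \<partial>\<nu>s n)"
      using int[OF fin(1)] \<Psi>01 by (intro nn_integral_eq_integral[symmetric]) auto
    also have "\<dots> \<le> (\<integral>\<^sup>+x. ennreal (\<Phi> x) \<partial>\<nu>s n)"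
    proof (rule nn_integral_mono)
      fix x
      have "ennreal (\<Psi> k x) \<le> ennreal (max 0 (\<Phi> x))" by (rule ennreal_leI[OF \<Psi>01(3)])
      then show "ennreal (\<Psi> k x) \<le> ennreal (\<Phi> x)" by (simp add: max_def ennreal_neg split: if_splits)
    qed
    also have "\<dots> \<le> ennreal \<epsilon>" by (rule bound)
    finally show ?thesis using \<epsilon> by (simp add: ennreal_le_iff)
  qed
  have le': "(\<integral>\<^sup>+x. ennreal (\<Psi> k x) \<partial>\<nu>) \<le> ennreal \<epsilon>" for k
  proof -
    have "(\<lambda>n. \<integral>x. \<Psi> k x \<partial>\<nu>s n) \<longlonglongrightarrow> (\<integral>x. \<Psi> k x \<partial>\<nu>)"
      using lim bc by (simp add: limitin_weak_topology)
    then have "(\<integral>x. \<Psi> k x \<partial>\<nu>) \<le> \<epsilon>" by (rule LIMSEQ_le_const2) (use le in auto)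
    then have "ennreal (\<integral>x. \<Psi> k x \<partial>\<nu>) \<le> ennreal \<epsilon>" by (rule ennreal_leI)
    then show ?thesis
      using int[OF fin(2)] \<Psi>01 by (simp add: nn_integral_eq_integral)
  qed
  have "(\<integral>\<^sup>+x. ennreal (\<Phi> x) \<partial>\<nu>) \<le> (\<integral>\<^sup>+x. (SUP k. ennreal (\<Psi> k x)) \<partial>\<nu>)"
  proof (rule nn_integral_mono)
    fix x
    obtain k :: nat where k: "\<Phi> x \<le> real k" using real_arch_simple by blast
    have "\<Phi> x \<le> \<Psi> k x" using k by (simp add: \<Psi>_def)
    then have "ennreal (\<Phi> x) \<le> ennreal (\<Psi> k x)" by (rule ennreal_leI)
    also have "\<dots> \<le> (SUP k. ennreal (\<Psi> k x))" by (rule SUP_upper) simp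
    finally show "ennreal (\<Phi> x) \<le> (SUP k. ennreal (\<Psi> k x))" .
  qed
  also have "\<dots> = (SUP k. \<integral>\<^sup>+x. ennreal (\<Psi> k x) \<partial>\<nu>)"
  proof (rule nn_integral_monotone_convergence_SUP)
    show "incseq (\<lambda>k x. ennreal (\<Psi> k x))"
      by (auto simp: incseq_def le_fun_def \<Psi>_def intro!: ennreal_leI)
    show "(\<lambda>x. ennreal (\<Psi> k x)) \<in> borel_measurable \<nu>" for k
      using borel_measurable_integrable[OF int[OF fin(2)]] by measurable
  qed
  also have "\<dots> \<le> ennreal \<epsilon>" by (rule SUP_least) (rule le')
  finally show ?thesis .
qed

text \<open>Uniform integrability is phrased through the positive part of
  \<open>total_mass (\<xi> 0) - R\<close>, which \<open>ennreal\<close> takes implicitly. Unlike an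
  indicator of large mass it is continuous in the path, so the weak limit inherits the bound with
  the same R.\<close>

locale uniformly_integrable_sequence =
  fixes T :: real and \<nu>s :: "nat \<Rightarrow> (real \<Rightarrow> ('a::polish_space \<times> nat) measure) measure"
    and \<nu> :: "(real \<Rightarrow> ('a \<times> nat) measure) measure"
  assumes T: "0 < T"
    and fins: "\<And>n. \<nu>s n \<in> finite_measures (coag_path_topology T)"
    and fin: "\<nu> \<in> finite_measures (coag_path_topology T)"
    and weak: "limitin (weak_topology (coag_path_topology T)) \<nu>s \<nu> sequentially"
    and tail: "\<And>\<epsilon>. 0 < \<epsilon> \<Longrightarrow> \<exists>R\<ge>0. \<forall>n. (\<integral>\<^sup>+\<xi>. ennreal (total_mass (\<xi> 0) - R) \<partial>\<nu>s n) \<le> ennreal \<epsilon>"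
begin

lemma mass_continuous: "continuous_map (coag_path_topology T) euclideanreal (\<lambda>\<xi>. total_mass (\<xi> 0))"
  using T by (intro continuous_map_initial_mass) simp

lemma mass_nonneg: "0 \<le> total_mass m"
  by (simp add: total_mass_def)

lemma tail_limit:
  assumes "0 < \<epsilon>"
  obtains R where "0 \<le> R" "\<And>n. (\<integral>\<^sup>+\<xi>. ennreal (total_mass (\<xi> 0) - R) \<partial>\<nu>s n) \<le> ennreal \<epsilon>"
    "(\<integral>\<^sup>+\<xi>. ennreal (total_mass (\<xi> 0) - R) \<partial>\<nu>) \<le> ennreal \<epsilon>"
proof -
  obtain R where R: "0 \<le> R" "\<And>n. (\<integral>\<^sup>+\<xi>. ennreal (total_mass (\<xi> 0) - R) \<partial>\<nu>s n) \<le> ennreal \<epsilon>"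
    using tail[OF assms] by blast
  have "continuous_map (coag_path_topology T) euclideanreal (\<lambda>\<xi>. total_mass (\<xi> 0) - R)"
    by (intro continuous_map_diff mass_continuous) simp
  then have "(\<integral>\<^sup>+\<xi>. ennreal (total_mass (\<xi> 0) - R) \<partial>\<nu>) \<le> ennreal \<epsilon>"
    by (rule weak_limit_nn_integral_le[OF weak fins fin _ R(2)]) (use assms in simp)
  then show ?thesis using that R by blast
qed

lemma path_measureI:
  fixes m :: "(real \<Rightarrow> ('a \<times> nat) measure) measure"
  assumes m: "m \<in> finite_measures (coag_path_topology T)"
    and R: "(\<integral>\<^sup>+\<xi>. ennreal (total_mass (\<xi> 0) - R) \<partial>m) \<le> ennreal \<epsilon>" "0 \<le> R"
  shows "path_measure T m"
proof
  interpret finite_measure m using finite_measuresD(1)[OF m] .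
  have meas: "(\<lambda>\<xi>. total_mass (\<xi> 0)) \<in> borel_measurable m"
    by (rule continuous_map_borel_measurable[OF mass_continuous finite_measuresD(2)[OF m]])
  have "(\<integral>\<^sup>+\<xi>. ennreal (total_mass (\<xi> 0)) \<partial>m) \<le> (\<integral>\<^sup>+\<xi>. ennreal (total_mass (\<xi> 0) - R) + ennreal R \<partial>m)"
  proof (rule nn_integral_mono)
    fix \<xi> :: "real \<Rightarrow> ('a \<times> nat) measure"
    show "ennreal (total_mass (\<xi> 0)) \<le> ennreal (total_mass (\<xi> 0) - R) + ennreal R"
    proof (cases "R \<le> total_mass (\<xi> 0)")
      case True
      then have "ennreal (total_mass (\<xi> 0) - R) + ennreal R = ennreal (total_mass (\<xi> 0) - R + R)"
        using R(2) by (intro ennreal_plus[symmetric]) auto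
      then show ?thesis by simp
    next
      case False
      then have "ennreal (total_mass (\<xi> 0)) \<le> ennreal R" by (intro ennreal_leI) simp
      then show ?thesis by (simp add: add_increasing)
    qed
  qed
  also have "\<dots> = (\<integral>\<^sup>+\<xi>. ennreal (total_mass (\<xi> 0) - R) \<partial>m) + (\<integral>\<^sup>+\<xi>. ennreal R \<partial>m)"
    using meas
    by (intro nn_integral_add measurable_compose[OF _ measurable_ennreal] borel_measurable_diff
        borel_measurable_const)
  also have "\<dots> < \<infinity>"
    using R(1) by (auto simp: less_top[symmetric] ennreal_mult_eq_top_iff emeasure_finite top_unique)
  finally show "integrable m (\<lambda>\<xi>. total_mass (\<xi> 0))"
    using meas mass_nonneg by (intro integrableI_nonneg) auto
qed (use T m in auto)

lemma path_measures: "path_measure T (\<nu>s n)" "path_measure T \<nu>"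
proof -
  obtain R where R: "0 \<le> R" "\<And>n. (\<integral>\<^sup>+\<xi>. ennreal (total_mass (\<xi> 0) - R) \<partial>\<nu>s n) \<le> ennreal 1"
    "(\<integral>\<^sup>+\<xi>. ennreal (total_mass (\<xi> 0) - R) \<partial>\<nu>) \<le> ennreal 1"
    using tail_limit[of 1] by auto
  show "path_measure T (\<nu>s n)" by (rule path_measureI[OF fins R(2,1)])
  show "path_measure T \<nu>" by (rule path_measureI[OF fin R(3,1)])
qed

text \<open>Clipping \<Phi> at height C * R changes it by at most C times the positive part of
  \<open>total_mass (\<xi> 0) - R\<close>, which is what the tail condition controls.\<close>

lemma truncation_error:
  fixes m :: "(real \<Rightarrow> ('a \<times> nat) measure) measure"
  assumes m: "path_measure T m" and R: "(\<integral>\<^sup>+\<xi>. ennreal (total_mass (\<xi> 0) - R) \<partial>m) \<le> ennreal \<epsilon>" "0 \<le> R" "0 \<le> \<epsilon>"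
    and \<Phi>: "continuous_map (coag_path_topology T) euclideanreal \<Phi>"
    and bound: "\<And>\<xi>. \<xi> \<in> coag_paths T \<Longrightarrow> \<bar>\<Phi> \<xi>\<bar> \<le> C * total_mass (\<xi> 0)" and C: "0 \<le> C"
  shows "\<bar>(\<integral>\<xi>. \<Phi> \<xi> \<partial>m) - (\<integral>\<xi>. max (- (C * R)) (min (\<Phi> \<xi>) (C * R)) \<partial>m)\<bar> \<le> C * \<epsilon>"
proof -
  interpret path_measure T m by (rule m)
  let ?\<Psi> = "\<lambda>\<xi>. max (- (C * R)) (min (\<Phi> \<xi>) (C * R))"
  have meas: "\<Phi> \<in> borel_measurable m"
    by (rule continuous_map_borel_measurable[OF \<Phi> sets_nu])
  have int: "integrable m \<Phi>"
    by (rule Bochner_Integration.integrable_bound[where f="\<lambda>\<xi>. C * total_mass (\<xi> 0)"])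
      (use meas integrable_mass bound in \<open>auto simp: space_nu intro!: AE_I2 order_trans[OF bound]\<close>)
  have int': "integrable m ?\<Psi>"
  proof (rule Bochner_Integration.integrable_bound[OF int])
    have "0 \<le> C * R" using C R by simp
    then show "AE \<xi> in m. norm (?\<Psi> \<xi>) \<le> norm (\<Phi> \<xi>)" by (intro AE_I2) auto
  qed (use meas in measurable)
  have tail_int: "integrable m (\<lambda>\<xi>. max 0 (total_mass (\<xi> 0) - R))"
    using integrable_mass finite_measure.integrable_const[OF finite_nu]
    by (intro integrable_max Bochner_Integration.integrable_diff) auto
  have "\<bar>(\<integral>\<xi>. \<Phi> \<xi> \<partial>m) - (\<integral>\<xi>. ?\<Psi> \<xi> \<partial>m)\<bar> = \<bar>\<integral>\<xi>. \<Phi> \<xi> - ?\<Psi> \<xi> \<partial>m\<bar>"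
    using int int' by simp
  also have "\<dots> \<le> (\<integral>\<xi>. \<bar>\<Phi> \<xi> - ?\<Psi> \<xi>\<bar> \<partial>m)" by (rule integral_abs_bound)
  also have "\<dots> \<le> (\<integral>\<xi>. C * max 0 (total_mass (\<xi> 0) - R) \<partial>m)"
  proof (rule integral_mono)
    fix \<xi> assume "\<xi> \<in> space m"
    then have "\<bar>\<Phi> \<xi>\<bar> \<le> C * total_mass (\<xi> 0)" by (intro bound) (simp add: space_nu)
    moreover have "C * max 0 (total_mass (\<xi> 0) - R) \<ge> C * total_mass (\<xi> 0) - C * R"
      using mult_left_mono[OF max.cobounded2[of "total_mass (\<xi> 0) - R" 0] C] by (simp add: right_diff_distrib)
    moreover have "0 \<le> C * max 0 (total_mass (\<xi> 0) - R)" "0 \<le> C * R" using C R by auto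
    ultimately show "\<bar>\<Phi> \<xi> - ?\<Psi> \<xi>\<bar> \<le> C * max 0 (total_mass (\<xi> 0) - R)" by linarith
  qed (use int int' tail_int in auto)
  also have "\<dots> = C * (\<integral>\<xi>. max 0 (total_mass (\<xi> 0) - R) \<partial>m)" by simp
  also have "\<dots> \<le> C * \<epsilon>"
  proof (rule mult_left_mono[OF _ C])
    have "ennreal (\<integral>\<xi>. max 0 (total_mass (\<xi> 0) - R) \<partial>m) = (\<integral>\<^sup>+\<xi>. ennreal (max 0 (total_mass (\<xi> 0) - R)) \<partial>m)"
      using tail_int by (intro nn_integral_eq_integral[symmetric]) auto
    also have "\<dots> = (\<integral>\<^sup>+\<xi>. ennreal (total_mass (\<xi> 0) - R) \<partial>m)"
      by (intro nn_integral_cong) (simp add: max_def ennreal_neg)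
    finally have "ennreal (\<integral>\<xi>. max 0 (total_mass (\<xi> 0) - R) \<partial>m) \<le> ennreal \<epsilon>" using R(1) by simp
    then show "(\<integral>\<xi>. max 0 (total_mass (\<xi> 0) - R) \<partial>m) \<le> \<epsilon>" using R(3) by (simp add: ennreal_le_iff)
  qed
  finally show ?thesis .
qed

lemma integral_tendsto:
  assumes \<Phi>: "continuous_map (coag_path_topology T) euclideanreal \<Phi>"
    and bound: "\<And>\<xi>. \<xi> \<in> coag_paths T \<Longrightarrow> \<bar>\<Phi> \<xi>\<bar> \<le> C * total_mass (\<xi> 0)" and C: "0 \<le> C"
  shows "(\<lambda>n. \<integral>\<xi>. \<Phi> \<xi> \<partial>\<nu>s n) \<longlonglongrightarrow> (\<integral>\<xi>. \<Phi> \<xi> \<partial>\<nu>)"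
proof (rule LIMSEQ_I)
  fix r :: real assume r: "0 < r"
  \<comment> \<open>Two truncation errors and the error of weak convergence share r equally; C + 1
    replaces C because C may be 0.\<close>
  define \<epsilon> where "\<epsilon> = r / (3 * (C + 1))"
  have \<epsilon>: "0 < \<epsilon>" "C * \<epsilon> < r / 3"
  proof -
    show "0 < \<epsilon>" using r C by (simp add: \<epsilon>_def)
    then have "C * \<epsilon> < (C + 1) * \<epsilon>" by (intro mult_strict_right_mono) auto
    also have "\<dots> = r / 3" using C by (simp add: \<epsilon>_def field_simps add_nonneg_eq_0_iff)
    finally show "C * \<epsilon> < r / 3" .
  qed
  obtain R where R: "0 \<le> R" "\<And>n. (\<integral>\<^sup>+\<xi>. ennreal (total_mass (\<xi> 0) - R) \<partial>\<nu>s n) \<le> ennreal \<epsilon>"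
    "(\<integral>\<^sup>+\<xi>. ennreal (total_mass (\<xi> 0) - R) \<partial>\<nu>) \<le> ennreal \<epsilon>"
    using tail_limit[OF \<epsilon>(1)] by blast
  let ?\<Psi> = "\<lambda>\<xi>. max (- (C * R)) (min (\<Phi> \<xi>) (C * R))"
  have "bounded_continuous (coag_path_topology T) ?\<Psi>"
  proof (rule bounded_continuousI[where C="C * R"])
    show "continuous_map (coag_path_topology T) euclideanreal ?\<Psi>"
      by (intro continuous_map_real_max continuous_map_real_min \<Phi>) simp_all
    have "0 \<le> C * R" using C R by simp
    then show "\<bar>?\<Psi> \<xi>\<bar> \<le> C * R" for \<xi> by linarith
  qed
  then have "(\<lambda>n. \<integral>\<xi>. ?\<Psi> \<xi> \<partial>\<nu>s n) \<longlonglongrightarrow> (\<integral>\<xi>. ?\<Psi> \<xi> \<partial>\<nu>)"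
    using weak by (simp add: limitin_weak_topology)
  then have "\<forall>\<^sub>F n in sequentially. dist (\<integral>\<xi>. ?\<Psi> \<xi> \<partial>\<nu>s n) (\<integral>\<xi>. ?\<Psi> \<xi> \<partial>\<nu>) < r / 3"
    by (rule tendstoD) (use r in simp)
  then have "\<forall>\<^sub>F n in sequentially. norm ((\<integral>\<xi>. \<Phi> \<xi> \<partial>\<nu>s n) - (\<integral>\<xi>. \<Phi> \<xi> \<partial>\<nu>)) < r"
  proof eventually_elim
    case (elim n)
    have "\<bar>(\<integral>\<xi>. \<Phi> \<xi> \<partial>\<nu>s n) - (\<integral>\<xi>. ?\<Psi> \<xi> \<partial>\<nu>s n)\<bar> \<le> C * \<epsilon>"
      by (rule truncation_error[OF path_measures(1) R(2,1) less_imp_le[OF \<epsilon>(1)] \<Phi> bound C])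
    moreover have "\<bar>(\<integral>\<xi>. \<Phi> \<xi> \<partial>\<nu>) - (\<integral>\<xi>. ?\<Psi> \<xi> \<partial>\<nu>)\<bar> \<le> C * \<epsilon>"
      by (rule truncation_error[OF path_measures(2) R(3,1) less_imp_le[OF \<epsilon>(1)] \<Phi> bound C])
    ultimately show ?case using elim \<epsilon>(2) unfolding real_norm_def dist_real_def by linarith
  qed
  then show "\<exists>no. \<forall>n\<ge>no. norm ((\<integral>\<xi>. \<Phi> \<xi> \<partial>\<nu>s n) - (\<integral>\<xi>. \<Phi> \<xi> \<partial>\<nu>)) < r"
    by (simp add: eventually_sequentially)
qed

lemma subsequence:
  assumes "strict_mono r"
  shows "uniformly_integrable_sequence T (\<nu>s \<circ> r) \<nu>"
proof
  show "limitin (weak_topology (coag_path_topology T)) (\<nu>s \<circ> r) \<nu> sequentially"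
    using limitin_subsequence[OF assms weak] by simp
  show "\<exists>R\<ge>0. \<forall>n. (\<integral>\<^sup>+\<xi>. ennreal (total_mass (\<xi> 0) - R) \<partial>(\<nu>s \<circ> r) n) \<le> ennreal \<epsilon>" if "0 < \<epsilon>" for \<epsilon>
    using tail[OF that] by auto
qed (use T fins fin in auto)

text \<open>Applied to the constant sequence, the convergence result below says that the averaged
  path of \<nu> is itself continuous in time.\<close>

lemma constant_sequence: "uniformly_integrable_sequence T (\<lambda>_. \<nu>) \<nu>"
proof
  show "limitin (weak_topology (coag_path_topology T)) (\<lambda>_. \<nu>) \<nu> sequentially"
    using fin by (simp add: topspace_weak_topology)
  show "\<exists>R\<ge>0. \<forall>n::nat. (\<integral>\<^sup>+\<xi>. ennreal (total_mass (\<xi> 0) - R) \<partial>\<nu>) \<le> ennreal \<epsilon>" if "0 < \<epsilon>" for \<epsilon>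
    using tail_limit[OF that] by metis
qed (use T fin in auto)

end

text \<open>The added assumption is the only information about the reference measure that the
  convergence argument uses.\<close>

locale jump_free_limit = uniformly_integrable_sequence +
  assumes jump_free: "\<And>t g. t \<in> {0<..T} \<Longrightarrow> bounded_continuous particles g \<Longrightarrow>
    AE \<xi> in \<nu>. (\<integral>x. g x \<partial>left_limit \<xi> t) = (\<integral>x. g x \<partial>\<xi> t)"
begin

text \<open>Right-continuity holds for every trajectory, and equality of left limit and value
  supplies the other side. At 0 and at T one of the two sides is void.\<close>

lemma AE_continuous:
  assumes t: "t \<in> {0..T}" and g: "bounded_continuous particles g"
  shows "AE \<xi> in \<nu>. \<forall>\<epsilon>>0. \<exists>\<delta>>0. \<forall>s\<in>{0..T}. \<bar>s - t\<bar> < \<delta> \<longrightarrow> \<bar>(\<integral>x. g x \<partial>\<xi> s) - (\<integral>x. g x \<partial>\<xi> t)\<bar> < \<epsilon>"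
proof -
  interpret path_measure T \<nu> by (rule path_measures(2))
  have "AE \<xi> in \<nu>. \<xi> \<in> coag_paths T \<and> (0 < t \<longrightarrow> (\<integral>x. g x \<partial>left_limit \<xi> t) = (\<integral>x. g x \<partial>\<xi> t))"
  proof (cases "0 < t")
    case True
    then have "AE \<xi> in \<nu>. (\<integral>x. g x \<partial>left_limit \<xi> t) = (\<integral>x. g x \<partial>\<xi> t)"
      using t by (intro jump_free g) simp
    with AE_space[of \<nu>] show ?thesis by eventually_elim (simp add: space_nu)
  qed (use AE_space[of \<nu>] in \<open>simp add: space_nu\<close>)
  then show ?thesis
  proof eventually_elim
    case (elim \<xi>)
    show ?case
    proof (intro allI impI)
      fix \<epsilon> :: real assume \<epsilon>: "0 < \<epsilon>"
      let ?P = "\<lambda>s. \<bar>(\<integral>x. g x \<partial>\<xi> s) - (\<integral>x. g x \<partial>\<xi> t)\<bar> < \<epsilon>"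
      have "\<exists>b>t. \<forall>s. t < s \<longrightarrow> s < b \<longrightarrow> s \<le> T \<longrightarrow> ?P s"
      proof (cases "t < T")
        case True
        then have "t \<in> {0..<T}" using t by simp
        from tendstoD[OF coag_paths_limit[OF conjunct1[OF elim] g this] \<epsilon>]
        show ?thesis unfolding eventually_at_right_field dist_real_def by blast
      qed (intro exI[of _ "t + 1"], auto)
      then obtain b where b: "t < b" "\<And>s. t < s \<Longrightarrow> s < b \<Longrightarrow> s \<le> T \<Longrightarrow> ?P s" by blast
      have "\<exists>a<t. \<forall>s. a < s \<longrightarrow> s < t \<longrightarrow> 0 \<le> s \<longrightarrow> ?P s"
      proof (cases "0 < t")
        case True
        then have t': "t \<in> {0<..T}" using t by simp
        have "((\<lambda>s. \<integral>x. g x \<partial>\<xi> s) \<longlongrightarrow> (\<integral>x. g x \<partial>\<xi> t)) (at_left t)"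
          using left_limit(2)[OF conjunct1[OF elim] t' g] elim True by simp
        from tendstoD[OF this \<epsilon>]
        show ?thesis unfolding eventually_at_left_field dist_real_def by blast
      qed (intro exI[of _ "t - 1"], auto)
      then obtain a where a: "a < t" "\<And>s. a < s \<Longrightarrow> s < t \<Longrightarrow> 0 \<le> s \<Longrightarrow> ?P s" by blast
      show "\<exists>\<delta>>0. \<forall>s\<in>{0..T}. \<bar>s - t\<bar> < \<delta> \<longrightarrow> ?P s"
      proof (intro exI[of _ "min (b - t) (t - a)"] conjI ballI impI)
        fix s assume s: "s \<in> {0..T}" "\<bar>s - t\<bar> < min (b - t) (t - a)"
        consider "s < t" | "s = t" | "t < s" by linarith
        then show "?P s"
        proof cases
          case 1 then show ?thesis using s by (intro a(2)) auto
        next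
          case 2 then show ?thesis using \<epsilon> by simp
        next
          case 3 then show ?thesis using s by (intro b(2)) auto
        qed
      qed (use a b in simp)
    qed
  qed
qed

text \<open>The envelope at slope \<open>L\<close> dominates the value at time \<open>t\<^sub>n\<close> up to \<open>L |t\<^sub>n - t|\<close>; as
  \<open>L\<close> tends to infinity it decreases to the value at \<open>t\<close> for every path that is continuous at \<open>t\<close>.\<close>

lemma eventually_rho_less:
  assumes s: "\<And>n. s n \<in> {0..T}" "s \<longlonglongrightarrow> t" and g: "bounded_continuous particles g"
    and \<epsilon>: "(\<integral>x. g x \<partial>rho T \<nu> t) < c"
  shows "\<forall>\<^sub>F n in sequentially. (\<integral>x. g x \<partial>rho T (\<nu>s n) (s n)) < c"
proof -
  interpret path_measure T \<nu> by (rule path_measures(2))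
  have t: "t \<in> {0..T}"
    using closed_sequentially[OF closed_atLeastAtMost _ s(2)] s(1) by blast
  obtain C where C: "0 \<le> C" "\<And>x. x \<in> topspace particles \<Longrightarrow> \<bar>g x\<bar> \<le> C"
    using bounded_continuousE[OF g] by blast
  define F where "F k \<xi> = envelope T ((real k + 1)\<^sup>2) t (\<lambda>s. \<integral>x. g x \<partial>\<xi> s)" for k :: nat and \<xi> :: "real \<Rightarrow> ('a \<times> nat) measure"
  have Fc: "continuous_map (coag_path_topology T) euclideanreal (F k)" for k
    unfolding F_def using T by (intro continuous_map_coag_envelope g) auto
  have I: "\<bar>\<integral>x. g x \<partial>\<xi> u\<bar> \<le> C * total_mass (\<xi> 0)" if "\<xi> \<in> coag_paths T" "u \<in> {0..T}" for \<xi> u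
    by (rule coag_paths_integral_bound[OF g C(2,1) that])
  have Fb: "\<bar>F k \<xi>\<bar> \<le> C * total_mass (\<xi> 0)" if "\<xi> \<in> coag_paths T" for k \<xi>
    unfolding F_def by (rule envelope_bound[OF I[OF that] _ t]) auto
  \<comment> \<open>This limit concerns \<nu> alone and serves to select one slope; n plays no part
    yet.\<close>
  have "(\<lambda>k. \<integral>\<xi>. F k \<xi> \<partial>\<nu>) \<longlonglongrightarrow> (\<integral>\<xi>. \<integral>x. g x \<partial>\<xi> t \<partial>\<nu>)"
  proof (rule integral_dominated_convergence[where w="\<lambda>\<xi>. C * total_mass (\<xi> 0)"])
    show "F k \<in> borel_measurable \<nu>" for k
      by (rule continuous_map_borel_measurable[OF Fc sets_nu])
    show "AE \<xi> in \<nu>. norm (F k \<xi>) \<le> C * total_mass (\<xi> 0)" for k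
      using Fb by (intro AE_I2) (simp add: space_nu)
    show "AE \<xi> in \<nu>. (\<lambda>k. F k \<xi>) \<longlonglongrightarrow> (\<integral>x. g x \<partial>\<xi> t)"
      using AE_continuous[OF t g] AE_space[of \<nu>]
    proof eventually_elim
      case (elim \<xi>)
      then have \<xi>: "\<xi> \<in> coag_paths T" by (simp add: space_nu)
      show ?case
        unfolding F_def
      proof (rule envelope_tendsto[OF I[OF \<xi>]])
        fix \<epsilon> :: real assume "0 < \<epsilon>"
        then obtain \<delta> where \<delta>: "0 < \<delta>"
          "\<And>s. s \<in> {0..T} \<Longrightarrow> \<bar>s - t\<bar> < \<delta> \<Longrightarrow> \<bar>(\<integral>x. g x \<partial>\<xi> s) - (\<integral>x. g x \<partial>\<xi> t)\<bar> < \<epsilon>"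
          using elim(1) by blast
        have "(\<lambda>k. 1 / (real k + 1)) \<longlonglongrightarrow> 0" by real_asymp
        from order_tendstoD(2)[OF this \<delta>(1)]
        show "\<forall>\<^sub>F k in sequentially. \<forall>s\<in>{0..T}. \<bar>s - t\<bar> < 1 / (real k + 1) \<longrightarrow>
            \<bar>(\<integral>x. g x \<partial>\<xi> s) - (\<integral>x. g x \<partial>\<xi> t)\<bar> \<le> \<epsilon>"
        proof eventually_elim
          case (elim k)
          show ?case
          proof (intro ballI impI)
            fix s assume "s \<in> {0..T}" "\<bar>s - t\<bar> < 1 / (real k + 1)"
            then show "\<bar>(\<integral>x. g x \<partial>\<xi> s) - (\<integral>x. g x \<partial>\<xi> t)\<bar> \<le> \<epsilon>"
              using elim by (intro less_imp_le \<delta>(2)) auto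
          qed
        qed
      qed (use t in auto)
    qed
  qed (use measurable_coag_eval[OF g t sets_nu] integrable_mass in auto)
  then have "(\<lambda>k. \<integral>\<xi>. F k \<xi> \<partial>\<nu>) \<longlonglongrightarrow> (\<integral>x. g x \<partial>rho T \<nu> t)"
    by (simp add: integral_rho(2)[OF g t])
  from eventually_happens[OF order_tendstoD(2)[OF this \<epsilon>]]
  obtain k where k: "(\<integral>\<xi>. F k \<xi> \<partial>\<nu>) < c" by auto
  \<comment> \<open>The slope is frozen from here on, so its product with the distance of
    \<open>s n\<close> to t tends to 0.\<close>
  let ?L = "(real k + 1)\<^sup>2"
  have le: "(\<integral>x. g x \<partial>rho T (\<nu>s n) (s n)) \<le> (\<integral>\<xi>. F k \<xi> \<partial>\<nu>s n) + ?L * \<bar>s n - t\<bar> * total_mass (\<nu>s n)" for n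
  proof -
    interpret n: path_measure T "\<nu>s n" by (rule path_measures(1))
    have const: "integrable (\<nu>s n) (\<lambda>_. a)" for a :: real
      by (rule finite_measure.integrable_const[OF n.finite_nu])
    have Fi: "integrable (\<nu>s n) (F k)"
    proof (rule Bochner_Integration.integrable_bound)
      show "integrable (\<nu>s n) (\<lambda>\<xi>. C * total_mass (\<xi> 0))" using n.integrable_mass by simp
      show "F k \<in> borel_measurable (\<nu>s n)" by (rule continuous_map_borel_measurable[OF Fc n.sets_nu])
      show "AE \<xi> in \<nu>s n. norm (F k \<xi>) \<le> norm (C * total_mass (\<xi> 0))"
        using Fb by (intro AE_I2) (auto simp: n.space_nu intro: order_trans[OF _ abs_ge_self])
    qed
    have "(\<integral>\<xi>. \<integral>x. g x \<partial>\<xi> (s n) \<partial>\<nu>s n) \<le> (\<integral>\<xi>. F k \<xi> + ?L * \<bar>s n - t\<bar> \<partial>\<nu>s n)"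
    proof (rule integral_mono)
      fix \<xi> assume "\<xi> \<in> space (\<nu>s n)"
      then have \<xi>: "\<xi> \<in> coag_paths T" by (simp add: n.space_nu)
      have "(\<integral>x. g x \<partial>\<xi> u) \<le> C * total_mass (\<xi> 0)" if "u \<in> {0..T}" for u
        using I[OF \<xi> that] by simp
      from envelope_upper[where h="\<lambda>s. \<integral>x. g x \<partial>\<xi> s" and t=t and L="?L", OF this _ s(1)[of n]]
      show "(\<integral>x. g x \<partial>\<xi> (s n)) \<le> F k \<xi> + ?L * \<bar>s n - t\<bar>" by (simp add: F_def)
    qed (use n.integral_rho(1)[OF g s(1)] Fi const in auto)
    also have "\<dots> = (\<integral>\<xi>. F k \<xi> \<partial>\<nu>s n) + (\<integral>\<xi>. ?L * \<bar>s n - t\<bar> \<partial>\<nu>s n)"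
      by (rule Bochner_Integration.integral_add[OF Fi const])
    finally show ?thesis
      using n.integral_rho(2)[OF g s(1)] by (simp add: total_mass_def mult_ac)
  qed
  \<comment> \<open>The \<nu>s are not probability measures; the test function 1 shows that their
    masses converge, which keeps the penalty term under control.\<close>
  have "(\<lambda>n. total_mass (\<nu>s n)) \<longlonglongrightarrow> total_mass \<nu>"
    using weak bounded_continuous_const[of "coag_path_topology T" 1]
    unfolding limitin_weak_topology integral_one[symmetric] by blast
  moreover have "(\<lambda>n. \<bar>s n - t\<bar>) \<longlonglongrightarrow> 0"
    using s(2) by (simp add: LIM_zero tendsto_rabs_zero)
  moreover have "(\<lambda>n. \<integral>\<xi>. F k \<xi> \<partial>\<nu>s n) \<longlonglongrightarrow> (\<integral>\<xi>. F k \<xi> \<partial>\<nu>)"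
    by (rule integral_tendsto[OF Fc Fb C(1)])
  ultimately have "(\<lambda>n. (\<integral>\<xi>. F k \<xi> \<partial>\<nu>s n) + ?L * \<bar>s n - t\<bar> * total_mass (\<nu>s n)) \<longlonglongrightarrow>
      (\<integral>\<xi>. F k \<xi> \<partial>\<nu>) + ?L * 0 * total_mass \<nu>"
    by (intro tendsto_intros)
  then have "\<forall>\<^sub>F n in sequentially. (\<integral>\<xi>. F k \<xi> \<partial>\<nu>s n) + ?L * \<bar>s n - t\<bar> * total_mass (\<nu>s n) < c"
    by (rule order_tendstoD(2)) (use k in simp)
  then show ?thesis by eventually_elim (rule le_less_trans[OF le])
qed

lemma rho_tendsto:
  assumes s: "\<And>n. s n \<in> {0..T}" "s \<longlonglongrightarrow> t"
  shows "limitin (weak_topology particles) (\<lambda>n. rho T (\<nu>s n) (s n)) (rho T \<nu> t) sequentially"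
proof -
  have t: "t \<in> {0..T}"
    using closed_sequentially[OF closed_atLeastAtMost _ s(2)] s(1) by blast
  have "(\<lambda>n. \<integral>x. g x \<partial>rho T (\<nu>s n) (s n)) \<longlonglongrightarrow> (\<integral>x. g x \<partial>rho T \<nu> t)" if g: "bounded_continuous particles g" for g
  proof (rule order_tendstoI)
    fix c assume "(\<integral>x. g x \<partial>rho T \<nu> t) < c"
    then show "\<forall>\<^sub>F n in sequentially. (\<integral>x. g x \<partial>rho T (\<nu>s n) (s n)) < c"
      by (rule eventually_rho_less[OF s g])
  next
    fix c assume "c < (\<integral>x. g x \<partial>rho T \<nu> t)"
    then have "(\<integral>x. - g x \<partial>rho T \<nu> t) < - c" by simp
    from eventually_rho_less[OF s bounded_continuous_uminus[OF g] this]
    show "\<forall>\<^sub>F n in sequentially. c < (\<integral>x. g x \<partial>rho T (\<nu>s n) (s n))" by simp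
  qed
  then show ?thesis
    using path_measure.rho_finite_measures[OF path_measures(1) s(1)]
      path_measure.rho_finite_measures[OF path_measures(2) t]
    by (auto simp: limitin_weak_topology)
qed

text \<open>If uniformity fails, there are bad times along a subsequence, and these cluster at some
  l. Both averaged paths, taken at the bad times, converge to \<open>rho T \<nu> l\<close>, so joint
  continuity of d forces their distance to 0.\<close>

lemma rho_uniform:
  assumes d: "continuous_pseudometric (weak_topology particles) d" and c: "0 < c"
  shows "\<forall>\<^sub>F n in sequentially. \<forall>t\<in>{0..T}. d (rho T \<nu> t) (rho T (\<nu>s n) t) \<le> c"
proof (rule ccontr)
  assume "\<not> ?thesis"
  then have freq: "\<exists>\<^sub>F n in sequentially. \<exists>t\<in>{0..T}. d (rho T \<nu> t) (rho T (\<nu>s n) t) > c"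
    by (simp add: not_eventually not_le)
  obtain r :: "nat \<Rightarrow> nat" where r: "strict_mono r"
    "\<And>n. \<exists>t\<in>{0..T}. d (rho T \<nu> t) (rho T (\<nu>s (r n)) t) > c"
    using not_eventually_sequentiallyD[of "\<lambda>n. \<not> (\<exists>t\<in>{0..T}. d (rho T \<nu> t) (rho T (\<nu>s n) t) > c)"] freq
    unfolding frequently_def by auto
  from r(2) have "\<exists>t. \<forall>n. t n \<in> {0..T} \<and> d (rho T \<nu> (t n)) (rho T (\<nu>s (r n)) (t n)) > c"
    by (intro choice) blast
  then obtain t where t: "\<And>n. t n \<in> {0..T}" "\<And>n. d (rho T \<nu> (t n)) (rho T (\<nu>s (r n)) (t n)) > c"
    by blast
  obtain l q where q: "strict_mono q" "(t \<circ> q) \<longlonglongrightarrow> l"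
    using t(1) compact_Icc[of 0 T] unfolding compact_def by blast
  \<comment> \<open>\<open>a\<close> handles the measures along the subsequence, \<open>b\<close>
    the fixed limit evaluated at the same moving times.\<close>
  interpret a: jump_free_limit T "\<nu>s \<circ> (r \<circ> q)" \<nu>
    by (intro jump_free_limit.intro subsequence strict_mono_o r q jump_free_limit_axioms.intro jump_free)
  interpret b: jump_free_limit T "\<lambda>_. \<nu>" \<nu>
    by (intro jump_free_limit.intro constant_sequence jump_free_limit_axioms.intro jump_free)
  have tq: "(t \<circ> q) n \<in> {0..T}" for n using t(1) by simp
  have A: "limitin (weak_topology particles) (\<lambda>n. rho T \<nu> (t (q n))) (rho T \<nu> l) sequentially"
    using b.rho_tendsto[OF tq q(2)] by simp
  have B: "limitin (weak_topology particles) (\<lambda>n. rho T (\<nu>s (r (q n))) (t (q n))) (rho T \<nu> l) sequentially"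
    using a.rho_tendsto[OF tq q(2)] by simp
  have l: "rho T \<nu> l \<in> topspace (weak_topology particles)" using A by (rule limitin_topspace)
  have "limitin (prod_topology (weak_topology particles) (weak_topology particles))
      (\<lambda>n. (rho T \<nu> (t (q n)), rho T (\<nu>s (r (q n))) (t (q n)))) (rho T \<nu> l, rho T \<nu> l) sequentially"
    using A B by (simp add: limitin_pairwise comp_def)
  from continuous_map_limit[OF _ this, of euclideanreal "\<lambda>(x, y). d x y"] d
  have "(\<lambda>n. d (rho T \<nu> (t (q n))) (rho T (\<nu>s (r (q n))) (t (q n)))) \<longlonglongrightarrow> d (rho T \<nu> l) (rho T \<nu> l)"
    by (simp add: continuous_pseudometric_def comp_def)
  moreover have "d (rho T \<nu> l) (rho T \<nu> l) = 0"
    using d l by (simp add: continuous_pseudometric_def)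
  ultimately have "c \<le> 0" by (intro LIMSEQ_le_const[of _ 0 c]) (use t(2) in \<open>auto intro: less_imp_le\<close>)
  then show False using c by simp
qed

lemma rho_skorohod_tendsto:
  "limitin (skorohod_topology T (weak_topology particles)) (\<lambda>n. rho T (\<nu>s n)) (rho T \<nu>) sequentially"
  unfolding limitin_def topspace_skorohod_topology
proof (intro conjI allI impI)
  show "rho T \<nu> \<in> cadlag T (weak_topology particles)"
    by (rule path_measure.rho_cadlag[OF path_measures(2)])
  fix U assume "openin (skorohod_topology T (weak_topology particles)) U \<and> rho T \<nu> \<in> U"
  then obtain d \<epsilon> where d: "continuous_pseudometric (weak_topology particles) d" and \<epsilon>: "0 < \<epsilon>"
    and sub: "{\<eta> \<in> cadlag T (weak_topology particles). skorohod_dist T d (rho T \<nu>) \<eta> < \<epsilon>} \<subseteq> U"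
    unfolding openin_skorohod by blast
  \<comment> \<open>The radius \<epsilon> may be infinite, and a non-strict bound is all that
    uniform convergence gives; a smaller finite radius settles both.\<close>
  obtain e where e: "0 < e" "e < \<epsilon>" using dense[OF \<epsilon>] by blast
  then obtain c where c: "e = ennreal c" "0 < c"
    by (cases e) (auto simp: ennreal_less_zero_iff dest: less_trans)
  from rho_uniform[OF d c(2)]
  show "\<forall>\<^sub>F n in sequentially. rho T (\<nu>s n) \<in> U"
  proof eventually_elim
    case (elim n)
    have "skorohod_dist T d (rho T \<nu>) (rho T (\<nu>s n)) \<le> ennreal c"
      by (rule skorohod_dist_leI[OF time_changes_id]) (use elim c in auto)
    also have "\<dots> < \<epsilon>" using e c by simp
    finally show ?case
      using sub path_measure.rho_cadlag[OF path_measures(1)] by blast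
  qed
qed

end


section \<open>The moment condition\<close>

lemma total_mass_point_measure:
  assumes "m \<in> point_measures X"
  shows "total_mass m = real (num_atoms m)"
proof -
  obtain n :: nat where "emeasure m (space m) = of_nat n"
    using assms sets.top[of m] unfolding point_measures_def by blast
  then have "total_mass m = real n" by (simp add: total_mass_def measure_def)
  then show ?thesis by (simp add: num_atoms_def)
qed

text \<open>The criterion of de la Vallee Poussin: superlinear growth gives r \<le> (\<epsilon> /
  \<beta>) * f r for large r, and integrating this against \<nu> turns the bound \<beta> into
  \<epsilon>. R depends only on f, \<beta> and \<epsilon>, hence is common to the whole
  class.\<close>

lemma moment_bounded_tail:
  fixes f :: "nat \<Rightarrow> real"
  assumes f: "filterlim (\<lambda>r. f r / real r) at_top sequentially" and T: "0 < T" and \<beta>: "0 < \<beta>" and \<epsilon>: "0 < \<epsilon>"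
  shows "\<exists>R\<ge>0. \<forall>\<nu>\<in>moment_bounded T f \<beta>. (\<integral>\<^sup>+\<xi>. ennreal (total_mass (\<xi> 0) - R) \<partial>\<nu>) \<le> ennreal \<epsilon>"
proof -
  have "\<forall>\<^sub>F r in sequentially. \<beta> / \<epsilon> \<le> f r / real r"
    using f by (simp add: filterlim_at_top)
  then obtain R where R: "\<And>r. R \<le> r \<Longrightarrow> \<beta> / \<epsilon> \<le> f r / real r"
    unfolding eventually_sequentially by blast
  have "(\<integral>\<^sup>+\<xi>. ennreal (total_mass (\<xi> 0) - real R) \<partial>\<nu>) \<le> ennreal \<epsilon>" if \<nu>: "\<nu> \<in> moment_bounded T f \<beta>" for \<nu>
  proof -
    have fm: "\<nu> \<in> finite_measures (coag_path_topology T)"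
      and m: "(\<integral>\<^sup>+\<xi>. ennreal (f (num_atoms (\<xi> 0))) \<partial>\<nu>) \<le> ennreal \<beta>"
      using \<nu> by (auto simp: moment_bounded_def)
    have sp: "space \<nu> = coag_paths T" using finite_measuresD(3)[OF fm] by (simp add: topspace_coag_path_topology)
    have mass: "(\<lambda>\<xi>. total_mass (\<xi> 0)) \<in> borel_measurable \<nu>"
      using T by (intro continuous_map_borel_measurable[OF continuous_map_initial_mass finite_measuresD(2)[OF fm]]) simp
    have "(\<lambda>\<xi>. num_atoms (\<xi> 0)) \<in> measurable \<nu> (count_space UNIV)"
      unfolding num_atoms_def using mass by measurable
    then have fmeas: "(\<lambda>\<xi>. f (num_atoms (\<xi> 0))) \<in> borel_measurable \<nu>"
      by (rule measurable_compose) simp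
    have "(\<integral>\<^sup>+\<xi>. ennreal (total_mass (\<xi> 0) - real R) \<partial>\<nu>) \<le>
        (\<integral>\<^sup>+\<xi>. ennreal (\<epsilon> / \<beta>) * ennreal (f (num_atoms (\<xi> 0))) \<partial>\<nu>)"
    proof (rule nn_integral_mono)
      fix \<xi> assume "\<xi> \<in> space \<nu>"
      then have "total_mass (\<xi> 0) = real (num_atoms (\<xi> 0))"
        using T by (intro total_mass_point_measure[OF coag_pathsD(1)[of _ T]]) (auto simp: sp)
      moreover have "ennreal (real r - real R) \<le> ennreal (\<epsilon> / \<beta>) * ennreal (f r)" for r
      proof (cases "R < r")
        \<comment> \<open>Strictness makes r positive, so that the quotient f r / r can be
          multiplied out; for r \<le> R the left side is 0 by truncation.\<close>
        case True
        then have "\<beta> / \<epsilon> * real r \<le> f r" using R[of r] by (simp add: pos_le_divide_eq)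
        then have "\<epsilon> / \<beta> * (\<beta> / \<epsilon> * real r) \<le> \<epsilon> / \<beta> * f r"
          using \<beta> \<epsilon> by (intro mult_left_mono) auto
        then have "real r \<le> \<epsilon> / \<beta> * f r" using \<beta> \<epsilon> by simp
        then have "ennreal (real r - real R) \<le> ennreal (\<epsilon> / \<beta> * f r)" by (intro ennreal_leI) simp
        also have "\<dots> = ennreal (\<epsilon> / \<beta>) * ennreal (f r)"
          using \<beta> \<epsilon> by (intro ennreal_mult') simp
        finally show ?thesis .
      qed (simp add: ennreal_neg)
      ultimately show "ennreal (total_mass (\<xi> 0) - real R) \<le> ennreal (\<epsilon> / \<beta>) * ennreal (f (num_atoms (\<xi> 0)))"
        by simp
    qed
    also have "\<dots> = ennreal (\<epsilon> / \<beta>) * (\<integral>\<^sup>+\<xi>. ennreal (f (num_atoms (\<xi> 0))) \<partial>\<nu>)"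
      by (intro nn_integral_cmult measurable_compose[OF fmeas measurable_ennreal])
    also have "\<dots> \<le> ennreal (\<epsilon> / \<beta>) * ennreal \<beta>" by (intro mult_left_mono m) simp
    also have "\<dots> = ennreal \<epsilon>" using \<beta> \<epsilon> by (simp add: ennreal_mult'[symmetric])
    finally show ?thesis .
  qed
  then show ?thesis by (intro exI[of _ "real R"]) auto
qed

theorem lemma2p5:
  fixes K :: "'a::polish_space \<times> nat \<Rightarrow> 'a \<times> nat \<Rightarrow> real"
    and \<Upsilon> :: "'a \<times> nat \<Rightarrow> 'a \<times> nat \<Rightarrow> 'a measure"
    and \<mu> :: "'a measure"
    and T \<beta> :: real
    and f :: "nat \<Rightarrow> real"
    and \<nu>seq :: "nat \<Rightarrow> (real \<Rightarrow> ('a \<times> nat) measure) measure"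
    and \<nu> :: "(real \<Rightarrow> ('a \<times> nat) measure) measure"
  assumes "coagulation_kernel K"
    and "placement_kernel \<Upsilon>"
    and "\<mu> \<in> probability_measures euclidean"
    and "0 < T"
    and "kernel_bound K < \<infinity>"
    and "0 < \<beta>"
    and "\<forall>r\<ge>1. 0 \<le> f r"
    and "filterlim (\<lambda>r. f r / real r) at_top sequentially"
    and "\<forall>n. \<nu>seq n \<in> moment_bounded T f \<beta>"
    and "\<nu> \<in> finite_measures (coag_path_topology T)"
    and "limitin (weak_topology (coag_path_topology T)) \<nu>seq \<nu> sequentially"
    and "\<exists>b>0.
           emeasure (reference_measure K \<Upsilon> T (scale_measure (ennreal b) \<mu>))
             (space (reference_measure K \<Upsilon> T (scale_measure (ennreal b) \<mu>))) < \<infinity> \<and>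
           rel_entropy \<nu> (reference_measure K \<Upsilon> T (scale_measure (ennreal b) \<mu>)) < \<infinity>"
  shows "(\<forall>n. rho T (\<nu>seq n) \<in> cadlag T (weak_topology particles)) \<and>
         limitin (skorohod_topology T (weak_topology particles))
           (\<lambda>n. rho T (\<nu>seq n)) (rho T \<nu>) sequentially"
proof -
  interpret uniformly_integrable_sequence T \<nu>seq \<nu>
  proof
    show "\<nu>seq n \<in> finite_measures (coag_path_topology T)" for n
      using assms(9) by (simp add: moment_bounded_def)
    show "\<exists>R\<ge>0. \<forall>n. (\<integral>\<^sup>+\<xi>. ennreal (total_mass (\<xi> 0) - R) \<partial>\<nu>seq n) \<le> ennreal \<epsilon>" if "0 < \<epsilon>" for \<epsilon>
      using moment_bounded_tail[OF assms(8,4,6) that] assms(9) by blast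
  qed (fact assms)+
  obtain b where b: "rel_entropy \<nu> (reference_measure K \<Upsilon> T (scale_measure (ennreal b) \<mu>)) < \<infinity>"
    using assms(12) by blast
  interpret jump_free_limit T \<nu>seq \<nu>
  proof
    show "AE \<xi> in \<nu>. (\<integral>x. g x \<partial>left_limit \<xi> t) = (\<integral>x. g x \<partial>\<xi> t)"
      if "t \<in> {0<..T}" "bounded_continuous particles g" for t g
      using path_measure.AE_left_continuous[OF path_measures(2) that b] .
  qed
  show ?thesis
    using rho_skorohod_tendsto path_measure.rho_cadlag[OF path_measures(1)] by blast
qed

end
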